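(* For any $\delta>0$ there exists $c_\delta>0$ such that the following holds. For each $n$, let $t^{(n)}$ be a cycle type of size $n$ such that $t_1^{(n)}=0$ and let $\tau_n$ be a uniformly random $t^{(n)}$-cyclic permutation. Then: $$\mathbf{P}\left(\frac{1}{\sqrt n}\mathrm{LIS}(\tau_n)<2(1-\delta)\right)\le \exp(-c_\delta n)\quad\text{and}\quad\mathbf{P}\left(\frac{1}{\sqrt n}\mathrm{LIS}(\tau_n)>2(1+\delta)\sqrt3\right)\le\exp(-c_\delta\sqrt n).$$
   Context: A cycle type of size $n$ is a sequence $t=(t_1,\dots,t_n)$ of nonnegative integers with $\sum_{p=1}^n p\,t_p=n$; a permutation of $[n]=\{1,\dots,n\}$ is $t$-cyclic if it has exactly $t_p$ cycles of length $p$ for every $p$ (fixed points are $1$-cycles). $\mathrm{LIS}(\tau)$ is the maximum length $\ell$ of an increasing subsequence of $\tau$, i.e. of indices $i_1<\dots<i_\ell$ with $\tau(i_1)<\dots<\tau(i_\ell)$.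
   Formalization: The bounds are proved for all n at least some threshold depending only on δ, not for each n: for n = 2 the only type has τ = (1 2), LIS = 1, so the first bound fails for small δ, and for n = 1 no cycle type with t_1 = 0 exists. *)

theory Defs
  imports "HOL-Probability.Probability" "HOL-Combinatorics.Combinatorics"
begin

text \<open>
  A sequence $(t_1,\dots,t_n)$ is represented by a function on the naturals of which only the
  values at $1,\dots,n$ matter.
\<close>

definition is_cycle_type :: "nat \<Rightarrow> (nat \<Rightarrow> nat) \<Rightarrow> bool" where
  "is_cycle_type n t \<longleftrightarrow> (\<Sum>p=1..n. p * t p) = n"

text \<open>
  The cycles of a permutation of $[n]$ are identified with its orbits on $[n]$; a fixed point
  \<open>x\<close> contributes the orbit \<open>{x}\<close>, i.e. a 1-cycle.
\<close>

definition num_cycles :: "nat \<Rightarrow> (nat \<Rightarrow> nat) \<Rightarrow> nat \<Rightarrow> nat" where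
  "num_cycles n \<tau> p = card {C \<in> orbit \<tau> ` {1..n}. card C = p}"

definition cyclic_perms :: "nat \<Rightarrow> (nat \<Rightarrow> nat) \<Rightarrow> (nat \<Rightarrow> nat) set" where
  "cyclic_perms n t = {\<tau>. \<tau> permutes {1..n} \<and> (\<forall>p\<in>{1..n}. num_cycles n \<tau> p = t p)}"

text \<open>
  An increasing subsequence is given by its set \<open>I\<close> of indices. The maximum is over a finite set
  containing 0, because the empty set of indices is allowed.
\<close>

definition LIS :: "nat \<Rightarrow> (nat \<Rightarrow> nat) \<Rightarrow> nat" where
  "LIS n \<tau> = Max {card I | I. I \<subseteq> {1..n} \<and> strict_mono_on I \<tau>}"

text \<open>
  This is only meaningful if \<open>cyclic_perms n t\<close> is nonempty, as it is for every cycle type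
  \<open>t\<close> of size \<open>n\<close>.
\<close>

definition random_cyclic_perm :: "nat \<Rightarrow> (nat \<Rightarrow> nat) \<Rightarrow> (nat \<Rightarrow> nat) pmf" where
  "random_cyclic_perm n t = pmf_of_set (cyclic_perms n t)"

end

theory Submission
  imports Defs
begin

text \<open>
  A uniform element of a conjugation-invariant set may be conjugated by an independent uniform
  \<open>g\<close>, so both bounds reduce to a fixed permutation without fixed points and a uniform \<open>g\<close>.

  Upper tail: an increasing partial map without fixed points has no cycles, hence a given one of
  size \<open>k\<close>, of order \<open>sqrt n\<close>, is contained in the conjugate with probability \<open>O(n powr - k)\<close>.
  The first moment method then gives the constant \<open>exp 1 < 3 < 2 * sqrt 3\<close>.

  Lower tail: cut the square into boxes with side of order \<open>sqrt n\<close> and add up the longest chains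
  of the boxes of a strip parallel to the diagonal. There are of order \<open>sqrt n\<close> disjoint strips,
  so the average over the strips is concentrated at speed \<open>n\<close>, since a transposition of \<open>g\<close>
  changes the total by at most 4. Off the diagonal the points of a box form, given their number, a
  uniform tie-free configuration, and so do those of a Bernoulli field. For the latter the sharp
  constant 2 comes from stationary last passage percolation (after Cator and Groeneboom): with
  sources and sinks of product Bernoulli law the passage time is exactly computable, and a
  comparison with slightly perturbed boundary densities shows that the optimal path leaves the
  axes early, so the passage time is carried by the bulk.
\<close>

subsection \<open>Conjugation and cycle types\<close>

text \<open>One \<open>g\<close> moves rows and columns together and the cycle type is arbitrary, so
  the dependence between boxes is out of reach. The lower tail never uses it: the mean of the total
  is bounded from single boxes by linearity, and concentration is a separate argument. A box off the
  diagonal has disjoint sets of row and column labels, which one \<open>g\<close> can permute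
  independently; this is why the strips avoid the diagonal. The side is about
  \<open>A * sqrt n\<close> with \<open>A\<close> depending only on the accuracy \<epsilon>, so a
  box holds about \<open>A ^ 2\<close> points however large \<open>n\<close> is. About
  \<open>\<epsilon> * n / A ^ 2\<close> boxes are used; giving up \<open>\<epsilon> * A\<close> in
  each is a deviation of order \<open>n\<close>, which has probability at most
  \<open>exp (- c * n)\<close>. The upper constant comes from choosing rows and columns freely:
  \<open>(n choose k) ^ 2 * n powr - k\<close> is at most \<open>(exp 2 * n / k ^ 2) ^ k\<close>,
  small once \<open>k > exp 1 * sqrt n\<close>. The sharp 2 comes from a quadratic cost against a
  linear gain: changing the boundary odds by the factors \<open>r\<close> and \<open>1 / r\<close>
  costs order \<open>(r - 1) ^ 2\<close>, while a path that leaves the axes late gains order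
  \<open>r - 1\<close>.\<close>

lemma LIS_finite: "finite {card I | I. I \<subseteq> {1..n::nat} \<and> strict_mono_on I \<tau>}"
proof -
  have "{card I | I. I \<subseteq> {1..n} \<and> strict_mono_on I \<tau>} \<subseteq> card ` Pow {1..n}" by auto
  thus ?thesis by (rule finite_subset[OF _ finite_imageI]) auto
qed

lemma LIS_ge: "I \<subseteq> {1..n} \<Longrightarrow> strict_mono_on I \<tau> \<Longrightarrow> card I \<le> LIS n \<tau>"
  unfolding LIS_def by (rule Max_ge[OF LIS_finite]) auto

lemma LIS_attained: "\<exists>I. I \<subseteq> {1..n} \<and> strict_mono_on I \<tau> \<and> card I = LIS n \<tau>"
proof -
  have "LIS n \<tau> \<in> {card I | I. I \<subseteq> {1..n} \<and> strict_mono_on I \<tau>}"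
    unfolding LIS_def
  proof (rule Max_in[OF LIS_finite])
    have "card {} \<in> {card I | I. I \<subseteq> {1..n} \<and> strict_mono_on I \<tau>}"
      by (intro CollectI exI[of _ "{}"]) (auto simp: strict_mono_on_def)
    thus "{card I | I. I \<subseteq> {1..n} \<and> strict_mono_on I \<tau>} \<noteq> {}" by blast
  qed
  thus ?thesis by auto
qed

definition conj_by :: "('a \<Rightarrow> 'a) \<Rightarrow> ('a \<Rightarrow> 'a) \<Rightarrow> 'a \<Rightarrow> 'a" where
  "conj_by g \<tau> = g \<circ> \<tau> \<circ> inv g"

lemma conj_by_permutes:
  "g permutes S \<Longrightarrow> \<tau> permutes S \<Longrightarrow> conj_by g \<tau> permutes S"
  unfolding conj_by_def by (intro permutes_compose permutes_inv) auto

lemma conj_by_inv: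
  assumes "g permutes S" shows "conj_by (inv g) (conj_by g \<tau>) = \<tau>"
  using permutes_inv_o[OF assms] permutes_inv_inv[OF assms]
  by (auto simp: conj_by_def fun_eq_iff permutes_inverses[OF assms])

lemma conj_by_comp:
  assumes "g permutes S" "h permutes S"
  shows "conj_by (g \<circ> h) \<tau> = conj_by g (conj_by h \<tau>)"
  using permutes_bij[OF assms(1)] permutes_bij[OF assms(2)]
  by (simp add: conj_by_def o_inv_distrib o_assoc)

lemma orbit_conj_by:
  assumes "bij g"
  shows "orbit (conj_by g \<tau>) (g x) = g ` orbit \<tau> x"
proof -
  have pow: "(conj_by g \<tau> ^^ k) (g x) = g ((\<tau> ^^ k) x)" for k
    by (induction k) (auto simp: conj_by_def inv_f_f[OF bij_is_inj[OF assms]])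
  show ?thesis
    unfolding orbit_altdef by (auto simp: pow)
qed

lemma num_cycles_conj_by:
  assumes g: "g permutes {1..n}"
  shows "num_cycles n (conj_by g \<tau>) p = num_cycles n \<tau> p"
proof -
  have bij: "bij g" by (rule permutes_bij[OF g])
  have inj: "inj g" by (rule bij_is_inj[OF bij])
  have "orbit (conj_by g \<tau>) ` {1..n} = (\<lambda>C. g ` C) ` orbit \<tau> ` {1..n}"
  proof -
    have "orbit (conj_by g \<tau>) ` {1..n} = orbit (conj_by g \<tau>) ` g ` {1..n}"
      using permutes_image[OF g] by simp
    also have "\<dots> = (\<lambda>C. g ` C) ` orbit \<tau> ` {1..n}"
      unfolding image_image by (simp add: orbit_conj_by[OF bij])
    finally show ?thesis .
  qed
  hence "{C \<in> orbit (conj_by g \<tau>) ` {1..n}. card C = p} = (\<lambda>C. g ` C) ` {C \<in> orbit \<tau> ` {1..n}. card C = p}"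
    using card_image[OF inj_on_subset[OF inj]] by auto
  moreover have "inj_on (\<lambda>C. g ` C) A" for A
    using inj by (intro inj_onI) (simp add: inj_image_eq_iff)
  ultimately show ?thesis
    unfolding num_cycles_def by (simp add: card_image)
qed

lemma conj_by_cyclic_perms:
  assumes "g permutes {1..n}" "\<tau> \<in> cyclic_perms n t"
  shows "conj_by g \<tau> \<in> cyclic_perms n t"
  using assms by (auto simp: cyclic_perms_def num_cycles_conj_by conj_by_permutes)

lemma finite_cyclic_perms: "finite (cyclic_perms n t)"
  by (rule finite_subset[OF _ finite_permutations[of "{1..n}"]]) (auto simp: cyclic_perms_def)

text \<open>This is how \<open>t 1 = 0\<close> enters; both tails work with the absence of fixed
  points.\<close>

lemma cyclic_perms_no_fixpoint:
  assumes "\<tau> \<in> cyclic_perms n t" "t 1 = 0" "x \<in> {1..n}"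
  shows "\<tau> x \<noteq> x"
proof
  assume "\<tau> x = x"
  hence "orbit \<tau> x = {x}" by (simp add: orbit_eq_singleton_iff)
  hence "{x} \<in> {C \<in> orbit \<tau> ` {1..n}. card C = 1}" using assms(3) by force
  moreover have "num_cycles n \<tau> 1 = 0" using assms by (auto simp: cyclic_perms_def)
  hence "{C \<in> orbit \<tau> ` {1..n}. card C = 1} = {}" unfolding num_cycles_def by simp
  ultimately show False by blast
qed

section \<open>Existence of permutations with prescribed cycle lengths\<close>

lemma cycle_on_finite_set:
  assumes "finite S" "S \<noteq> {}"
  shows "\<exists>\<tau>. \<tau> permutes S \<and> (\<forall>x\<in>S. orbit \<tau> x = S)"
proof -
  define l where "l = card S"
  have l: "l > 0" using assms by (auto simp: l_def card_gt_0_iff)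
  obtain h where h: "bij_betw h {0..<l} S"
    using ex_bij_betw_nat_finite[OF assms(1)] l_def by blast
  define h' where "h' = inv_into {0..<l} h"
  have h'h: "h' (h i) = i" if "i < l" for i
    unfolding h'_def using h that by (intro inv_into_f_f) (auto simp: bij_betw_def)
  define \<tau> where "\<tau> x = (if x \<in> S then h ((h' x + 1) mod l) else x)" for x
  have hS: "h i \<in> S" if "i < l" for i using h that by (auto simp: bij_betw_def)
  have step: "\<tau> (h i) = h ((i + 1) mod l)" if "i < l" for i
    using that by (simp add: \<tau>_def hS h'h)
  have pow: "(\<tau> ^^ k) (h i) = h ((i + k) mod l)" if "i < l" for i k
    using that l by (induction k) (auto simp: step mod_Suc_eq)
  have surj: "\<exists>i<l. y = h i" if "y \<in> S" for y
    using h that by (auto simp: bij_betw_def)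
  have orb: "orbit \<tau> x = S" if x: "x \<in> S" for x
  proof -
    obtain i where i: "i < l" "x = h i" using surj[OF x] by auto
    show ?thesis
    proof
      show "orbit \<tau> x \<subseteq> S" unfolding orbit_altdef using i pow hS l by auto
      show "S \<subseteq> orbit \<tau> x"
      proof
        fix y assume "y \<in> S"
        then obtain j where j: "j < l" "y = h j" using surj by auto
        \<comment> \<open>The exponent \<open>l - i + j\<close> replaces \<open>j - i\<close>: it is
          positive, as the iterates that make up an orbit must be.\<close>
        have "(i + (l - i + j)) mod l = j" using i j by simp
        moreover have "0 < l - i + j" using i by simp
        moreover have "(\<tau> ^^ (l - i + j)) x = h ((i + (l - i + j)) mod l)"
          using pow[OF i(1)] i(2) by simp
        ultimately have "0 < l - i + j \<and> y = (\<tau> ^^ (l - i + j)) x" using j(2) by metis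
        thus "y \<in> orbit \<tau> x" unfolding orbit_altdef by blast
      qed
    qed
  qed
  have "\<tau> ` S = S"
  proof
    show "\<tau> ` S \<subseteq> S" using hS l by (auto simp: \<tau>_def)
    show "S \<subseteq> \<tau> ` S"
    proof
      fix y assume "y \<in> S"
      then obtain j where j: "j < l" "y = h j" using surj by auto
      \<comment> \<open>Modulo \<open>l\<close>, the index \<open>j + (l - 1)\<close> is the
        predecessor of \<open>j\<close>.\<close>
      have "((j + (l - 1)) mod l + 1) mod l = (j + (l - 1) + 1) mod l" by (rule mod_add_left_eq)
      also have "j + (l - 1) + 1 = j + l" using l by simp
      also have "(j + l) mod l = j" using j by simp
      finally have "((j + (l - 1)) mod l + 1) mod l = j" .
      hence "\<tau> (h ((j + (l - 1)) mod l)) = y" using step[of "(j + (l - 1)) mod l"] l j by simp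
      thus "y \<in> \<tau> ` S" using hS[of "(j + (l - 1)) mod l"] l by force
    qed
  qed
  hence "bij_betw \<tau> S S"
    using assms(1) by (auto simp: bij_betw_def intro: eq_card_imp_inj_on)
  hence "\<tau> permutes S" by (rule bij_imp_permutes) (auto simp: \<tau>_def)
  thus ?thesis using orb by blast
qed

lemma exists_perm_with_cycle_lengths:
  assumes "finite S" "card S = sum_list ls" "\<forall>l\<in>set ls. l > 0"
  shows "\<exists>\<tau>. \<tau> permutes S \<and> (\<forall>p. card {C \<in> orbit \<tau> ` S. card C = p} = count_list ls p)"
  using assms
proof (induction ls arbitrary: S)
  case Nil
  thus ?case by (intro exI[of _ id]) auto
next
  case (Cons l ls)
  obtain S1 where S1: "S1 \<subseteq> S" "card S1 = l" "finite S1"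
    using obtain_subset_with_card_n[of l S] Cons.prems by auto
  define S2 where "S2 = S - S1"
  have S2: "finite S2" "card S2 = sum_list ls" "S = S1 \<union> S2" "S1 \<inter> S2 = {}"
    using Cons.prems S1 by (auto simp: S2_def card_Diff_subset)
  obtain \<tau>2 where t2: "\<tau>2 permutes S2"
      "\<And>p. card {C \<in> orbit \<tau>2 ` S2. card C = p} = count_list ls p"
    using Cons.IH[of S2] S2 Cons.prems by auto
  have "S1 \<noteq> {}" using S1 Cons.prems by auto
  then obtain \<tau>1 where t1: "\<tau>1 permutes S1" "\<And>x. x \<in> S1 \<Longrightarrow> orbit \<tau>1 x = S1"
    using cycle_on_finite_set[OF S1(3)] by blast
  define \<tau> where "\<tau> = \<tau>1 \<circ> \<tau>2"
  have perm: "\<tau> permutes S" unfolding \<tau>_def S2(3)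
    using t1 t2 by (intro permutes_compose) (auto intro: permutes_subset)
  have e1: "\<tau> z = \<tau>1 z" if "z \<in> S1" for z
  proof -
    have "z \<notin> S2" using that S2(4) by blast
    thus ?thesis using t2(1) by (simp add: \<tau>_def permutes_not_in)
  qed
  have e2: "\<tau> z = \<tau>2 z" if "z \<in> S2" for z
  proof -
    have "\<tau>2 z \<notin> S1" using that S2(4) permutes_in_image[OF t2(1), of z] by blast
    thus ?thesis using t1(1) by (simp add: \<tau>_def permutes_not_in)
  qed
  have pow: "(\<tau> ^^ k) x = (\<sigma> ^^ k) x \<and> (\<sigma> ^^ k) x \<in> X"
    if "x \<in> X" "\<sigma> permutes X" "\<And>z. z \<in> X \<Longrightarrow> \<tau> z = \<sigma> z" for x k \<sigma> X
    using that by (induction k) (auto simp: permutes_in_image)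
  have pow1: "(\<tau> ^^ k) x = (\<tau>1 ^^ k) x" "(\<tau>1 ^^ k) x \<in> S1" if "x \<in> S1" for x k
    using pow[OF that t1(1) e1] by auto
  have pow2: "(\<tau> ^^ k) x = (\<tau>2 ^^ k) x" "(\<tau>2 ^^ k) x \<in> S2" if "x \<in> S2" for x k
    using pow[OF that t2(1) e2] by auto
  have o1: "orbit \<tau> x = S1" if "x \<in> S1" for x
    using t1(2)[OF that] pow1[OF that] unfolding orbit_altdef by auto
  have o2: "orbit \<tau> x = orbit \<tau>2 x" if "x \<in> S2" for x
    using pow2[OF that] unfolding orbit_altdef by auto
  have o2S: "orbit \<tau>2 x \<subseteq> S2" "orbit \<tau>2 x \<noteq> {}" if "x \<in> S2" for x
    using pow2(2)[OF that] unfolding orbit_altdef by auto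
  have im: "orbit \<tau> ` S = insert S1 (orbit \<tau>2 ` S2)"
    unfolding S2(3) image_Un using o1 o2 \<open>S1 \<noteq> {}\<close> by (auto simp: image_iff)
  have notin: "S1 \<notin> orbit \<tau>2 ` S2" using o2S S2(4) by blast
  have "card {C \<in> orbit \<tau> ` S. card C = p} = count_list (l # ls) p" for p
  proof (cases "p = l")
    case True
    hence "{C \<in> orbit \<tau> ` S. card C = p} = insert S1 {C \<in> orbit \<tau>2 ` S2. card C = p}"
      unfolding im using S1 by auto
    thus ?thesis using True notin t2(2)[of p] S2(1) by simp
  next
    case False
    hence "{C \<in> orbit \<tau> ` S. card C = p} = {C \<in> orbit \<tau>2 ` S2. card C = p}"
      unfolding im using S1 by auto
    thus ?thesis using False t2(2)[of p] by simp
  qed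
  thus ?case using perm by blast
qed

text \<open>Makes the uniform law in \<open>random_cyclic_perm\<close> meaningful. The list
  \<open>ls\<close> in the proof contains each length \<open>p\<close> exactly \<open>t p\<close>
  times.\<close>

lemma cyclic_perms_nonempty:
  assumes "is_cycle_type n t"
  shows "cyclic_perms n t \<noteq> {}"
proof -
  define ls where "ls = concat (map (\<lambda>p. replicate (t p) p) [1..<n+1])"
  have "sum_list ls = (\<Sum>p\<leftarrow>[1..<n+1]. p * t p)"
    unfolding ls_def by (induction n) (auto simp: sum_list_replicate mult.commute)
  also have "\<dots> = (\<Sum>p\<in>{1..n}. p * t p)"
    by (subst sum_set_upt_conv_sum_list_nat [symmetric]) (rule sum.cong, auto)
  finally have sum: "card {1..n} = sum_list ls" using assms by (simp add: is_cycle_type_def)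
  have pos: "\<forall>l\<in>set ls. l > 0" by (auto simp: ls_def)
  have cnt: "count_list (concat (map (\<lambda>p. replicate (t p) p) xs)) p = (if p \<in> set xs then t p else 0)"
    if "distinct xs" for xs p
  proof -
    have "count_list (replicate k a) p = (if a = p then k else 0)" for k a
      by (induction k) auto
    thus ?thesis using that by (induction xs) auto
  qed
  obtain \<tau> where \<tau>: "\<tau> permutes {1..n}" "\<And>p. card {C \<in> orbit \<tau> ` {1..n}. card C = p} = count_list ls p"
    using exists_perm_with_cycle_lengths[OF _ sum pos] by auto
  have "count_list ls p = t p" if "p \<in> {1..n}" for p
    unfolding ls_def using that by (subst cnt) auto
  hence "\<tau> \<in> cyclic_perms n t" using \<tau> by (auto simp: cyclic_perms_def num_cycles_def)
  thus ?thesis by blast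
qed

text \<open>Counts the pairs of \<open>g\<close> and \<open>\<tau>\<close> whose conjugate lies in
  \<open>E\<close> in two ways: each \<open>conj_by g\<close> is a bijection of
  \<open>cyclic_perms n t\<close>, so every \<open>g\<close> contributes the same number, while each
  \<open>\<tau>\<close> contributes at most \<open>B * fact n\<close>.\<close>

lemma prob_random_cyclic_perm_le:
  assumes ct: "is_cycle_type n t"
    and bound: "\<And>\<tau>. \<tau> \<in> cyclic_perms n t \<Longrightarrow>
      real (card {g. g permutes {1..n} \<and> conj_by g \<tau> \<in> E}) \<le> B * fact n"
  shows "measure_pmf.prob (random_cyclic_perm n t) E \<le> B"
proof -
  define C where "C = cyclic_perms n t"
  define P where "P = {g. g permutes {1..n}}"
  have fC: "finite C" "C \<noteq> {}" unfolding C_def using finite_cyclic_perms cyclic_perms_nonempty[OF ct] by auto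
  have fP: "finite P" "card P = fact n" unfolding P_def
    by (simp_all add: finite_permutations card_permutations)
  have bij: "bij_betw (conj_by g) C C" if g: "g \<in> P" for g
  proof (rule bij_betw_byWitness[where f' = "conj_by (inv g)"])
    have g': "g permutes {1..n}" "inv g permutes {1..n}" using g by (auto simp: P_def permutes_inv)
    show "\<forall>a\<in>C. conj_by (inv g) (conj_by g a) = a" using conj_by_inv[OF g'(1)] by auto
    show "\<forall>a\<in>C. conj_by g (conj_by (inv g) a) = a"
      using conj_by_inv[OF g'(2)] permutes_inv_inv[OF g'(1)] by auto
    show "conj_by g ` C \<subseteq> C" "conj_by (inv g) ` C \<subseteq> C"
      using g' by (auto simp: C_def intro!: conj_by_cyclic_perms)
  qed
  have eq: "real (card (C \<inter> E)) = (\<Sum>\<tau>\<in>C. if \<tau> \<in> E then 1 else 0)"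
    using fC by (simp add: sum.If_cases Int_def)
  have "fact n * real (card (C \<inter> E)) = (\<Sum>g\<in>P. \<Sum>\<tau>\<in>C. if \<tau> \<in> E then 1 else 0)"
    using fP eq by simp
  also have "\<dots> = (\<Sum>g\<in>P. \<Sum>\<tau>\<in>C. if conj_by g \<tau> \<in> E then 1 else 0)"
    by (intro sum.cong refl sum.reindex_bij_betw[OF bij, symmetric])
  also have "\<dots> = (\<Sum>\<tau>\<in>C. \<Sum>g\<in>P. if conj_by g \<tau> \<in> E then 1 else 0)" by (rule sum.swap)
  also have "\<dots> = (\<Sum>\<tau>\<in>C. real (card {g. g permutes {1..n} \<and> conj_by g \<tau> \<in> E}))"
  proof (intro sum.cong refl)
    fix \<tau>
    have "{g. g permutes {1..n} \<and> conj_by g \<tau> \<in> E} = P \<inter> {g. conj_by g \<tau> \<in> E}"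
      unfolding P_def by blast
    thus "(\<Sum>g\<in>P. if conj_by g \<tau> \<in> E then 1 else 0)
        = real (card {g. g permutes {1..n} \<and> conj_by g \<tau> \<in> E})"
      using fP(1) by (simp only: sum.If_cases) simp
  qed
  also have "\<dots> \<le> (\<Sum>\<tau>\<in>C. B * fact n)"
    by (intro sum_mono bound) (auto simp: C_def)
  also have "\<dots> = fact n * (B * card C)" by simp
  finally have "real (card (C \<inter> E)) \<le> B * card C" by simp
  moreover have "measure_pmf.prob (random_cyclic_perm n t) E = card (C \<inter> E) / card C"
    unfolding random_cyclic_perm_def C_def[symmetric] by (rule measure_pmf_of_set[OF fC(2,1)])
  ultimately show ?thesis using fC by (simp add: divide_le_eq card_gt_0_iff)
qed

subsection \<open>The upper tail: first moment\<close>

text \<open>Ranks decide: both maps send \<open>x\<close> to the element of the common image with as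
  many elements below it as \<open>x\<close> has in \<open>A\<close>.\<close>

lemma strict_mono_on_unique:
  fixes f f' :: "'a::linorder \<Rightarrow> 'b::linorder"
  assumes "finite A" "strict_mono_on A f" "strict_mono_on A f'" "f ` A = f' ` A" "x \<in> A"
  shows "f x = f' x"
proof -
  have below: "card {b \<in> h ` A. b < h x} = card {y \<in> A. y < x}" if "strict_mono_on A h" for h :: "'a \<Rightarrow> 'b"
  proof -
    have "{b \<in> h ` A. b < h x} = h ` {y \<in> A. y < x}"
      using strict_mono_on_less[OF that] assms(5) by auto
    moreover have "inj_on h {y \<in> A. y < x}"
      using strict_mono_on_imp_inj_on[OF that] by (rule inj_on_subset) auto
    ultimately show ?thesis by (simp add: card_image)
  qed
  have mono: "card {b \<in> f ` A. b < p} < card {b \<in> f ` A. b < q}" if "p \<in> f ` A" "p < q" for p q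
    using that assms(1) by (intro psubset_card_mono) auto
  have "card {b \<in> f ` A. b < f x} = card {b \<in> f ` A. b < f' x}"
    using below[OF assms(2)] below[OF assms(3)] assms(4) by simp
  moreover have "f x \<in> f ` A" "f' x \<in> f ` A" using assms by auto
  ultimately show ?thesis
    using mono[of "f x" "f' x"] mono[of "f' x" "f x"] by (cases "f x" "f' x" rule: linorder_cases) auto
qed

text \<open>Composing a fixed member with the inverses of all members gives permutations that fix
  \<open>V\<close> pointwise, hence permutations of \<open>X - V\<close>.\<close>

lemma card_perms_inv_agree_le:
  fixes F :: "('a \<Rightarrow> 'a) set"
  assumes X: "finite X" "V \<subseteq> X" and F: "\<And>p. p \<in> F \<Longrightarrow> p permutes X"
    and agree: "\<And>p q x. p \<in> F \<Longrightarrow> q \<in> F \<Longrightarrow> x \<in> V \<Longrightarrow> inv p x = inv q x"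
  shows "card F \<le> fact (card X - card V)"
proof (cases "F = {}")
  case False
  then obtain p0 where p0: "p0 \<in> F" by blast
  define h where "h p = p0 \<circ> inv p" for p :: "'a \<Rightarrow> 'a"
  have "h p permutes (X - V)" if "p \<in> F" for p
  proof (rule permutes_superset)
    show "h p permutes X" unfolding h_def using F that p0 by (intro permutes_compose permutes_inv) auto
    show "h p x = x" if "x \<in> X - (X - V)" for x
      using that agree[OF \<open>p \<in> F\<close> p0, of x] by (auto simp: h_def permutes_inverses[OF F[OF p0]])
  qed
  moreover have "inj_on h F"
  proof (rule inj_onI)
    fix p q assume pq: "p \<in> F" "q \<in> F" "h p = h q"
    have "inv p0 \<circ> h p = inv p0 \<circ> h q" using pq by simp
    hence "inv p = inv q"
      by (simp add: h_def o_assoc permutes_inv_o[OF F[OF p0]])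
    thus "p = q" using permutes_inv_inv[OF F] pq by metis
  qed
  moreover have "finite {q. q permutes (X - V)}" using X by (intro finite_permutations) auto
  ultimately have "card F \<le> card {q. q permutes (X - V)}"
    by (intro card_inj_on_le[of h]) auto
  also have "\<dots> = fact (card (X - V))" using X by (intro card_permutations) auto
  also have "card (X - V) = card X - card V" using X by (intro card_Diff_subset) (auto intro: finite_subset)
  finally show ?thesis .
qed auto

lemma card_le_fibres:
  assumes "finite H" "\<And>x. x \<in> S \<Longrightarrow> \<Phi> x \<in> H" "\<And>h. h \<in> H \<Longrightarrow> card {x \<in> S. \<Phi> x = h} \<le> m"
  shows "card S \<le> card H * m"
proof -
  have "S = (\<Union>h\<in>H. {x \<in> S. \<Phi> x = h})" using assms(2) by auto
  hence "card S \<le> (\<Sum>h\<in>H. card {x \<in> S. \<Phi> x = h})" using card_UN_le[OF assms(1)] by metis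
  also have "\<dots> \<le> (\<Sum>h\<in>H. m)" by (intro sum_mono assms(3))
  finally show ?thesis by simp
qed

text \<open>
  An increasing map without fixed points has no cycles, so a relabelling \<open>g\<close> is determined on
  \<open>A \<union> B\<close> by the values of \<open>inv g\<close> on \<open>A - B\<close>.
\<close>
lemma card_conj_strict_mono_le:
  assumes \<tau>: "\<tau> permutes {1..n}" "\<And>x. x \<in> {1..n} \<Longrightarrow> \<tau> x \<noteq> x"
    and AB: "A \<subseteq> {1..n}" "B \<subseteq> {1..n}" "card A = k" "card B = k"
  defines "v \<equiv> card (A \<union> B)"
  shows "card {g. g permutes {1..n} \<and> strict_mono_on A (conj_by g \<tau>) \<and> conj_by g \<tau> ` A = B}
    \<le> n ^ (v - k) * fact (n - v)"
proof -
  define S where "S = {g. g permutes {1..n} \<and> strict_mono_on A (conj_by g \<tau>) \<and> conj_by g \<tau> ` A = B}"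
  define V where "V = A \<union> B"
  have fin: "finite A" "finite B" "finite V" using AB by (auto intro: finite_subset simp: V_def)
  have VB: "card (V - B) = v - k"
    unfolding v_def V_def using fin AB by (subst card_Diff_subset) auto
  define \<Phi> where "\<Phi> g = restrict (inv g) (V - B)" for g :: "nat \<Rightarrow> nat"
  define H where "H = PiE (V - B) (\<lambda>_. {1..n})"
  have H: "finite H" "card H = n ^ (v - k)"
    unfolding H_def using fin VB by (auto intro!: finite_PiE simp: card_PiE)
  have \<Phi>H: "\<Phi> g \<in> H" if "g \<in> S" for g
  proof -
    have "inv g permutes {1..n}" using that by (auto simp: S_def permutes_inv)
    hence "inv g x \<in> {1..n}" if "x \<in> V" for x
      using that AB by (subst permutes_in_image) (auto simp: V_def)
    thus ?thesis unfolding \<Phi>_def H_def by auto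
  qed
  have agree: "inv g x = inv g' x"
    if g: "g \<in> S" "g' \<in> S" "\<Phi> g = \<Phi> g'" and x: "x \<in> V" for g g' x
  proof (rule ccontr)
    assume neq: "inv g x \<noteq> inv g' x"
    \<comment> \<open>\<open>D\<close> is where the two relabellings differ. Every point of
      \<open>D\<close> turns out to be the image under \<open>\<phi>\<close> of a point of
      \<open>D \<inter> A\<close>, so by counting \<open>D \<subseteq> A\<close> and
      \<open>\<phi>\<close> maps \<open>D\<close> onto itself. An increasing bijection of a finite
      set is the identity, so \<open>x\<close> would come from a fixed point of
      \<open>\<tau>\<close>.\<close>
    define D where "D = {y \<in> V. inv g y \<noteq> inv g' y}"
    have xD: "x \<in> D" using x neq by (simp add: D_def)
    have gp: "g permutes {1..n}" "g' permutes {1..n}" using g by (auto simp: S_def)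
    define \<phi> where "\<phi> = conj_by g \<tau>"
    have mono: "strict_mono_on A \<phi>" "\<phi> ` A = B" using g by (auto simp: S_def \<phi>_def)
    \<comment> \<open>Both conjugates are increasing from \<open>A\<close> onto \<open>B\<close>, so
      they agree on \<open>A\<close>.\<close>
    have \<phi>': "conj_by g' \<tau> u = \<phi> u" if "u \<in> A" for u
      using strict_mono_on_unique[of A "conj_by g' \<tau>" \<phi> u] g fin that by (auto simp: S_def \<phi>_def)
    have sub: "D \<subseteq> \<phi> ` (D \<inter> A)"
    proof
      fix y assume y: "y \<in> D"
      have "y \<in> B"
      proof (rule ccontr)
        assume "y \<notin> B"
        hence "\<Phi> g y = inv g y" "\<Phi> g' y = inv g' y" using y by (auto simp: \<Phi>_def D_def)
        thus False using y g by (simp add: D_def)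
      qed
      then obtain u where u: "u \<in> A" "y = \<phi> u" using mono by auto
      have 1: "inv g y = \<tau> (inv g u)"
        unfolding u(2) \<phi>_def conj_by_def using permutes_inverses[OF gp(1)] by simp
      have 2: "inv g' y = \<tau> (inv g' u)"
        unfolding u(2) \<phi>'[OF u(1), symmetric] conj_by_def using permutes_inverses[OF gp(2)] by simp
      have "inv g u \<noteq> inv g' u" using y 1 2 by (auto simp: D_def)
      thus "y \<in> \<phi> ` (D \<inter> A)" using u by (auto simp: D_def V_def)
    qed
    have fD: "finite D" using fin by (auto simp: D_def)
    have "card D \<le> card (D \<inter> A)"
      using card_mono[OF _ sub] card_image_le[of "D \<inter> A" \<phi>] fD by simp
    hence DA: "D \<subseteq> A" using fD by (metis Int_lower1 card_seteq inf.absorb_iff1)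
    have "card (\<phi> ` D) \<le> card D" by (rule card_image_le[OF fD])
    hence im: "\<phi> ` D = D" using sub DA fD by (metis card_seteq finite_imageI inf.absorb_iff1)
    have "\<phi> x = id x"
      using mono(1) DA im xD fD
      by (intro strict_mono_on_unique[of D]) (auto simp: strict_mono_on_def)
    hence "\<tau> (inv g x) = inv g x"
      unfolding \<phi>_def conj_by_def using permutes_inverses[OF gp(1)] by (metis comp_apply id_apply)
    moreover have "inv g x \<in> {1..n}"
      using permutes_in_image[OF permutes_inv[OF gp(1)], of x] x AB by (auto simp: V_def)
    ultimately show False using \<tau>(2) by blast
  qed
  have "card S \<le> card H * fact (n - v)"
  proof (rule card_le_fibres[OF H(1) \<Phi>H])
    fix h assume "h \<in> H"
    have "card {x \<in> S. \<Phi> x = h} \<le> fact (card {1..n} - card V)"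
      using AB agree by (intro card_perms_inv_agree_le) (auto simp: V_def S_def)
    thus "card {x \<in> S. \<Phi> x = h} \<le> fact (n - v)" by (simp add: v_def V_def)
  qed
  thus ?thesis using H by (simp add: S_def)
qed

lemma fact_add_ge_power: "fact m * m ^ v \<le> (fact (m + v) :: nat)"
proof (induction v)
  case (Suc v)
  have "fact m * m ^ Suc v = (fact m * m ^ v) * m" by simp
  also have "\<dots> \<le> fact (m + v) * (m + v + 1)" using Suc by (intro mult_mono) auto
  also have "\<dots> = fact (m + Suc v)" by (simp add: algebra_simps)
  finally show ?case .
qed auto

text \<open>With \<open>m = n - v \<ge> n / 2\<close> one has
  \<open>(n / m) ^ v \<le> exp (v ^ 2 / m)\<close>. For \<open>v\<close> of order
  \<open>sqrt n\<close> the factor is bounded, so prescribing \<open>v\<close> values of a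
  permutation costs about \<open>n\<close> for each of them.\<close>

lemma falling_factorial_bound:
  assumes "2 * v \<le> n" "n > 0"
  shows "real n ^ v * fact (n - v) \<le> exp (2 * real v ^ 2 / n) * fact n"
proof -
  define m where "m = n - v"
  have m: "n = m + v" "2 * m \<ge> n" "m > 0" using assms by (auto simp: m_def)
  have "real n = real m * (1 + real v / real m)" using m by (simp add: field_simps)
  also have "\<dots> \<le> real m * exp (real v / real m)" by (intro mult_left_mono) auto
  finally have "real n ^ v \<le> (real m * exp (real v / real m)) ^ v" by (intro power_mono) auto
  also have "\<dots> = real m ^ v * exp (real v ^ 2 / real m)"
    by (simp add: power_mult_distrib exp_of_nat_mult[symmetric] power2_eq_square)
  also have "\<dots> \<le> real m ^ v * exp (2 * real v ^ 2 / n)"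
  proof -
    have "real v ^ 2 / real m \<le> 2 * real v ^ 2 / n"
    proof -
      have "real v ^ 2 / real m = 2 * real v ^ 2 / (2 * real m)" using m by simp
      also have "\<dots> \<le> 2 * real v ^ 2 / n"
        using m(2,3) assms(2) by (intro divide_left_mono) (auto simp flip: of_nat_mult)
      finally show ?thesis .
    qed
    thus ?thesis by (intro mult_left_mono) auto
  qed
  finally have "real n ^ v * fact m \<le> exp (2 * real v ^ 2 / n) * (fact m * real m ^ v)"
    using mult_right_mono[of "real n ^ v" _ "fact m"] by (simp add: algebra_simps)
  also have "fact m * real m ^ v \<le> fact n"
    using fact_add_ge_power[of m v] m(1) by (metis of_nat_fact of_nat_le_iff of_nat_mult of_nat_power)
  finally show ?thesis by (simp add: m_def mult_left_mono)
qed

text \<open>The left side is one term of the exponential series.\<close>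

lemma power_div_fact_le_exp: "real k ^ k / fact k \<le> exp (real k)"
proof -
  have "(\<lambda>i. real k ^ i / fact i) sums exp (real k)"
    using exp_converges[of "real k"] by (simp add: divide_inverse mult.commute)
  hence "(\<Sum>i\<in>{k}. real k ^ i / fact i) \<le> exp (real k)"
    using sum_le_suminf[of "\<lambda>i. real k ^ i / fact i" "{k}"] by (auto simp: sums_iff)
  thus ?thesis by simp
qed

text \<open>Union bound over the index set \<open>A\<close> and the value set \<open>B\<close> of an
  increasing subsequence of length exactly \<open>k\<close>. The bound for one pair is about
  \<open>fact n / n ^ k\<close> whatever the size \<open>v\<close> of \<open>A \<union> B\<close>
  is, because the factor \<open>n ^ (v - k)\<close> compensates for \<open>fact (n - v)\<close>. As
  \<open>v \<le> 2 * k\<close>, the correction \<open>2 * v ^ 2\<close> becomes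
  \<open>8 * k ^ 2\<close>.\<close>

lemma card_conj_LIS_ge:
  assumes \<tau>: "\<tau> permutes {1..n}" "\<And>x. x \<in> {1..n} \<Longrightarrow> \<tau> x \<noteq> x"
    and k: "4 * k \<le> n" "k > 0"
  shows "real (card {g. g permutes {1..n} \<and> LIS n (conj_by g \<tau>) \<ge> k})
    \<le> (exp 2 * n / real k ^ 2) ^ k * exp (8 * real k ^ 2 / n) * fact n"
proof -
  have n: "n > 0" using k by simp
  define Q where "Q = {A. A \<subseteq> {1..n} \<and> card A = k}"
  define W where "W A B = {g. g permutes {1..n} \<and> strict_mono_on A (conj_by g \<tau>) \<and> conj_by g \<tau> ` A = B}" for A B
  have Q: "finite Q" "card Q = n choose k"
    unfolding Q_def using n_subsets[of "{1..n}" k] by auto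
  have sub: "{g. g permutes {1..n} \<and> LIS n (conj_by g \<tau>) \<ge> k} \<subseteq> (\<Union>(A, B)\<in>Q \<times> Q. W A B)"
  proof
    fix g assume g: "g \<in> {g. g permutes {1..n} \<and> LIS n (conj_by g \<tau>) \<ge> k}"
    obtain I where I: "I \<subseteq> {1..n}" "strict_mono_on I (conj_by g \<tau>)" "card I = LIS n (conj_by g \<tau>)"
      using LIS_attained by blast
    obtain A where A: "A \<subseteq> I" "card A = k"
      using obtain_subset_with_card_n[of k I] I g by auto
    have perm: "conj_by g \<tau> permutes {1..n}" using g \<tau> conj_by_permutes by auto
    have mono: "strict_mono_on A (conj_by g \<tau>)" using I(2) A(1) by (auto simp: strict_mono_on_def)
    have "conj_by g \<tau> ` A \<subseteq> {1..n}" using A I permutes_image[OF perm] by blast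
    moreover have "card (conj_by g \<tau> ` A) = k"
      using A(2) card_image[OF strict_mono_on_imp_inj_on[OF mono]] by simp
    ultimately have "(A, conj_by g \<tau> ` A) \<in> Q \<times> Q" using A I by (auto simp: Q_def)
    moreover have "g \<in> W A (conj_by g \<tau> ` A)" using mono g by (auto simp: W_def)
    ultimately show "g \<in> (\<Union>(A, B)\<in>Q \<times> Q. W A B)" by blast
  qed
  have W: "real (card (W A B)) \<le> exp (8 * real k ^ 2 / n) * fact n / real n ^ k"
    if "A \<in> Q" "B \<in> Q" for A B
  proof -
    define v where "v = card (A \<union> B)"
    have fin: "finite A" "finite B" using that by (auto simp: Q_def intro: finite_subset)
    have v: "k \<le> v" "v \<le> 2 * k"
      using that fin card_Un_le[of A B] card_mono[of "A \<union> B" A] by (auto simp: v_def Q_def)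
    have "real (card (W A B)) \<le> real (n ^ (v - k) * fact (n - v))"
      unfolding W_def of_nat_le_iff v_def using that \<tau> by (intro card_conj_strict_mono_le) (auto simp: Q_def)
    also have "\<dots> = real n ^ v * fact (n - v) / real n ^ k"
      using v n by (simp add: power_add[symmetric] field_simps)
    also have "\<dots> \<le> exp (2 * real v ^ 2 / n) * fact n / real n ^ k"
      using v k n by (intro divide_right_mono falling_factorial_bound) auto
    also have "\<dots> \<le> exp (8 * real k ^ 2 / n) * fact n / real n ^ k"
    proof -
      have "real v ^ 2 \<le> (2 * real k) ^ 2" using v by (intro power_mono) auto
      hence "2 * real v ^ 2 / n \<le> 8 * real k ^ 2 / n" using n by (intro divide_right_mono) auto
      thus ?thesis by (intro divide_right_mono mult_right_mono) auto
    qed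
    finally show ?thesis .
  qed
  have "finite (\<Union>(A, B)\<in>Q \<times> Q. W A B)"
    by (rule finite_subset[OF _ finite_permutations[of "{1..n}"]]) (auto simp: W_def)
  hence "card {g. g permutes {1..n} \<and> LIS n (conj_by g \<tau>) \<ge> k} \<le> card (\<Union>(A, B)\<in>Q \<times> Q. W A B)"
    using sub by (rule card_mono)
  also have "\<dots> \<le> (\<Sum>(A, B)\<in>Q \<times> Q. card (W A B))"
    using card_UN_le[of "Q \<times> Q" "\<lambda>(A, B). W A B"] Q by (simp add: case_prod_unfold)
  finally have "real (card {g. g permutes {1..n} \<and> LIS n (conj_by g \<tau>) \<ge> k})
      \<le> (\<Sum>(A, B)\<in>Q \<times> Q. real (card (W A B)))"
    by (simp add: case_prod_unfold flip: of_nat_sum)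
  also have "\<dots> \<le> (\<Sum>(A, B)\<in>Q \<times> Q. exp (8 * real k ^ 2 / n) * fact n / real n ^ k)"
    using W by (intro sum_mono) auto
  also have "\<dots> = real (n choose k) ^ 2 * (exp (8 * real k ^ 2 / n) * fact n / real n ^ k)"
    by (simp add: Q card_cartesian_product power2_eq_square case_prod_unfold)
  also have "\<dots> \<le> (real n ^ k * exp k / real k ^ k) ^ 2 * (exp (8 * real k ^ 2 / n) * fact n / real n ^ k)"
  proof (intro mult_right_mono power_mono)
    have "real (n choose k) * fact k \<le> real n ^ k"
      using binomial_fact_pow[of n k] by (metis of_nat_fact of_nat_le_iff of_nat_mult of_nat_power)
    hence "real (n choose k) \<le> real n ^ k * (1 / fact k)" by (simp add: field_simps)
    also have "\<dots> \<le> real n ^ k * (exp k / real k ^ k)"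
      using power_div_fact_le_exp[of k] k by (intro mult_left_mono) (auto simp: field_simps)
    finally show "real (n choose k) \<le> real n ^ k * exp k / real k ^ k" by simp
  qed auto
  also have "\<dots> = (exp 2 * n / real k ^ 2) ^ k * exp (8 * real k ^ 2 / n) * fact n"
  proof -
    have "exp (real k) = exp 1 ^ k" by (simp add: exp_of_nat_mult[symmetric])
    moreover have "exp (2::real) = exp 1 ^ 2" by (simp add: exp_of_nat_mult[symmetric])
    ultimately show ?thesis using n k
      by (simp add: power_mult_distrib power_divide power2_eq_square)
  qed
  finally show ?thesis .
qed

lemma card_conj_LIS_upper_tail:
  "\<exists>c>0. \<exists>N. \<forall>n\<ge>N. \<forall>\<tau>. \<tau> permutes {1..n} \<longrightarrow> (\<forall>x\<in>{1..n}. \<tau> x \<noteq> x) \<longrightarrow>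
    real (card {g. g permutes {1..n} \<and> real (LIS n (conj_by g \<tau>)) \<ge> 3 * sqrt n})
      \<le> exp (- c * sqrt n) * fact n"
proof -
  \<comment> \<open>For \<open>k \<ge> 3 * sqrt n\<close> the base \<open>exp 2 * n / k ^ 2\<close>
    is at most \<open>exp 2 / 9 = exp (- d)\<close>.\<close>
  define d where "d = ln 9 - (2::real)"
  have d: "d > 0"
  proof -
    have "exp (2::real) = exp 1 ^ 2" by (simp add: exp_of_nat_mult[symmetric])
    also have "\<dots> < 3 ^ 2" using e_less_272 by (intro power_strict_mono) auto
    finally have "ln (exp 2) < ln (9::real)" by (subst ln_less_cancel_iff) auto
    thus ?thesis by (simp add: d_def)
  qed
  \<comment> \<open>\<open>256\<close> gives \<open>sqrt n \<ge> 16\<close> and so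
    \<open>4 * k \<le> 16 * sqrt n \<le> n\<close>. \<open>(64 / d) ^ 2\<close> gives
    \<open>128 \<le> 2 * d * sqrt n\<close>: two thirds of the exponent
    \<open>3 * d * sqrt n\<close> absorb the factor \<open>exp 128\<close>.\<close>
  define N where "N = nat \<lceil>(64 / d) ^ 2\<rceil> + 256"
  show ?thesis
  proof (intro exI[of _ d] conjI exI[of _ N] allI impI d)
    fix n \<tau>
    assume n: "n \<ge> N" and \<tau>: "\<tau> permutes {1..n}" "\<forall>x\<in>{1..n}. \<tau> x \<noteq> x"
    define k where "k = nat \<lceil>3 * sqrt n\<rceil>"
    have n256: "real n \<ge> 256" using n by (simp add: N_def)
    hence s16: "sqrt n \<ge> 16" by (intro real_le_rsqrt) auto
    have k: "real k \<ge> 3 * sqrt n" "real k \<le> 4 * sqrt n"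
      using s16 by (auto simp: k_def) linarith
    have sq: "sqrt n * sqrt n = n" by simp
    have k4: "4 * k \<le> n"
    proof -
      have "16 * sqrt n \<le> sqrt n * sqrt n" using s16 by (intro mult_right_mono) auto
      hence "4 * real k \<le> real n" using k(2) sq by linarith
      thus ?thesis by linarith
    qed
    have kpos: "k > 0" using k(1) s16 by (cases k) auto
    have k2: "9 * n \<le> real k ^ 2" "real k ^ 2 \<le> 16 * n"
      using power_mono[OF k(1), of 2] power_mono[OF k(2), of 2] by (auto simp: power_mult_distrib)
    have "{g. g permutes {1..n} \<and> real (LIS n (conj_by g \<tau>)) \<ge> 3 * sqrt n}
        = {g. g permutes {1..n} \<and> LIS n (conj_by g \<tau>) \<ge> k}"
      by (auto simp: k_def)
    hence "real (card {g. g permutes {1..n} \<and> real (LIS n (conj_by g \<tau>)) \<ge> 3 * sqrt n})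
        \<le> (exp 2 * n / real k ^ 2) ^ k * exp (8 * real k ^ 2 / n) * fact n"
      using card_conj_LIS_ge[OF \<tau>(1) _ k4 kpos] \<tau>(2) by simp
    also have "\<dots> \<le> (exp (- d)) ^ k * exp 128 * fact n"
    proof (intro mult_right_mono mult_mono power_mono)
      have "exp 2 * n / real k ^ 2 \<le> exp 2 * n / (9 * n)"
        using k2 n256 kpos by (intro divide_left_mono) auto
      also have "\<dots> = exp 2 / 9" using n256 by simp
      also have "\<dots> = exp (- d)" by (simp add: d_def exp_diff exp_minus field_simps)
      finally show "exp 2 * n / real k ^ 2 \<le> exp (- d)" .
      show "exp (8 * real k ^ 2 / n) \<le> exp 128" using k2 n256 by (simp add: divide_le_eq)
    qed (use kpos in auto)
    also have "(exp (- d)) ^ k * exp 128 = exp (128 - d * k)"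
      by (simp add: exp_of_nat_mult[symmetric] exp_add[symmetric] algebra_simps)
    also have "\<dots> \<le> exp (- d * sqrt n)"
    proof -
      have "real n \<ge> (64 / d) ^ 2" using n unfolding N_def by linarith
      hence "64 / d \<le> sqrt n" using d by (intro real_le_rsqrt) auto
      hence "128 \<le> 2 * (d * sqrt n)" using d by (simp add: field_simps)
      moreover have "d * (3 * sqrt n) \<le> d * k" using k d by (intro mult_left_mono) auto
      ultimately show ?thesis by (simp add: algebra_simps)
    qed
    finally show "real (card {g. g permutes {1..n} \<and> real (LIS n (conj_by g \<tau>)) \<ge> 3 * sqrt n})
      \<le> exp (- d * sqrt n) * fact n" by (simp add: mult_right_mono)
  qed
qed

subsection \<open>Concentration on the symmetric group\<close>

text \<open>Meant for deviations from a mean: summed over them, the linear term vanishes and a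
  Gaussian bound remains.\<close>

lemma exp_le_add_exp_square: "exp y \<le> y + exp (y\<^sup>2)" for y :: real
proof -
  have sq: "1 + y\<^sup>2 \<le> exp (y\<^sup>2)" by simp
  consider "y < - 1" | "- 1 \<le> y" "y \<le> 0" | "0 \<le> y" "y \<le> 1" | "1 < y" by linarith
  thus ?thesis
  proof cases
    case 1
    have "0 \<le> y * (y + 1)" using 1 by (intro mult_nonpos_nonpos) auto
    hence "0 \<le> y + y\<^sup>2" by (simp add: power2_eq_square algebra_simps)
    moreover have "exp y \<le> 1" using 1 by simp
    ultimately show ?thesis using sq by linarith
  next
    case 2
    define z where "z = - y"
    have z: "0 \<le> z" "z \<le> 1" using 2 by (auto simp: z_def)
    have "exp y = 1 / exp z" by (simp add: z_def exp_minus field_simps)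
    also have "\<dots> \<le> 1 / (1 + z)" using z by (intro divide_left_mono) auto
    also have "\<dots> \<le> 1 - z + z\<^sup>2"
    proof -
      have "(1 - z + z\<^sup>2) * (1 + z) = 1 + z ^ 3" by (simp add: power2_eq_square power3_eq_cube algebra_simps)
      also have "\<dots> \<ge> 1" using z by simp
      finally show ?thesis using z by (simp add: divide_le_eq)
    qed
    finally have "exp y \<le> 1 + y + y\<^sup>2" by (simp add: z_def)
    thus ?thesis using sq by linarith
  next
    case 3
    have "exp y \<le> 1 + y + y\<^sup>2" by (rule exp_bound) (use 3 in auto)
    thus ?thesis using sq by linarith
  next
    case 4
    have "y \<le> y\<^sup>2" using 4 by (simp add: power2_eq_square)
    hence "exp y \<le> exp (y\<^sup>2)" by simp
    thus ?thesis using 4 by linarith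
  qed
qed

text \<open>Hoeffding's lemma for a uniform variable of range \<open>d\<close>, with 1 in place of
  the sharp constant 1/8.\<close>

lemma sum_exp_le_of_bounded_deviation:
  fixes m :: "'a \<Rightarrow> real"
  assumes "finite B" "B \<noteq> {}" and dev: "\<And>b b'. b \<in> B \<Longrightarrow> b' \<in> B \<Longrightarrow> \<bar>m b - m b'\<bar> \<le> d"
  defines "\<mu> \<equiv> (\<Sum>b\<in>B. m b) / card B"
  shows "(\<Sum>b\<in>B. exp (l * m b)) \<le> card B * exp (l * \<mu> + l\<^sup>2 * d\<^sup>2)"
proof -
  have cB: "real (card B) > 0" using assms by (simp add: card_gt_0_iff)
  have dev': "\<bar>m b - \<mu>\<bar> \<le> d" if "b \<in> B" for b
  proof -
    have eq: "card B * (m b - \<mu>) = (\<Sum>b'\<in>B. m b - m b')"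
      using cB by (simp add: \<mu>_def sum_subtractf algebra_simps)
    have "card B * \<bar>m b - \<mu>\<bar> = \<bar>\<Sum>b'\<in>B. m b - m b'\<bar>"
      unfolding eq[symmetric] by (simp add: abs_mult)
    also have "\<dots> \<le> (\<Sum>b'\<in>B. d)" by (rule order_trans[OF sum_abs sum_mono]) (use dev that in auto)
    finally show ?thesis using cB by simp
  qed
  have "(\<Sum>b\<in>B. exp (l * (m b - \<mu>))) \<le> (\<Sum>b\<in>B. l * (m b - \<mu>) + exp (l\<^sup>2 * d\<^sup>2))"
  proof (rule sum_mono)
    fix b assume b: "b \<in> B"
    have "(l * (m b - \<mu>))\<^sup>2 \<le> l\<^sup>2 * d\<^sup>2"
      using power_mono[OF dev'[OF b], of 2] by (simp add: power_mult_distrib mult_left_mono)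
    hence "exp ((l * (m b - \<mu>))\<^sup>2) \<le> exp (l\<^sup>2 * d\<^sup>2)" by simp
    thus "exp (l * (m b - \<mu>)) \<le> l * (m b - \<mu>) + exp (l\<^sup>2 * d\<^sup>2)"
      using exp_le_add_exp_square[of "l * (m b - \<mu>)"] by linarith
  qed
  also have "\<dots> = card B * exp (l\<^sup>2 * d\<^sup>2)"
    using cB by (simp add: sum.distrib sum_subtractf \<mu>_def flip: sum_distrib_left)
  finally have "exp (l * \<mu>) * (\<Sum>b\<in>B. exp (l * (m b - \<mu>))) \<le> exp (l * \<mu>) * (card B * exp (l\<^sup>2 * d\<^sup>2))"
    by (intro mult_left_mono) auto
  thus ?thesis by (simp add: sum_distrib_left exp_add[symmetric] algebra_simps)
qed

text \<open>
  The group is exposed one coset at a time: conditioning on the coset \<open>transpose a b \<circ> Sym S\<close>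
  moves the mean by at most \<open>2 * c\<close>.
\<close>
lemma perm_exp_moment_le:
  assumes "finite S"
    and "\<And>p x y. p permutes S \<Longrightarrow> x \<in> S \<Longrightarrow> y \<in> S \<Longrightarrow> \<bar>f (p \<circ> Transposition.transpose x y) - f p\<bar> \<le> (c::real)"
  shows "(\<Sum>p | p permutes S. exp (l * f p))
    \<le> fact (card S) * exp (l * ((\<Sum>p | p permutes S. f p) / fact (card S)) + 4 * l\<^sup>2 * c\<^sup>2 * card S)"
  using assms
proof (induction S arbitrary: f rule: finite_induct)
  case empty
  thus ?case by simp
next
  case (insert a S)
  define T where "T = insert a S"
  have T: "finite T" "T \<noteq> {}" "card T = Suc (card S)" using insert by (auto simp: T_def)
  define m where "m b = (\<Sum>q | q permutes S. f (Transposition.transpose a b \<circ> q)) / fact (card S)" for b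
  have fP: "finite {q. q permutes S}" "card {q. q permutes S} = fact (card S)"
    using insert by (auto intro: finite_permutations card_permutations)
  have near: "\<bar>m b - (\<Sum>q | q permutes S. f q) / fact (card S)\<bar> \<le> c" if b: "b \<in> T" for b
  proof -
    have "\<bar>f (Transposition.transpose a b \<circ> q) - f q\<bar> \<le> c" if q: "q permutes S" for q
    proof -
      have qT: "q permutes T" using q by (rule permutes_subset) (auto simp: T_def)
      \<comment> \<open>The cosets are left translates, whereas the hypothesis on \<open>f\<close>
        concerns right multiplication; the transposition is moved across \<open>q\<close>.\<close>
      have "Transposition.transpose a b \<circ> q = q \<circ> Transposition.transpose (inv q a) (inv q b)"
        by (rule transpose_comp_eq[OF permutes_bij[OF q]])
      moreover have "inv q a \<in> T" "inv q b \<in> T"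
        using b permutes_in_image[OF permutes_inv[OF qT]] by (auto simp: T_def)
      ultimately show ?thesis using insert.prems[of q "inv q a" "inv q b"] qT unfolding T_def by metis
    qed
    hence "\<bar>\<Sum>q | q permutes S. f (Transposition.transpose a b \<circ> q) - f q\<bar> \<le> (\<Sum>q | q permutes S. c)"
      by (intro order_trans[OF sum_abs sum_mono]) auto
    hence "\<bar>\<Sum>q | q permutes S. f (Transposition.transpose a b \<circ> q) - f q\<bar> / fact (card S) \<le> c"
      using fP by (simp add: divide_le_eq mult.commute)
    thus ?thesis by (simp add: m_def sum_subtractf diff_divide_distrib[symmetric])
  qed
  have dev: "\<bar>m b - m b'\<bar> \<le> 2 * c" if "b \<in> T" "b' \<in> T" for b b'
    using near[OF that(1)] near[OF that(2)] by linarith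
  have split: "(\<Sum>p | p permutes T. h p) = (\<Sum>b\<in>T. \<Sum>q | q permutes S. h (Transposition.transpose a b \<circ> q))"
    for h :: "('a \<Rightarrow> 'a) \<Rightarrow> real"
    unfolding T_def using insert by (intro sum_over_permutations_insert) auto
  have mean: "(\<Sum>p | p permutes T. f p) / fact (card T) = (\<Sum>b\<in>T. m b) / card T"
    unfolding split T(3) m_def by (simp add: sum_divide_distrib[symmetric])
  have "(\<Sum>p | p permutes T. exp (l * f p)) = (\<Sum>b\<in>T. \<Sum>q | q permutes S. exp (l * f (Transposition.transpose a b \<circ> q)))"
    by (rule split)
  also have "\<dots> \<le> (\<Sum>b\<in>T. fact (card S) * exp (l * m b + 4 * l\<^sup>2 * c\<^sup>2 * card S))"
  proof (rule sum_mono)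
    fix b assume b: "b \<in> T"
    have "\<bar>f (Transposition.transpose a b \<circ> (p \<circ> Transposition.transpose x y)) - f (Transposition.transpose a b \<circ> p)\<bar> \<le> c"
      if "p permutes S" "x \<in> S" "y \<in> S" for p x y
    proof -
      have "Transposition.transpose a b permutes T" using b by (intro permutes_swap_id) (auto simp: T_def)
      moreover have "p permutes T" using that(1) by (rule permutes_subset) (auto simp: T_def)
      ultimately have "Transposition.transpose a b \<circ> p permutes T" by (rule permutes_compose[rotated])
      thus ?thesis using insert.prems[of "Transposition.transpose a b \<circ> p" x y] that unfolding T_def o_assoc by blast
    qed
    thus "(\<Sum>q | q permutes S. exp (l * f (Transposition.transpose a b \<circ> q)))
        \<le> fact (card S) * exp (l * m b + 4 * l\<^sup>2 * c\<^sup>2 * card S)"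
      unfolding m_def by (rule insert.IH[of "\<lambda>q. f (Transposition.transpose a b \<circ> q)"])
  qed
  also have "\<dots> = fact (card S) * exp (4 * l\<^sup>2 * c\<^sup>2 * card S) * (\<Sum>b\<in>T. exp (l * m b))"
    by (simp add: sum_distrib_left sum_distrib_right exp_add algebra_simps)
  \<comment> \<open>Exposing one more element costs \<open>(2 * c) ^ 2 = 4 * c ^ 2\<close> in the
    coefficient of \<open>l ^ 2\<close>.\<close>
  also have "\<dots> \<le> fact (card S) * exp (4 * l\<^sup>2 * c\<^sup>2 * card S) *
      (card T * exp (l * ((\<Sum>b\<in>T. m b) / card T) + l\<^sup>2 * (2 * c)\<^sup>2))"
    using T dev by (intro mult_left_mono sum_exp_le_of_bounded_deviation) auto
  also have "\<dots> = fact (card T) * exp (l * ((\<Sum>b\<in>T. m b) / card T) + 4 * l\<^sup>2 * c\<^sup>2 * card T)"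
    by (simp add: T(3) exp_add[symmetric] algebra_simps power_mult_distrib)
  finally show ?case unfolding mean[symmetric] unfolding T_def .
qed

lemma perm_lower_tail:
  assumes "finite S" "S \<noteq> {}" "c > 0" "y \<ge> 0"
    and lip: "\<And>p x y. p permutes S \<Longrightarrow> x \<in> S \<Longrightarrow> y \<in> S \<Longrightarrow> \<bar>f (p \<circ> Transposition.transpose x y) - f p\<bar> \<le> (c::real)"
  shows "real (card {p. p permutes S \<and> f p \<le> (\<Sum>p | p permutes S. f p) / fact (card S) - y})
    \<le> fact (card S) * exp (- y\<^sup>2 / (16 * c\<^sup>2 * card S))"
proof -
  define \<mu> where "\<mu> = (\<Sum>p | p permutes S. f p) / fact (card S)"
  define D where "D = 8 * c\<^sup>2 * card S"
  have D: "D > 0" using assms by (simp add: D_def card_gt_0_iff)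
  \<comment> \<open>The minimiser of the Chernoff exponent
    \<open>4 * l ^ 2 * c ^ 2 * card S - l * y\<close>.\<close>
  define l where "l = y / D"
  have l: "l \<ge> 0" using D assms by (simp add: l_def)
  define E where "E = {p. p permutes S \<and> f p \<le> \<mu> - y}"
  have fin: "finite {p. p permutes S}" using assms by (intro finite_permutations)
  have "real (card E) * exp (- l * (\<mu> - y)) = (\<Sum>p\<in>E. exp (- l * (\<mu> - y)))" by simp
  also have "\<dots> \<le> (\<Sum>p\<in>E. exp (- l * f p))"
    using l by (intro sum_mono) (auto simp: E_def mult_left_mono)
  also have "\<dots> \<le> (\<Sum>p | p permutes S. exp (- l * f p))"
    using fin by (intro sum_mono2) (auto simp: E_def)
  also have "\<dots> \<le> fact (card S) * exp (- l * \<mu> + 4 * (- l)\<^sup>2 * c\<^sup>2 * card S)"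
    unfolding \<mu>_def by (rule perm_exp_moment_le[OF assms(1) lip])
  finally have "real (card E) * exp (- l * (\<mu> - y)) * exp (l * (\<mu> - y))
      \<le> fact (card S) * exp (- l * \<mu> + 4 * (- l)\<^sup>2 * c\<^sup>2 * card S) * exp (l * (\<mu> - y))"
    by (rule mult_right_mono) simp
  also have "real (card E) * exp (- l * (\<mu> - y)) * exp (l * (\<mu> - y)) = real (card E)"
    by (simp add: mult.assoc exp_add[symmetric])
  also have "fact (card S) * exp (- l * \<mu> + 4 * (- l)\<^sup>2 * c\<^sup>2 * card S) * exp (l * (\<mu> - y))
      = fact (card S) * exp (4 * l\<^sup>2 * c\<^sup>2 * card S - l * y)"
    by (simp add: mult.assoc exp_add[symmetric] algebra_simps)
  also have "4 * l\<^sup>2 * c\<^sup>2 * card S - l * y = - y\<^sup>2 / (16 * c\<^sup>2 * card S)"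
  proof -
    have "4 * l\<^sup>2 * c\<^sup>2 * card S = l * (l * D) / 2" by (simp add: D_def power2_eq_square)
    also have "l * D = y" using D by (simp add: l_def)
    finally have "4 * l\<^sup>2 * c\<^sup>2 * card S - l * y = - (y * y / D) / 2" by (simp add: l_def)
    also have "\<dots> = - y\<^sup>2 / (2 * D)" by (simp add: power2_eq_square)
    finally show ?thesis by (simp add: D_def)
  qed
  finally show ?thesis by (simp add: E_def \<mu>_def)
qed

text \<open>The value at \<open>z = g w\<close> can change only if \<open>w\<close> or
  \<open>\<tau> w\<close> is one of the two transposed labels, which leaves four points.\<close>

lemma conj_by_transpose_diff:
  assumes g: "g permutes S" and \<tau>: "\<tau> permutes S"
  shows "finite {z. conj_by (g \<circ> Transposition.transpose x y) \<tau> z \<noteq> conj_by g \<tau> z}"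
    and "card {z. conj_by (g \<circ> Transposition.transpose x y) \<tau> z \<noteq> conj_by g \<tau> z} \<le> 4"
proof -
  define W where "W = {g x, g y, g (inv \<tau> x), g (inv \<tau> y)}"
  have inv: "inv (g \<circ> Transposition.transpose x y) = Transposition.transpose x y \<circ> inv g"
    using permutes_bij[OF g] by (simp add: o_inv_distrib)
  have sub: "{z. conj_by (g \<circ> Transposition.transpose x y) \<tau> z \<noteq> conj_by g \<tau> z} \<subseteq> W"
  proof
    fix z assume "z \<in> {z. conj_by (g \<circ> Transposition.transpose x y) \<tau> z \<noteq> conj_by g \<tau> z}"
    hence neq: "g (Transposition.transpose x y (\<tau> (Transposition.transpose x y (inv g z)))) \<noteq> g (\<tau> (inv g z))"
      by (simp add: conj_by_def inv)
    define w where "w = inv g z"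
    have z: "z = g w" using permutes_inverses[OF g] by (simp add: w_def)
    have "w = x \<or> w = y \<or> \<tau> w = x \<or> \<tau> w = y"
      using neq unfolding w_def[symmetric] by (auto simp: Transposition.transpose_def split: if_splits)
    thus "z \<in> W" unfolding W_def z using permutes_inverses[OF \<tau>] by auto
  qed
  have W: "finite W" "card W \<le> 4" unfolding W_def by (auto simp: card_insert_if)
  show "finite {z. conj_by (g \<circ> Transposition.transpose x y) \<tau> z \<noteq> conj_by g \<tau> z}"
    using finite_subset[OF sub W(1)] .
  show "card {z. conj_by (g \<circ> Transposition.transpose x y) \<tau> z \<noteq> conj_by g \<tau> z} \<le> 4"
    using card_mono[OF W(1) sub] W(2) by linarith
qed

subsection \<open>Last passage percolation with boundary sources\<close>

definition grid_chain :: "(nat \<times> nat) set \<Rightarrow> bool" where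
  "grid_chain C \<longleftrightarrow> (\<forall>p\<in>C. \<forall>q\<in>C. p \<noteq> q \<longrightarrow>
     (fst p < fst q \<and> snd p < snd q) \<or> (fst q < fst p \<and> snd q < snd p))"

definition lis :: "(nat \<times> nat) set \<Rightarrow> nat" where
  "lis Z = Max (card ` {C. C \<subseteq> Z \<and> grid_chain C})"

lemma grid_chain_subset: "grid_chain C \<Longrightarrow> D \<subseteq> C \<Longrightarrow> grid_chain D"
  unfolding grid_chain_def by blast

lemma grid_chain_empty [simp]: "grid_chain {}"
  by (simp add: grid_chain_def)

lemma lis_ge: "finite Z \<Longrightarrow> C \<subseteq> Z \<Longrightarrow> grid_chain C \<Longrightarrow> card C \<le> lis Z"
  unfolding lis_def by (intro Max_ge) (auto intro: finite_subset[of _ "Pow Z"])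

lemma lis_attained: "finite Z \<Longrightarrow> \<exists>C. C \<subseteq> Z \<and> grid_chain C \<and> card C = lis Z"
proof -
  assume "finite Z"
  hence "lis Z \<in> card ` {C. C \<subseteq> Z \<and> grid_chain C}"
    unfolding lis_def by (intro Max_in) (auto intro: finite_subset[of _ "Pow Z"] exI[of _ "{}"])
  thus ?thesis by auto
qed

lemma lis_mono: "finite Z' \<Longrightarrow> Z \<subseteq> Z' \<Longrightarrow> lis Z \<le> lis Z'"
  using lis_attained[of Z] lis_ge[of Z'] finite_subset[of Z Z'] by (metis order_trans)

text \<open>
  Last passage percolation with strict steps in the bulk, fed by sources \<open>u\<close> on the horizontal axis
  and sinks \<open>v\<close> on the vertical axis; the cell \<open>(i, j)\<close> joins the corners \<open>(i, j)\<close> and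
  \<open>(Suc i, Suc j)\<close>.
\<close>
fun lpp :: "(nat \<Rightarrow> bool) \<Rightarrow> (nat \<Rightarrow> bool) \<Rightarrow> (nat \<Rightarrow> nat \<Rightarrow> bool) \<Rightarrow> nat \<Rightarrow> nat \<Rightarrow> nat" where
  "lpp u v w 0 0 = 0"
| "lpp u v w (Suc i) 0 = lpp u v w i 0 + of_bool (u i)"
| "lpp u v w 0 (Suc j) = lpp u v w 0 j + of_bool (v j)"
| "lpp u v w (Suc i) (Suc j) =
     max (max (lpp u v w i (Suc j)) (lpp u v w (Suc i) j)) (lpp u v w i j + of_bool (w i j))"

abbreviation psum :: "(nat \<Rightarrow> bool) \<Rightarrow> nat \<Rightarrow> nat" where
  "psum u z \<equiv> (\<Sum>k<z. of_bool (u k))"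

lemma lpp_0_right [simp]: "lpp u v w i 0 = psum u i"
  by (induction i) auto

text \<open>Reflection in the diagonal carries statements about sources over to sinks.\<close>

lemma lpp_swap: "lpp u v w i j = lpp v u (\<lambda>i j. w j i) j i"
  by (induction u v w i j rule: lpp.induct) auto

lemma lpp_0_left [simp]: "lpp u v w 0 j = psum v j"
  by (subst lpp_swap) simp

lemma lpp_Suc_left: "lpp u v w i j \<le> lpp u v w (Suc i) j"
  by (cases j) auto

lemma lpp_Suc_right: "lpp u v w i j \<le> lpp u v w i (Suc j)"
  by (cases i) auto

lemma lpp_mono: "i \<le> i' \<Longrightarrow> j \<le> j' \<Longrightarrow> lpp u v w i j \<le> lpp u v w i' j'"
  using lift_Suc_mono_le[of "\<lambda>i. lpp u v w i j" i i'] lpp_Suc_left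
    lift_Suc_mono_le[of "\<lambda>j. lpp u v w i' j" j j'] lpp_Suc_right by (meson order_trans)

lemma grid_chain_insert_corner:
  assumes "grid_chain C" "\<And>p. p \<in> C \<Longrightarrow> fst p < i \<and> snd p < j"
  shows "grid_chain (insert (i, j) C)" "(i, j) \<notin> C"
  using assms unfolding grid_chain_def by (auto, fastforce+)

text \<open>The recursion in terms of an optimal path: it follows one axis up to the exit time
  \<open>z\<close>, collecting the boundary points there, and then a chain of marked cells beyond
  \<open>z\<close>.\<close>

lemma lpp_decompose:
  "\<exists>C z. finite C \<and> grid_chain C \<and> (\<forall>p\<in>C. fst p < i \<and> snd p < j \<and> w (fst p) (snd p)) \<and>
     (z \<le> i \<and> (\<forall>p\<in>C. z \<le> fst p) \<and> lpp u v w i j = psum u z + card C \<or>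
      z \<le> j \<and> (\<forall>p\<in>C. z \<le> snd p) \<and> lpp u v w i j = psum v z + card C)"
proof (induction u v w i j rule: lpp.induct)
  case (1 u v w)
  show ?case by (intro exI[of _ "{}"] exI[of _ 0]) auto
next
  case (2 u v w i)
  show ?case by (intro exI[of _ "{}"] exI[of _ "Suc i"]) auto
next
  case (3 u v w j)
  show ?case by (intro exI[of _ "{}"] exI[of _ "Suc j"]) auto
next
  case (4 u v w i j)
  let ?l = "lpp u v w (Suc i) (Suc j)"
  consider "?l = lpp u v w i (Suc j)" | "?l = lpp u v w (Suc i) j" |
     "?l = lpp u v w i j" | "w i j" "?l = Suc (lpp u v w i j)"
  proof -
    have "max (max a b) c \<in> {a, b, c}" for a b c :: nat by (auto simp: max_def)
    from this[of "lpp u v w i (Suc j)" "lpp u v w (Suc i) j" "lpp u v w i j + of_bool (w i j)"]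
    show ?thesis using that by (cases "w i j") auto
  qed
  thus ?case
  proof cases
    case 1
    thus ?thesis using "4.IH"(1) by (metis le_SucI less_SucI)
  next
    case 2
    thus ?thesis using "4.IH"(2) by (metis le_SucI less_SucI)
  next
    case 3
    thus ?thesis using "4.IH"(3) by (metis le_SucI less_SucI)
  next
    case c4: 4
    obtain C z where C: "finite C" "grid_chain C" "\<And>p. p \<in> C \<Longrightarrow> fst p < i \<and> snd p < j \<and> w (fst p) (snd p)"
      and z: "z \<le> i \<and> (\<forall>p\<in>C. z \<le> fst p) \<and> lpp u v w i j = psum u z + card C \<or>
        z \<le> j \<and> (\<forall>p\<in>C. z \<le> snd p) \<and> lpp u v w i j = psum v z + card C"
      using "4.IH"(3) by metis
    have ins: "grid_chain (insert (i, j) C)" "(i, j) \<notin> C"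
      using grid_chain_insert_corner[OF C(2)] C(3) by auto
    show ?thesis
      using C z ins c4 by (intro exI[of _ "insert (i, j) C"] exI[of _ z])
        (auto simp: less_Suc_eq)
  qed
qed

text \<open>Converse of \<open>lpp_decompose\<close> for sources: any exit time and any chain beyond
  it compete. The induction strips off the last point of the chain.\<close>

lemma lpp_ge_chain_right:
  assumes "finite C" "grid_chain C" "\<And>p. p \<in> C \<Longrightarrow> z \<le> fst p \<and> fst p < i \<and> snd p < j \<and> w (fst p) (snd p)"
    "z \<le> i"
  shows "psum u z + card C \<le> lpp u v w i j"
  using assms
proof (induction "card C" arbitrary: C i j)
  case 0
  thus ?case using lpp_mono[of z i 0 j u v w] by simp
next
  case (Suc n)
  have "C \<noteq> {}" using Suc by auto
  then obtain p where p: "p \<in> C" "fst p = Max (fst ` C)"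
    using Max_in[of "fst ` C"] Suc by (metis (no_types, lifting) finite_imageI imageE image_is_empty)
  have le: "fst q \<le> fst p" if "q \<in> C" for q using Suc.prems(1) that p by auto
  define D where "D = C - {p}"
  have D: "finite D" "grid_chain D" "n = card D" "card C = Suc (card D)"
    using Suc.prems Suc.hyps(2) p by (auto simp: D_def intro: grid_chain_subset)
  have lt: "fst q < fst p \<and> snd q < snd p" if "q \<in> D" for q
    using Suc.prems(2) p(1) that le[of q] unfolding grid_chain_def D_def
    by (metis Diff_iff insertI1 leD)
  have pp: "z \<le> fst p" "fst p < i" "snd p < j" "w (fst p) (snd p)" using Suc.prems(3)[OF p(1)] by auto
  have "psum u z + card D \<le> lpp u v w (fst p) (snd p)"
    using D lt Suc.prems(3) pp by (intro Suc.hyps(1)) (auto simp: D_def)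
  hence "psum u z + card C \<le> lpp u v w (fst p) (snd p) + 1" using D by simp
  also have "\<dots> \<le> lpp u v w (Suc (fst p)) (Suc (snd p))" using pp by simp
  also have "\<dots> \<le> lpp u v w i j" using pp by (intro lpp_mono) auto
  finally show ?case .
qed

lemma grid_chain_swap: "grid_chain (prod.swap ` C) \<longleftrightarrow> grid_chain C"
  unfolding grid_chain_def by (simp add: inj_eq[OF inj_swap]) blast

lemma lpp_ge_chain_up:
  assumes "finite C" "grid_chain C" "\<And>p. p \<in> C \<Longrightarrow> z \<le> snd p \<and> fst p < i \<and> snd p < j \<and> w (fst p) (snd p)"
    "z \<le> j"
  shows "psum v z + card C \<le> lpp u v w i j"
proof -
  have "psum v z + card (prod.swap ` C) \<le> lpp v u (\<lambda>i j. w j i) j i"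
    using assms by (intro lpp_ge_chain_right) (auto simp: grid_chain_swap)
  moreover have "card (prod.swap ` C) = card C" by (intro card_image) auto
  ultimately show ?thesis by (subst lpp_swap) simp
qed

lemma psum_mono: "z \<le> z' \<Longrightarrow> psum u z \<le> psum u z'"
  by (intro sum_mono2) auto

text \<open>Compares the increments over \<open>[z, z')\<close>, written additively because
  subtraction on the naturals truncates.\<close>

lemma psum_diff_mono:
  assumes "\<And>k. k < z' \<Longrightarrow> u k \<Longrightarrow> u' k" "z \<le> z'"
  shows "psum u z' + psum u' z \<le> psum u z + psum u' z'"
proof -
  have split: "psum f z' = psum f z + (\<Sum>k=z..<z'. of_bool (f k))" for f
    using sum.atLeastLessThan_concat[OF le0 assms(2), of "\<lambda>k. of_bool (f k) :: nat"]
    by (simp only: atLeast0LessThan)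
  have "(\<Sum>k=z..<z'. of_bool (u k)) \<le> (\<Sum>k=z..<z'. of_bool (u' k) :: nat)"
    using assms(1) by (intro sum_mono) auto
  thus ?thesis unfolding split by simp
qed

text \<open>
  An optimal path that leaves the axes after time \<open>z0\<close> profits from the extra sources \<open>u'\<close>
  (or sinks \<open>v'\<close>) it meets before leaving, whatever the other boundary is.
\<close>
lemma lpp_exit:
  assumes u: "\<And>k. k < s \<Longrightarrow> u k \<Longrightarrow> u' k" and v: "\<And>k. k < s \<Longrightarrow> v k \<Longrightarrow> v' k"
  shows "lpp u v w s s \<le> lis {(i, j). i < s \<and> j < s \<and> w i j} + psum u z0 + psum v z0 \<or>
    lpp u v w s s + psum u' z0 \<le> lpp u' v'' w s s + psum u z0 \<or>
    lpp u v w s s + psum v' z0 \<le> lpp u'' v' w s s + psum v z0"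
proof -
  have fin: "finite {(i, j). i < s \<and> j < s \<and> w i j}"
    by (rule finite_subset[of _ "{..<s} \<times> {..<s}"]) auto
  obtain C z where C: "finite C" "grid_chain C" "\<And>p. p \<in> C \<Longrightarrow> fst p < s \<and> snd p < s \<and> w (fst p) (snd p)"
    and z: "z \<le> s \<and> (\<forall>p\<in>C. z \<le> fst p) \<and> lpp u v w s s = psum u z + card C \<or>
      z \<le> s \<and> (\<forall>p\<in>C. z \<le> snd p) \<and> lpp u v w s s = psum v z + card C"
    using lpp_decompose[of s s w u v] by metis
  have lis: "card C \<le> lis {(i, j). i < s \<and> j < s \<and> w i j}"
    using C by (intro lis_ge[OF fin]) auto
  show ?thesis
  proof (cases "z \<le> z0")
    case True
    thus ?thesis using z lis psum_mono[OF True, of u] psum_mono[OF True, of v] by linarith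
  next
    case False
    from z show ?thesis
    proof
      assume z: "z \<le> s \<and> (\<forall>p\<in>C. z \<le> fst p) \<and> lpp u v w s s = psum u z + card C"
      \<comment> \<open>The same exit time and the same chain compete under the new sources.\<close>
      have "psum u' z + card C \<le> lpp u' v'' w s s" using C z by (intro lpp_ge_chain_right) auto
      moreover have "psum u z + psum u' z0 \<le> psum u z0 + psum u' z"
        using False z u by (intro psum_diff_mono) auto
      ultimately show ?thesis using z by linarith
    next
      assume z: "z \<le> s \<and> (\<forall>p\<in>C. z \<le> snd p) \<and> lpp u v w s s = psum v z + card C"
      have "psum v' z + card C \<le> lpp u'' v' w s s" using C z by (intro lpp_ge_chain_up) auto
      moreover have "psum v z + psum v' z0 \<le> psum v z0 + psum v' z"
        using False z v by (intro psum_diff_mono) auto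
      ultimately show ?thesis using z by linarith
    qed
  qed
qed

subsection \<open>Stationarity\<close>

text \<open>
  \<open>newrow xs v ys\<close> lists the horizontal increments of \<^const>\<open>lpp\<close> one row higher, given those below
  (\<open>xs\<close>), the vertical increment on the left (\<open>v\<close>) and the cells in between (\<open>ys\<close>); \<open>vbit\<close> gives the
  vertical increments along the row.
\<close>
fun newrow :: "bool list \<Rightarrow> bool \<Rightarrow> bool list \<Rightarrow> bool list" where
  "newrow (x # xs) v (y # ys) = ((x \<or> y) \<and> \<not> v) # newrow xs ((v \<or> y) \<and> \<not> x) ys"
| "newrow _ _ _ = []"

fun toprow :: "bool list \<Rightarrow> bool list \<Rightarrow> bool list list \<Rightarrow> bool list" where
  "toprow xs (v # vs) (ys # yss) = toprow (newrow xs v ys) vs yss"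
| "toprow xs _ _ = xs"

primrec vbit :: "bool list \<Rightarrow> bool \<Rightarrow> bool list \<Rightarrow> nat \<Rightarrow> bool" where
  "vbit xs v ys 0 = v"
| "vbit xs v ys (Suc i) = ((vbit xs v ys i \<or> ys ! i) \<and> \<not> xs ! i)"

lemma vbit_Cons: "vbit (x # xs) v (y # ys) (Suc i) = vbit xs ((v \<or> y) \<and> \<not> x) ys i"
  by (induction i) auto

lemma length_newrow: "length xs = length ys \<Longrightarrow> length (newrow xs v ys) = length xs"
  by (induction xs v ys rule: newrow.induct) auto

lemma newrow_nth:
  "length xs = length ys \<Longrightarrow> i < length xs \<Longrightarrow>
    newrow xs v ys ! i = ((xs ! i \<or> ys ! i) \<and> \<not> vbit xs v ys i)"
proof (induction xs v ys arbitrary: i rule: newrow.induct)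
  case (1 x xs v y ys)
  thus ?case by (cases i) (auto simp: vbit_Cons simp del: vbit.simps(2))
qed auto

text \<open>In a cell with lower increment \<open>x\<close>, left increment \<open>v\<close> and
  mark \<open>y\<close>, the far corner exceeds the near one by the maximum of \<open>x\<close>,
  \<open>v\<close>, \<open>y\<close>. Subtracting \<open>v\<close> leaves
  \<open>(x \<or> y) \<and> \<not> v\<close> on the upper side, subtracting \<open>x\<close> leaves
  \<open>(v \<or> y) \<and> \<not> x\<close> on the right side: the rules of \<open>newrow\<close>
  and \<open>vbit\<close>.\<close>

lemma lpp_first_row:
  fixes u v :: "nat \<Rightarrow> bool"
  assumes "length xs = m" "length ys = m" "\<And>i. i < m \<Longrightarrow> u i = xs ! i" "\<And>i. i < m \<Longrightarrow> w i 0 = ys ! i"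
  shows "i \<le> m \<Longrightarrow> lpp u v w i (Suc 0) = lpp u v w i 0 + of_bool (vbit xs (v 0) ys i)"
    and "i < m \<Longrightarrow> lpp u v w (Suc i) (Suc 0) = lpp u v w i (Suc 0) + of_bool (newrow xs (v 0) ys ! i)"
proof -
  show *: "lpp u v w i (Suc 0) = lpp u v w i 0 + of_bool (vbit xs (v 0) ys i)" if "i \<le> m" for i
    using that
  proof (induction i)
    case (Suc i)
    thus ?case using assms by (auto simp: max_def simp del: lpp_0_right)
  qed auto
  show "lpp u v w (Suc i) (Suc 0) = lpp u v w i (Suc 0) + of_bool (newrow xs (v 0) ys ! i)" if "i < m"
    using *[of i] *[of "Suc i"] that assms by (auto simp: newrow_nth simp del: lpp.simps(4))
qed

text \<open>The row at height one serves as the new horizontal axis; the offset is the value at its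
  left end.\<close>

lemma lpp_restart:
  assumes "\<And>i. i < m \<Longrightarrow> lpp u v w (Suc i) (Suc 0) = lpp u v w i (Suc 0) + of_bool (u' i)"
  shows "i \<le> m \<Longrightarrow> lpp u v w i (Suc j) =
    of_bool (v 0) + lpp u' (\<lambda>j. v (Suc j)) (\<lambda>i j. w i (Suc j)) i j"
proof (induction j arbitrary: i)
  case 0
  thus ?case using assms by (induction i) (auto simp del: lpp.simps(4) lpp_0_right simp: lpp.simps(2))
next
  case (Suc j)
  note Suc_IH = Suc.IH
  from Suc.prems show ?case
  proof (induction i)
    case 0
    show ?case by (simp add: sum.lessThan_Suc_shift del: sum.lessThan_Suc sum_of_bool_eq)
  next
    case (Suc i)
    have "lpp u v w (Suc i) (Suc (Suc j)) = 
      max (max (lpp u v w i (Suc (Suc j))) (lpp u v w (Suc i) (Suc j))) (lpp u v w i (Suc j) + of_bool (w i (Suc j)))"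
      by (rule lpp.simps)
    thus ?case using Suc.IH Suc.prems Suc_IH[of i] Suc_IH[of "Suc i"] by simp
  qed
qed

abbreviation count_true :: "bool list \<Rightarrow> nat" where
  "count_true xs \<equiv> length (filter id xs)"

lemma psum_nth: "psum ((!) xs) (length xs) = count_true xs"
proof -
  have "{..<length xs} \<inter> Collect ((!) xs) = {i. i < length xs \<and> id (xs ! i)}" by auto
  thus ?thesis by (simp add: length_filter_conv_card)
qed

lemma psum_nth_take: "z \<le> length xs \<Longrightarrow> psum ((!) xs) z = count_true (take z xs)"
  using psum_nth[of "take z xs"] by simp

text \<open>Adds the increments up the left side and then along the top. Under stationarity both
  counts are binomial; they are dependent, but a union bound does not mind.\<close>

lemma lpp_toprow:
  assumes "length xs = m" "length vs = n" "length yss = n" "\<And>ys. ys \<in> set yss \<Longrightarrow> length ys = m"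
  shows "lpp ((!) xs) ((!) vs) (\<lambda>i j. yss ! j ! i) m n = count_true vs + count_true (toprow xs vs yss)"
  using assms
proof (induction xs vs yss arbitrary: n rule: toprow.induct)
  case (1 xs v vs ys yss)
  obtain n' where n: "n = Suc n'" using 1(3) by (cases n) auto
  let ?w = "\<lambda>i j. (ys # yss) ! j ! i"
  have first: "lpp ((!) xs) ((!) (v # vs)) ?w (Suc i) (Suc 0)
      = lpp ((!) xs) ((!) (v # vs)) ?w i (Suc 0) + of_bool (newrow xs v ys ! i)" if "i < m" for i
    using lpp_first_row(2)[of xs m ys "(!) xs" ?w i "(!) (v # vs)"] that 1 by simp
  have "lpp ((!) xs) ((!) (v # vs)) ?w m (Suc n') = of_bool ((v # vs) ! 0) +
      lpp ((!) (newrow xs v ys)) (\<lambda>j. (v # vs) ! Suc j) (\<lambda>i j. (ys # yss) ! Suc j ! i) m n'"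
    by (rule lpp_restart[OF first]) auto
  thus ?case using 1 n by (auto simp: length_newrow)
qed (auto simp: psum_nth simp del: sum_of_bool_eq)

text \<open>Burke's property for one cell. Unequal increments pass through unchanged, two successes
  become two failures, and two failures become two successes when the cell is marked. The balance
  equation says that the last two events have the same probability.\<close>

lemma bernoulli_burke:
  assumes "a \<in> {0..1}" "b \<in> {0..1}" "p \<in> {0..1}" "a * b = p * (1 - a) * (1 - b)"
  shows "do {x \<leftarrow> bernoulli_pmf a; v \<leftarrow> bernoulli_pmf b; y \<leftarrow> bernoulli_pmf p;
      return_pmf ((x \<or> y) \<and> \<not> v, (v \<or> y) \<and> \<not> x)}
    = do {x \<leftarrow> bernoulli_pmf a; v \<leftarrow> bernoulli_pmf b; return_pmf (x, v)}"
proof (rule pmf_eqI)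
  fix c :: "bool \<times> bool"
  show "pmf (do {x \<leftarrow> bernoulli_pmf a; v \<leftarrow> bernoulli_pmf b; y \<leftarrow> bernoulli_pmf p;
      return_pmf ((x \<or> y) \<and> \<not> v, (v \<or> y) \<and> \<not> x)}) c
    = pmf (do {x \<leftarrow> bernoulli_pmf a; v \<leftarrow> bernoulli_pmf b; return_pmf (x, v)}) c"
    using assms by (cases c; cases "fst c"; cases "snd c") (simp_all add: pmf_bind algebra_simps)
qed

text \<open>The vertical output of a cell is independent of its horizontal output and has the law of
  the sink \<open>v\<close>, so it can serve as the sink of the remaining row.\<close>

lemma replicate_pmf_newrow:
  assumes "a \<in> {0..1}" "b \<in> {0..1}" "p \<in> {0..1}" "a * b = p * (1 - a) * (1 - b)"
  shows "do {xs \<leftarrow> replicate_pmf m (bernoulli_pmf a); v \<leftarrow> bernoulli_pmf b;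
      ys \<leftarrow> replicate_pmf m (bernoulli_pmf p); return_pmf (newrow xs v ys)}
    = replicate_pmf m (bernoulli_pmf a)"
proof (induction m)
  case (Suc m)
  let ?A = "bernoulli_pmf a" and ?B = "bernoulli_pmf b" and ?P = "bernoulli_pmf p"
  let ?F = "\<lambda>(x, v). do {xs \<leftarrow> replicate_pmf m ?A; ys \<leftarrow> replicate_pmf m ?P; return_pmf (x # newrow xs v ys)}"
  have "do {xs \<leftarrow> replicate_pmf (Suc m) ?A; v \<leftarrow> ?B; ys \<leftarrow> replicate_pmf (Suc m) ?P; return_pmf (newrow xs v ys)}
    = do {x \<leftarrow> ?A; xs \<leftarrow> replicate_pmf m ?A; v \<leftarrow> ?B; y \<leftarrow> ?P; ys \<leftarrow> replicate_pmf m ?P;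
        return_pmf (((x \<or> y) \<and> \<not> v) # newrow xs ((v \<or> y) \<and> \<not> x) ys)}"
    by (simp add: bind_assoc_pmf bind_return_pmf)
  also have "\<dots> = do {x \<leftarrow> ?A; v \<leftarrow> ?B; xs \<leftarrow> replicate_pmf m ?A; y \<leftarrow> ?P; ys \<leftarrow> replicate_pmf m ?P;
        return_pmf (((x \<or> y) \<and> \<not> v) # newrow xs ((v \<or> y) \<and> \<not> x) ys)}"
    by (intro bind_pmf_cong refl bind_commute_pmf)
  also have "\<dots> = do {x \<leftarrow> ?A; v \<leftarrow> ?B; y \<leftarrow> ?P; xs \<leftarrow> replicate_pmf m ?A; ys \<leftarrow> replicate_pmf m ?P;
        return_pmf (((x \<or> y) \<and> \<not> v) # newrow xs ((v \<or> y) \<and> \<not> x) ys)}"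
    by (intro bind_pmf_cong refl bind_commute_pmf)
  also have "\<dots> = do {x \<leftarrow> ?A; v \<leftarrow> ?B; y \<leftarrow> ?P;
      return_pmf ((x \<or> y) \<and> \<not> v, (v \<or> y) \<and> \<not> x)} \<bind> ?F"
    by (simp add: bind_assoc_pmf bind_return_pmf)
  also have "\<dots> = do {x \<leftarrow> ?A; v \<leftarrow> ?B; return_pmf (x, v)} \<bind> ?F"
    by (simp only: bernoulli_burke[OF assms])
  also have "\<dots> = do {x \<leftarrow> ?A; v \<leftarrow> ?B; xs \<leftarrow> replicate_pmf m ?A; ys \<leftarrow> replicate_pmf m ?P;
      return_pmf (x # newrow xs v ys)}"
    by (simp add: bind_assoc_pmf bind_return_pmf)
  also have "\<dots> = do {x \<leftarrow> ?A; xs \<leftarrow> replicate_pmf m ?A; v \<leftarrow> ?B; ys \<leftarrow> replicate_pmf m ?P;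
      return_pmf (x # newrow xs v ys)}"
    by (intro bind_pmf_cong refl bind_commute_pmf)
  also have "\<dots> = do {x \<leftarrow> ?A; zs \<leftarrow> do {xs \<leftarrow> replicate_pmf m ?A; v \<leftarrow> ?B; ys \<leftarrow> replicate_pmf m ?P;
      return_pmf (newrow xs v ys)}; return_pmf (x # zs)}"
    by (simp add: bind_assoc_pmf bind_return_pmf)
  also have "\<dots> = replicate_pmf (Suc m) ?A"
    unfolding Suc.IH by simp
  finally show ?case .
qed (simp add: bind_return_pmf)

lemma replicate_pmf_toprow:
  assumes "a \<in> {0..1}" "b \<in> {0..1}" "p \<in> {0..1}" "a * b = p * (1 - a) * (1 - b)"
  shows "do {xs \<leftarrow> replicate_pmf m (bernoulli_pmf a); vs \<leftarrow> replicate_pmf n (bernoulli_pmf b);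
      yss \<leftarrow> replicate_pmf n (replicate_pmf m (bernoulli_pmf p)); return_pmf (toprow xs vs yss)}
    = replicate_pmf m (bernoulli_pmf a)"
proof (induction n)
  case (Suc n)
  let ?A = "replicate_pmf m (bernoulli_pmf a)" and ?B = "bernoulli_pmf b"
  let ?P = "replicate_pmf m (bernoulli_pmf p)"
  have "do {xs \<leftarrow> ?A; vs \<leftarrow> replicate_pmf (Suc n) ?B; yss \<leftarrow> replicate_pmf (Suc n) ?P; return_pmf (toprow xs vs yss)}
    = do {xs \<leftarrow> ?A; v \<leftarrow> ?B; vs \<leftarrow> replicate_pmf n ?B; ys \<leftarrow> ?P; yss \<leftarrow> replicate_pmf n ?P;
        return_pmf (toprow (newrow xs v ys) vs yss)}"
    by (simp add: bind_assoc_pmf bind_return_pmf)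
  also have "\<dots> = do {xs \<leftarrow> ?A; v \<leftarrow> ?B; ys \<leftarrow> ?P; vs \<leftarrow> replicate_pmf n ?B; yss \<leftarrow> replicate_pmf n ?P;
        return_pmf (toprow (newrow xs v ys) vs yss)}"
    by (intro bind_pmf_cong refl bind_commute_pmf)
  also have "\<dots> = do {xs \<leftarrow> do {xs \<leftarrow> ?A; v \<leftarrow> ?B; ys \<leftarrow> ?P; return_pmf (newrow xs v ys)};
        vs \<leftarrow> replicate_pmf n ?B; yss \<leftarrow> replicate_pmf n ?P; return_pmf (toprow xs vs yss)}"
    by (simp add: bind_assoc_pmf bind_return_pmf)
  also have "\<dots> = ?A" unfolding replicate_pmf_newrow[OF assms] by (rule Suc.IH)
  finally show ?case .
qed (simp add: bind_return_pmf bind_return_pmf')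

section \<open>Product Bernoulli laws: marginals, deviations and couplings\<close>

lemma map_replicate_pmf: "map_pmf (map f) (replicate_pmf n p) = replicate_pmf n (map_pmf f p)"
proof (induction n)
  case (Suc n)
  show ?case by (simp add: Suc.IH[symmetric] map_bind_pmf bind_map_pmf)
qed simp

lemma take_replicate_pmf:
  assumes "z \<le> n" shows "map_pmf (take z) (replicate_pmf n p) = replicate_pmf z p"
proof -
  have "map_pmf (take z) (replicate_pmf (z + (n - z)) p) =
      do {xs \<leftarrow> replicate_pmf z p; ys \<leftarrow> replicate_pmf (n - z) p; return_pmf (take z (xs @ ys))}"
    unfolding replicate_pmf_distrib by (simp add: map_bind_pmf)
  also have "\<dots> = do {xs \<leftarrow> replicate_pmf z p; ys \<leftarrow> replicate_pmf (n - z) p; return_pmf xs}"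
    by (intro bind_pmf_cong refl) (auto simp: set_replicate_pmf)
  also have "\<dots> = replicate_pmf z p" by (simp add: bind_return_pmf')
  finally show ?thesis using assms by simp
qed

text \<open>The binomial weights are Bernstein polynomials, whose moment sums are those of the
  Weierstrass approximation theorem.\<close>

lemma binomial_pmf_moments:
  assumes p: "p \<in> {0..1}"
  shows "measure_pmf.expectation (binomial_pmf n p) real = n * p"
    and "measure_pmf.expectation (binomial_pmf n p) (\<lambda>k. (real k - n * p)\<^sup>2) = n * p * (1 - p)"
proof -
  have 0: "(\<Sum>k\<le>n. Bernstein n k p) = 1" by (rule sum_Bernstein)
  have 1: "(\<Sum>k\<le>n. real k * Bernstein n k p) = n * p" by (rule sum_k_Bernstein)
  have 2: "(\<Sum>k\<le>n. real k * (real k - 1) * Bernstein n k p) = real n * (real n - 1) * p\<^sup>2" by (rule sum_kk_Bernstein)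
  have E: "measure_pmf.expectation (binomial_pmf n p) f = (\<Sum>k\<le>n. f k * Bernstein n k p)"
    for f :: "nat \<Rightarrow> real"
    using expectation_binomial_pmf'[OF p, of n f] by (simp add: Bernstein_def mult_ac)
  show "measure_pmf.expectation (binomial_pmf n p) real = n * p" unfolding E by (rule 1)
  have "(\<Sum>k\<le>n. (real k - n * p)\<^sup>2 * Bernstein n k p)
      = (\<Sum>k\<le>n. real k * (real k - 1) * Bernstein n k p + (1 - 2 * (n * p)) * (real k * Bernstein n k p)
          + (n * p)\<^sup>2 * Bernstein n k p)"
    by (intro sum.cong refl) (simp add: power2_eq_square algebra_simps)
  also have "\<dots> = real n * (real n - 1) * p\<^sup>2 + (1 - 2 * (n * p)) * (n * p) + (n * p)\<^sup>2"
    by (simp add: sum.distrib 0 1 2 flip: sum_distrib_left)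
  also have "\<dots> = n * p * (1 - p)" by (simp add: power2_eq_square algebra_simps)
  finally show "measure_pmf.expectation (binomial_pmf n p) (\<lambda>k. (real k - n * p)\<^sup>2) = n * p * (1 - p)"
    unfolding E .
qed

lemma binomial_pmf_chebyshev:
  assumes p: "p \<in> {0..1}" and t: "t > 0"
  shows "measure_pmf.prob (binomial_pmf n p) {k. t \<le> \<bar>real k - n * p\<bar>} \<le> n * p / t\<^sup>2"
proof -
  have "finite (set_pmf (binomial_pmf n p))" using p by (rule finite_set_pmf_binomial_pmf)
  hence int: "integrable (measure_pmf (binomial_pmf n p)) f" for f :: "nat \<Rightarrow> real"
    by (rule integrable_measure_pmf_finite)
  have "measure_pmf.prob (binomial_pmf n p) {k. t \<le> \<bar>real k - n * p\<bar>} \<le> n * p * (1 - p) / t\<^sup>2"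
    using measure_pmf.Chebyshev_inequality[of real "binomial_pmf n p" t] t int
    by (simp add: binomial_pmf_moments[OF p])
  also have "\<dots> \<le> n * p / t\<^sup>2"
    using p by (intro divide_right_mono mult_left_le) auto
  finally show ?thesis .
qed

text \<open>Only the law of \<open>f\<close> under \<open>M\<close> is prescribed, so the lemma
  serves many dependent lists on one sample space.\<close>

lemma prob_count_true_deviation:
  assumes law: "map_pmf f M = replicate_pmf n (bernoulli_pmf p)" and p: "p \<in> {0..1}" and t: "t > 0"
    and A: "\<And>x. x \<in> A \<Longrightarrow> t \<le> \<bar>real (count_true (f x)) - n * p\<bar>"
  shows "measure_pmf.prob M A \<le> n * p / t\<^sup>2"
proof -
  have "map_pmf (\<lambda>x. count_true (f x)) M = binomial_pmf n p"
    unfolding binomial_pmf_altdef[OF p] law[symmetric] by (simp add: map_pmf_comp o_def)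
  hence bin: "binomial_pmf n p = map_pmf (\<lambda>x. count_true (f x)) M" by (rule sym)
  have "measure_pmf.prob (binomial_pmf n p) {k. t \<le> \<bar>real k - n * p\<bar>}
      = measure_pmf.prob M {x. t \<le> \<bar>real (count_true (f x)) - n * p\<bar>}"
    unfolding bin by (simp add: vimage_def)
  moreover have "measure_pmf.prob M A \<le> measure_pmf.prob M {x. t \<le> \<bar>real (count_true (f x)) - n * p\<bar>}"
    using A by (intro measure_pmf.finite_measure_mono) auto
  ultimately show ?thesis using binomial_pmf_chebyshev[OF p t, of n] by linarith
qed

lemma bernoulli_thinning:
  assumes "q \<in> {0..1}" "c \<in> {0..1}"
  shows "do {x \<leftarrow> bernoulli_pmf q; y \<leftarrow> bernoulli_pmf c; return_pmf (x \<and> y)} = bernoulli_pmf (q * c)"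
proof (rule pmf_eqI)
  have "q * c \<in> {0..1}" using assms by (auto intro: mult_le_one)
  thus "pmf (do {x \<leftarrow> bernoulli_pmf q; y \<leftarrow> bernoulli_pmf c; return_pmf (x \<and> y)}) b = pmf (bernoulli_pmf (q * c)) b" for b
    using assms by (cases b) (simp_all add: pmf_bind measure_pmf_single algebra_simps)
qed

text \<open>Keeping each success of parameter \<open>a'\<close> with probability
  \<open>a / a'\<close> leaves successes of parameter \<open>a\<close>.\<close>

lemma bernoulli_coupling:
  assumes "0 \<le> a" "a \<le> a'" "a' \<le> 1"
  obtains T :: "(bool \<times> bool) pmf" where "map_pmf fst T = bernoulli_pmf a" "map_pmf snd T = bernoulli_pmf a'"
    "\<And>x. x \<in> set_pmf T \<Longrightarrow> fst x \<Longrightarrow> snd x"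
proof -
  define c where "c = (if a' = 0 then 0 else a / a')"
  have c: "c \<in> {0..1}" "a' * c = a" using assms by (auto simp: c_def divide_simps)
  define T where "T = do {x \<leftarrow> bernoulli_pmf a'; y \<leftarrow> bernoulli_pmf c; return_pmf (x \<and> y, x)}"
  show ?thesis
  proof (rule that[of T])
    have "map_pmf fst T = do {x \<leftarrow> bernoulli_pmf a'; y \<leftarrow> bernoulli_pmf c; return_pmf (x \<and> y)}"
      by (simp add: T_def map_bind_pmf)
    thus "map_pmf fst T = bernoulli_pmf a" using bernoulli_thinning[of a' c] assms c by simp
    show "map_pmf snd T = bernoulli_pmf a'" by (simp add: T_def map_bind_pmf bind_return_pmf')
    show "fst x \<Longrightarrow> snd x" if "x \<in> set_pmf T" for x using that by (auto simp: T_def)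
  qed
qed

section \<open>Longest chains in a Bernoulli field\<close>

abbreviation bernoulli_field :: "nat \<Rightarrow> real \<Rightarrow> bool list list pmf" where
  "bernoulli_field s \<theta> \<equiv> replicate_pmf s (replicate_pmf s (bernoulli_pmf \<theta>))"

text \<open>The outer list runs over the rows, as in \<open>lpp_toprow\<close>, so the horizontal
  coordinate is the inner index.\<close>

definition field_set :: "nat \<Rightarrow> bool list list \<Rightarrow> (nat \<times> nat) set" where
  "field_set s yss = {(i, j). i < s \<and> j < s \<and> yss ! j ! i}"

type_synonym boundary_sample =
  "(bool \<times> bool) list \<times> (bool \<times> bool) list \<times> bool list \<times> bool list \<times> bool list list"

lemma union_bound_list:
  "measure_pmf.prob M (\<Union>A\<in>set As. A) \<le> (\<Sum>A\<leftarrow>As. measure_pmf.prob M A)"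
proof (induction As)
  case (Cons A As)
  have "measure_pmf.prob M (\<Union>A\<in>set (A # As). A) \<le> measure_pmf.prob M A + measure_pmf.prob M (\<Union>A\<in>set As. A)"
    using measure_Un_le[of A M "\<Union>A\<in>set As. A"] by simp
  thus ?case using Cons by simp
qed simp

text \<open>
  The boundary laws \<open>al\<close>, \<open>a\<close>, \<open>ar\<close> make the processes with boundary parameters \<open>(a, a)\<close>,
  \<open>(ar, al)\<close> and \<open>(al, ar)\<close> all stationary, so all the passage times involved are sums of two
  binomials; the numerical assumption says that leaving the axes late is too expensive.
\<close>
lemma prob_lis_field_ge:
  fixes a al ar \<theta> t :: real and s z0 :: nat
  assumes par: "0 \<le> al" "al \<le> a" "a \<le> ar" "ar \<le> 1" "\<theta> \<in> {0..1}"
    and bal: "a * a = \<theta> * (1 - a) * (1 - a)" "ar * al = \<theta> * (1 - ar) * (1 - al)"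
    and t: "t > 0" and z0: "z0 \<le> s"
    and gain: "(ar + al) * s + 6 * t < 2 * a * s + (ar - a) * z0"
  shows "measure_pmf.prob (bernoulli_field s \<theta>)
      {yss. real (lis (field_set s yss)) \<ge> 2 * a * (real s - z0) - 4 * t} \<ge> 1 - 10 * (s * ar / t\<^sup>2)"
proof -
  obtain T where T: "map_pmf fst T = bernoulli_pmf a" "map_pmf snd T = bernoulli_pmf ar"
    "\<And>x. x \<in> set_pmf T \<Longrightarrow> fst x \<Longrightarrow> snd x"
    using bernoulli_coupling[of a ar] par by auto
  let ?T = "replicate_pmf s T" and ?L = "replicate_pmf s (bernoulli_pmf al)"
  let ?W = "bernoulli_field s \<theta>"
  \<comment> \<open>The pairs in \<open>us\<close> and \<open>vs\<close> couple the parameters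
    \<open>a\<close> and \<open>ar\<close> monotonically, as \<open>lpp_exit\<close> demands. The
    boundaries \<open>ul\<close> and \<open>vl\<close> play the roles of \<open>v''\<close> and
    \<open>u''\<close> there and can be independent.\<close>
  define M where "M = do {us \<leftarrow> ?T; vs \<leftarrow> ?T; ul \<leftarrow> ?L; vl \<leftarrow> ?L; yss \<leftarrow> ?W; return_pmf (us, vs, ul, vl, yss)}"
  have EA: "replicate_pmf s (bernoulli_pmf a) = map_pmf (map fst) ?T"
    and EAR: "replicate_pmf s (bernoulli_pmf ar) = map_pmf (map snd) ?T"
    by (simp_all add: map_replicate_pmf T)
  define U :: "boundary_sample \<Rightarrow> bool list" where "U = (\<lambda>(us, vs, ul, vl, yss). map fst us)"
  define V :: "boundary_sample \<Rightarrow> bool list" where "V = (\<lambda>(us, vs, ul, vl, yss). map fst vs)"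
  define UR :: "boundary_sample \<Rightarrow> bool list" where "UR = (\<lambda>(us, vs, ul, vl, yss). map snd us)"
  define VR :: "boundary_sample \<Rightarrow> bool list" where "VR = (\<lambda>(us, vs, ul, vl, yss). map snd vs)"
  define UL :: "boundary_sample \<Rightarrow> bool list" where "UL = (\<lambda>(us, vs, ul, vl, yss). ul)"
  define VL :: "boundary_sample \<Rightarrow> bool list" where "VL = (\<lambda>(us, vs, ul, vl, yss). vl)"
  define Y :: "boundary_sample \<Rightarrow> bool list list" where "Y = (\<lambda>(us, vs, ul, vl, yss). yss)"
  note defs = U_def V_def UR_def VR_def UL_def VL_def Y_def
  have lawU: "map_pmf U M = replicate_pmf s (bernoulli_pmf a)"
    and lawV: "map_pmf V M = replicate_pmf s (bernoulli_pmf a)"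
    and lawUR: "map_pmf UR M = replicate_pmf s (bernoulli_pmf ar)"
    and lawVR: "map_pmf VR M = replicate_pmf s (bernoulli_pmf ar)"
    and lawUL: "map_pmf UL M = replicate_pmf s (bernoulli_pmf al)"
    and lawVL: "map_pmf VL M = replicate_pmf s (bernoulli_pmf al)"
    and lawY: "map_pmf Y M = ?W"
    unfolding M_def defs EA EAR by (simp_all add: map_bind_pmf bind_return_pmf') (simp_all add: map_pmf_def)
  \<comment> \<open>Each of the three processes sees independent sources, sinks and cells, although
    they share randomness with each other.\<close>
  have law1: "map_pmf (\<lambda>x. toprow (U x) (V x) (Y x)) M = replicate_pmf s (bernoulli_pmf a)"
    using replicate_pmf_toprow[of a a \<theta> s s] par bal
    unfolding M_def defs EA EAR by (simp add: map_bind_pmf bind_map_pmf)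
  have law2: "map_pmf (\<lambda>x. toprow (UR x) (VL x) (Y x)) M = replicate_pmf s (bernoulli_pmf ar)"
    using replicate_pmf_toprow[of ar al \<theta> s s] par bal
    unfolding M_def defs EA EAR by (simp add: map_bind_pmf bind_map_pmf)
  have law3: "map_pmf (\<lambda>x. toprow (UL x) (VR x) (Y x)) M = replicate_pmf s (bernoulli_pmf al)"
    using replicate_pmf_toprow[of al ar \<theta> s s] par bal
    unfolding M_def defs EA EAR by (simp add: map_bind_pmf bind_map_pmf mult_ac, subst bind_commute_pmf, simp)
  have lawt: "map_pmf (\<lambda>x. take z0 (f x)) M = replicate_pmf z0 p" if "map_pmf f M = replicate_pmf s p" for f and p :: "bool pmf"
  proof -
    have "map_pmf (take z0) (map_pmf f M) = replicate_pmf z0 p"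
      unfolding that by (rule take_replicate_pmf[OF z0])
    thus ?thesis by (simp add: map_pmf_comp)
  qed
  define dev where "dev f n p = {x. t \<le> \<bar>real (count_true (f x)) - n * p\<bar>}" 
    for f :: "boundary_sample \<Rightarrow> bool list" and n :: nat and p :: real
  have dev: "measure_pmf.prob M (dev f n p) \<le> s * ar / t\<^sup>2"
    if "map_pmf f M = replicate_pmf n (bernoulli_pmf p)" "n \<le> s" "0 \<le> p" "p \<le> ar" for f n p
  proof -
    have "measure_pmf.prob M (dev f n p) \<le> n * p / t\<^sup>2"
      using that par t by (intro prob_count_true_deviation[where f = f]) (auto simp: dev_def)
    also have "\<dots> \<le> s * ar / t\<^sup>2" using that by (intro divide_right_mono mult_mono) auto
    finally show ?thesis .
  qed
  \<comment> \<open>Ten counts: sinks and top row of each of the three processes, and the first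
    \<open>z0\<close> entries of the four boundaries of parameters \<open>a\<close> and
    \<open>ar\<close>.\<close>
  define Bs where "Bs = [dev V s a, dev (\<lambda>x. toprow (U x) (V x) (Y x)) s a,
    dev VL s al, dev (\<lambda>x. toprow (UR x) (VL x) (Y x)) s ar,
    dev VR s ar, dev (\<lambda>x. toprow (UL x) (VR x) (Y x)) s al,
    dev (\<lambda>x. take z0 (U x)) z0 a, dev (\<lambda>x. take z0 (V x)) z0 a,
    dev (\<lambda>x. take z0 (UR x)) z0 ar, dev (\<lambda>x. take z0 (VR x)) z0 ar]"
  define Bad where "Bad = (\<Union>A\<in>set Bs. A)"
  have "measure_pmf.prob M Bad \<le> (\<Sum>A\<leftarrow>Bs. measure_pmf.prob M A)"
    unfolding Bad_def by (rule union_bound_list)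
  also have "\<dots> \<le> (\<Sum>A\<leftarrow>Bs. s * ar / t\<^sup>2)"
    using dev lawV law1 lawVL law2 lawVR law3 lawt[OF lawU] lawt[OF lawV] lawt[OF lawUR] lawt[OF lawVR] par z0
    by (intro sum_list_mono) (auto simp: Bs_def)
  also have "\<dots> = 10 * (s * ar / t\<^sup>2)" by (simp add: Bs_def)
  finally have bad: "measure_pmf.prob M Bad \<le> 10 * (s * ar / t\<^sup>2)" .
  define G where "G = {yss. real (lis (field_set s yss)) \<ge> 2 * a * (real s - z0) - 4 * t}"
  have good: "Y x \<in> G" if x: "x \<in> set_pmf M" "x \<notin> Bad" for x
  proof -
    obtain us vs ul vl yss where xx: "x = (us, vs, ul, vl, yss)" by (cases x) auto
    have len: "length us = s" "length vs = s" "length ul = s" "length vl = s" "length yss = s"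
      "\<And>ys. ys \<in> set yss \<Longrightarrow> length ys = s"
      and mono: "\<And>b. b \<in> set us \<Longrightarrow> fst b \<Longrightarrow> snd b" "\<And>b. b \<in> set vs \<Longrightarrow> fst b \<Longrightarrow> snd b"
      using x(1) T(3) unfolding xx M_def by (auto simp: set_replicate_pmf in_lists_conv_set)
    let ?w = "\<lambda>i j. yss ! j ! i"
    have dv: "\<bar>real (count_true (f x)) - n * p\<bar> < t" if "dev f n p \<in> set Bs" for f n p
      using x(2) that by (auto simp: Bad_def dev_def)
    have dvs: "\<bar>real (count_true (V x)) - s * a\<bar> < t" "\<bar>real (count_true (toprow (U x) (V x) (Y x))) - s * a\<bar> < t"
      "\<bar>real (count_true (VL x)) - s * al\<bar> < t" "\<bar>real (count_true (toprow (UR x) (VL x) (Y x))) - s * ar\<bar> < t"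
      "\<bar>real (count_true (VR x)) - s * ar\<bar> < t" "\<bar>real (count_true (toprow (UL x) (VR x) (Y x))) - s * al\<bar> < t"
      "\<bar>real (count_true (take z0 (U x))) - z0 * a\<bar> < t" "\<bar>real (count_true (take z0 (V x))) - z0 * a\<bar> < t"
      "\<bar>real (count_true (take z0 (UR x))) - z0 * ar\<bar> < t" "\<bar>real (count_true (take z0 (VR x))) - z0 * ar\<bar> < t"
      by (rule dv; simp add: Bs_def)+
    have lens: "length (U x) = s" "length (V x) = s" "length (UR x) = s" "length (VR x) = s"
      "length (UL x) = s" "length (VL x) = s" "length (Y x) = s" "Y x = yss" using len by (auto simp: xx defs)
    have G1: "lpp ((!) (U x)) ((!) (V x)) ?w s s = count_true (V x) + count_true (toprow (U x) (V x) (Y x))"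
      and G2: "lpp ((!) (UR x)) ((!) (VL x)) ?w s s = count_true (VL x) + count_true (toprow (UR x) (VL x) (Y x))"
      and G3: "lpp ((!) (UL x)) ((!) (VR x)) ?w s s = count_true (VR x) + count_true (toprow (UL x) (VR x) (Y x))"
      unfolding lens(8) using lens len by (auto intro!: lpp_toprow)
    have fs: "{(i, j). i < s \<and> j < s \<and> ?w i j} = field_set s yss" by (simp add: field_set_def)
    have ex: "lpp ((!) (U x)) ((!) (V x)) ?w s s
          \<le> lis (field_set s yss) + psum ((!) (U x)) z0 + psum ((!) (V x)) z0 \<or>
        lpp ((!) (U x)) ((!) (V x)) ?w s s + psum ((!) (UR x)) z0
          \<le> lpp ((!) (UR x)) ((!) (VL x)) ?w s s + psum ((!) (U x)) z0 \<or>
        lpp ((!) (U x)) ((!) (V x)) ?w s s + psum ((!) (VR x)) z0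
          \<le> lpp ((!) (UL x)) ((!) (VR x)) ?w s s + psum ((!) (V x)) z0"
      unfolding fs[symmetric] using mono len by (intro lpp_exit) (auto simp: xx defs)
    have ps: "psum ((!) xs) z0 = count_true (take z0 xs)" if "length xs = s" for xs
      using that z0 by (intro psum_nth_take) auto
    have sums: "count_true (V x) + count_true (toprow (U x) (V x) (Y x))
          \<le> lis (field_set s yss) + count_true (take z0 (U x)) + count_true (take z0 (V x)) \<or>
        count_true (V x) + count_true (toprow (U x) (V x) (Y x)) + count_true (take z0 (UR x))
          \<le> count_true (VL x) + count_true (toprow (UR x) (VL x) (Y x)) + count_true (take z0 (U x)) \<or>
        count_true (V x) + count_true (toprow (U x) (V x) (Y x)) + count_true (take z0 (VR x))
          \<le> count_true (VR x) + count_true (toprow (UL x) (VR x) (Y x)) + count_true (take z0 (V x))"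
      using ex unfolding G1 G2 G3 ps[OF lens(1)] ps[OF lens(2)] ps[OF lens(3)] ps[OF lens(4)] .
    have gain': "s * ar + s * al + 6 * t < s * a + s * a + z0 * ar - z0 * a"
      using gain by (simp add: algebra_simps)
    note dvs' = dvs[unfolded abs_less_iff]
    \<comment> \<open>The two late-exit alternatives involve six counts, each off by less than
      \<open>t\<close>, and contradict \<open>gain'\<close>. The early-exit alternative involves
      four counts, hence the loss \<open>4 * t\<close>.\<close>
    have "real (lis (field_set s yss)) \<ge> s * a + s * a - z0 * a - z0 * a - 4 * t"
      using sums by (elim disjE) (use dvs' gain' in linarith)+
    thus ?thesis by (simp add: G_def lens(8) algebra_simps)
  qed
  have "1 - measure_pmf.prob M Bad = measure_pmf.prob M (- Bad)"
    using measure_pmf.prob_compl[of Bad M] by (simp add: Compl_eq_Diff_UNIV)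
  also have "\<dots> \<le> measure_pmf.prob M (Y -` G)"
    using good by (intro measure_pmf.finite_measure_mono_AE) (auto simp: AE_measure_pmf_iff)
  also have "\<dots> = measure_pmf.prob ?W G" unfolding lawY[symmetric] by simp
  finally show ?thesis using bad unfolding G_def by linarith
qed

text \<open>The field has density \<open>x ^ 2\<close>, so \<open>(s * x) ^ 2\<close> points on
  average, and the stationary passage time is about \<open>2 * s * x\<close>. Raising one boundary
  and lowering the other costs \<open>r + 1 / r - 2\<close>, at most
  \<open>\<epsilon> ^ 2 / 4\<close>, in units of \<open>s * x\<close>. A path that stays on an axis
  beyond \<open>\<epsilon> * s\<close> would gain nearly \<open>\<epsilon> ^ 2 / 2\<close> from the
  denser boundary, which is more.\<close>

lemma prob_lis_field_near_optimal:
  fixes \<epsilon> x :: real and s :: nat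
  assumes e: "0 < \<epsilon>" "\<epsilon> \<le> 1" and x: "0 < x" "x \<le> \<epsilon>\<^sup>2 / 100" and A: "46080 / \<epsilon> ^ 5 \<le> s * x"
  shows "measure_pmf.prob (bernoulli_field s (x\<^sup>2))
    {yss. real (lis (field_set s yss)) \<ge> (2 - 5 * \<epsilon>) * (s * x)} \<ge> 1 - \<epsilon>"
proof -
  let ?P = "measure_pmf.prob (bernoulli_field s (x\<^sup>2))"
  \<comment> \<open>The odds of \<open>a\<close>, \<open>ar\<close>, \<open>al\<close> are
    \<open>x\<close>, \<open>r * x\<close>, \<open>x / r\<close>. A balance equation says that the
    odds of sources and sinks multiply to \<open>x ^ 2\<close>.\<close>
  define r where "r = 1 + \<epsilon> / 2"
  define a where "a = x / (1 + x)"
  define ar where "ar = r * x / (1 + r * x)"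
  define al where "al = x / (r + x)"
  define B where "B = s * x"
  \<comment> \<open>\<open>6 * t\<close> is then \<open>\<epsilon> ^ 2 * B / 8\<close>, within the
    margin between gain and cost. The failure bound \<open>20 * B / t ^ 2\<close> equals
    \<open>20 * 48 ^ 2 / (\<epsilon> ^ 4 * B)\<close>, and
    \<open>20 * 48 ^ 2 = 46080\<close>.\<close>
  define t where "t = \<epsilon>\<^sup>2 * B / 48"
  define z0 where "z0 = nat \<lceil>\<epsilon> * s\<rceil>"
  have e2: "\<epsilon>\<^sup>2 \<le> \<epsilon>" "\<epsilon>\<^sup>2 > 0" using e by (auto simp: power2_eq_square mult_left_le)
  have x100: "x \<le> 1 / 100" "x \<le> \<epsilon> / 100" using x(2) e2 e by linarith+
  have r: "1 \<le> r" "r \<le> 3 / 2" using e by (auto simp: r_def)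
  have rx: "0 < r * x" "r * x \<le> 3 / 200" using r x(1) x100 mult_mono[of r "3/2" x "1/100"] by auto
  have B1: "46080 \<le> B * \<epsilon> ^ 5" using A e by (simp add: B_def field_simps)
  have B0: "B \<ge> 46080"
  proof -
    have "B \<ge> 0" using x by (simp add: B_def)
    hence "B * \<epsilon> ^ 5 \<le> B" using e by (intro mult_left_le power_le_one) auto
    thus ?thesis using B1 by linarith
  qed
  have s: "real s = B / x" "real s \<ge> 100 / \<epsilon>"
  proof -
    show "real s = B / x" using x by (simp add: B_def)
    also have "\<dots> \<ge> 1 / (\<epsilon> / 100)" using B0 x x100 e by (intro frac_le) auto
    finally show "real s \<ge> 100 / \<epsilon>" by simp
  qed
  have es: "\<epsilon> * s \<ge> 100" using s(2) e by (simp add: field_simps)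
  have z0: "\<epsilon> * s \<le> z0" "z0 \<le> \<epsilon> * s + 1" using es by (auto simp: z0_def)
  have z0s: "z0 \<le> s"
  proof -
    have "\<epsilon> * s \<le> s" using e by (simp add: mult_left_le_one_le)
    thus ?thesis unfolding z0_def by linarith
  qed
  have xsq: "x\<^sup>2 \<in> {0..1}" using x(1) x100 by (auto simp: power2_eq_square intro: mult_le_one)
  have par: "0 \<le> al" "al \<le> a" "a \<le> ar" "ar \<le> 1"
  proof -
    show "0 \<le> al" using x r by (simp add: al_def)
    show "al \<le> a" using x r by (simp add: al_def a_def frac_le)
    have "x \<le> r * x" using x(1) r by simp
    hence "1 / (1 + r * x) \<le> 1 / (1 + x)" using x(1) by (intro frac_le) auto
    moreover have "a = 1 - 1 / (1 + x)" using x(1) by (simp add: a_def field_simps)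
    moreover have "ar = 1 - 1 / (1 + r * x)" using rx by (simp add: ar_def field_simps)
    ultimately show "a \<le> ar" by linarith
    show "ar \<le> 1" using rx by (simp add: ar_def)
  qed
  have bal: "a * a = x\<^sup>2 * (1 - a) * (1 - a)" "ar * al = x\<^sup>2 * (1 - ar) * (1 - al)"
  proof -
    have "1 - a = 1 / (1 + x)" using x by (simp add: a_def field_simps)
    thus "a * a = x\<^sup>2 * (1 - a) * (1 - a)" by (simp add: a_def power2_eq_square)
    have "1 - ar = 1 / (1 + r * x)" using rx by (simp add: ar_def field_simps)
    moreover have "1 - al = r / (r + x)" using x r by (simp add: al_def field_simps)
    ultimately show "ar * al = x\<^sup>2 * (1 - ar) * (1 - al)" by (simp add: ar_def al_def power2_eq_square)
  qed
  have a_ge: "a \<ge> x * (1 - x)"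
  proof -
    have "x * (1 - x) * (1 + x) = x - x ^ 3" by (simp add: power3_eq_cube algebra_simps)
    also have "\<dots> \<le> x" using x by simp
    finally show ?thesis using x by (simp add: a_def le_divide_eq)
  qed
  have a_le: "a \<le> x" using divide_left_mono[of 1 "1 + x" x] x by (simp add: a_def)
  have ar_le: "ar \<le> r * x" using divide_left_mono[of 1 "1 + r * x" "r * x"] rx by (simp add: ar_def)
  have al_le: "al \<le> x / r" using x r by (simp add: al_def frac_le)
  have sumr: "r + 1 / r \<le> 2 + \<epsilon>\<^sup>2 / 4"
  proof -
    have "r + 1 / r - 2 = (r - 1)\<^sup>2 / r" using r by (simp add: power2_eq_square field_simps)
    also have "\<dots> \<le> (r - 1)\<^sup>2 / 1" using r by (intro divide_left_mono) auto
    also have "\<dots> = \<epsilon>\<^sup>2 / 4" by (simp add: r_def power2_eq_square)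
    finally show ?thesis by simp
  qed
  have ar_al: "ar + al \<le> x * (2 + \<epsilon>\<^sup>2 / 4)"
  proof -
    have "ar + al \<le> x * (r + 1 / r)" using ar_le al_le by (simp add: algebra_simps)
    also have "\<dots> \<le> x * (2 + \<epsilon>\<^sup>2 / 4)" using sumr x by (intro mult_left_mono) auto
    finally show ?thesis .
  qed
  have ar_a: "ar - a \<ge> x * (2 * \<epsilon> / 5)"
  proof -
    define D where "D = (1 + r * x) * (1 + x)"
    have D: "0 < D" unfolding D_def using rx x by (intro mult_pos_pos) linarith+
    have D': "D \<le> 5 / 4"
    proof -
      have "(1 + r * x) * (1 + x) \<le> (1 + 3 / 200) * (1 + 1 / 100)"
        using rx x x100 by (intro mult_mono) auto
      also have "\<dots> \<le> 5 / (4::real)" by simp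
      finally show ?thesis unfolding D_def .
    qed
    have "ar - a = x * (r - 1) / D"
      using rx x by (simp add: ar_def a_def D_def divide_simps) (simp add: algebra_simps)
    also have "\<dots> \<ge> x * (r - 1) / (5 / 4)"
      using D D' x r by (intro divide_left_mono) simp_all
    finally show ?thesis by (simp add: r_def mult_ac)
  qed
  have gain: "(ar + al) * s + 6 * t < 2 * a * s + (ar - a) * z0"
  proof -
    have 1: "(ar + al) * s \<le> B * (2 + \<epsilon>\<^sup>2 / 4)"
      using mult_right_mono[OF ar_al, of s] by (simp add: B_def mult_ac)
    have 2: "2 * a * s \<ge> 2 * B * (1 - x)"
      using mult_right_mono[OF a_ge, of "2 * s"] by (simp add: B_def mult_ac)
    have 3: "(ar - a) * z0 \<ge> B * (2 * \<epsilon>\<^sup>2 / 5)"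
    proof -
      have "(ar - a) * z0 \<ge> (x * (2 * \<epsilon> / 5)) * (\<epsilon> * s)"
        using ar_a z0 x e par by (intro mult_mono) auto
      thus ?thesis by (simp add: B_def power2_eq_square mult_ac)
    qed
    have 4: "B * x \<le> B * (\<epsilon>\<^sup>2 / 100)" using x B0 by (intro mult_left_mono) auto
    have 5: "B * \<epsilon>\<^sup>2 > 0" using B0 e2 by simp
    \<comment> \<open>In units of \<open>\<epsilon> ^ 2 * B\<close> the comparison reads
      \<open>1/4 + 1/8 < 2/5 - 1/50\<close>.\<close>
    show ?thesis using 1 2 3 4 5 by (simp add: t_def algebra_simps)
  qed
  have t: "t > 0" using B0 e2 by (simp add: t_def)
  have "(2 - 5 * \<epsilon>) * B \<le> 2 * a * (real s - z0) - 4 * t"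
  proof -
    have "x * z0 \<le> \<epsilon> * B + x" using mult_left_mono[OF z0(2), of x] x by (simp add: B_def algebra_simps)
    hence "a * z0 \<le> \<epsilon> * B + x" using mult_right_mono[OF a_le, of z0] by simp
    moreover have "a * s \<ge> B * (1 - x)" using mult_right_mono[OF a_ge, of s] by (simp add: B_def mult_ac)
    moreover have "B * x \<le> B * (\<epsilon> / 100)" using x100 B0 by (intro mult_left_mono) auto
    moreover have "x \<le> \<epsilon> * B"
    proof -
      have "\<epsilon> * 1 \<le> \<epsilon> * B" using B0 e by (intro mult_left_mono) auto
      thus ?thesis using x100 e by linarith
    qed
    moreover have "4 * t \<le> \<epsilon> * B / 12"
      using mult_right_mono[OF e2(1), of B] B0 by (simp add: t_def)
    moreover have "\<epsilon> * B > 0" using e B0 by simp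
    ultimately show ?thesis by (simp add: algebra_simps)
  qed
  hence "{yss. real (lis (field_set s yss)) \<ge> 2 * a * (real s - z0) - 4 * t}
      \<subseteq> {yss. real (lis (field_set s yss)) \<ge> (2 - 5 * \<epsilon>) * B}" by auto
  hence "?P {yss. real (lis (field_set s yss)) \<ge> 2 * a * (real s - z0) - 4 * t}
    \<le> ?P {yss. real (lis (field_set s yss)) \<ge> (2 - 5 * \<epsilon>) * B}"
    by (intro measure_pmf.finite_measure_mono) auto
  moreover have "1 - 10 * (s * ar / t\<^sup>2) \<le> ?P {yss. real (lis (field_set s yss)) \<ge> 2 * a * (real s - z0) - 4 * t}"
    using par xsq bal t z0s gain by (rule prob_lis_field_ge)
  moreover have "10 * (s * ar / t\<^sup>2) \<le> \<epsilon>"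
  proof -
    have "s * ar \<le> 2 * B" 
    proof -
      have "r * x \<le> 2 * x" using r x by (intro mult_right_mono) auto
      hence "s * ar \<le> s * (2 * x)" using ar_le by (intro mult_left_mono) auto
      thus ?thesis by (simp add: B_def)
    qed
    hence "10 * (s * ar / t\<^sup>2) \<le> 20 * B / t\<^sup>2" using divide_right_mono[of "s * ar" "2 * B" "t\<^sup>2"] by simp
    also have "\<dots> = 46080 / (\<epsilon> ^ 4 * B)"
      using B0 e by (simp add: t_def power_divide power_mult_distrib field_simps power2_eq_square power4_eq_xxxx)
    also have "\<dots> \<le> \<epsilon>"
    proof -
      have "B * \<epsilon> ^ 5 = \<epsilon> * (\<epsilon> ^ 4 * B)" by (simp add: eval_nat_numeral)
      hence "46080 \<le> \<epsilon> * (\<epsilon> ^ 4 * B)" using B1 by linarith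
      moreover have "0 < \<epsilon> ^ 4 * B" using B0 e by simp
      ultimately show ?thesis by (simp only: pos_divide_le_eq)
    qed
    finally show ?thesis .
  qed
  ultimately show ?thesis unfolding B_def by linarith
qed

section \<open>Densities of replicated laws and pairs of successes\<close>

lemma pmf_replicate_pmf:
  "length xs = n \<Longrightarrow> pmf (replicate_pmf n p) xs = prod_list (map (pmf p) xs)"
proof (induction xs arbitrary: n)
  case (Cons x xs)
  obtain m where n: "n = Suc m" "length xs = m" using Cons.prems by auto
  have "replicate_pmf n p = map_pmf (\<lambda>(x, xs). x # xs) (pair_pmf p (replicate_pmf m p))"
    by (simp add: n pair_pmf_def map_bind_pmf)
  moreover have "inj (\<lambda>(x :: 'a, xs). x # xs)" by (auto simp: inj_def)
  ultimately have "pmf (replicate_pmf n p) (x # xs) = pmf (pair_pmf p (replicate_pmf m p)) (x, xs)"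
    using pmf_map_inj'[of "\<lambda>(x :: 'a, xs). x # xs" "pair_pmf p (replicate_pmf m p)" "(x, xs)"] by simp
  thus ?case using Cons.IH[OF n(2)] by (simp add: pmf_pair)
qed simp

lemma nth_replicate_pmf:
  "j < n \<Longrightarrow> map_pmf (\<lambda>xs. xs ! j) (replicate_pmf n p) = p"
proof (induction n arbitrary: j)
  case (Suc n)
  show ?case
  proof (cases j)
    case 0
    thus ?thesis by (simp add: map_bind_pmf bind_return_pmf')
  next
    case (Suc i)
    have "map_pmf (\<lambda>xs. xs ! j) (replicate_pmf (Suc n) p) = p \<bind> (\<lambda>_. map_pmf (\<lambda>xs. xs ! i) (replicate_pmf n p))"
      by (simp add: map_bind_pmf Suc) (simp add: map_pmf_def)
    thus ?thesis using Suc Suc.IH[of i] Suc.prems by simp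
  qed
qed simp

lemma concat_replicate_pmf:
  "map_pmf concat (replicate_pmf n (replicate_pmf m p)) = replicate_pmf (n * m) p"
proof (induction n)
  case (Suc n)
  have "map_pmf concat (replicate_pmf (Suc n) (replicate_pmf m p)) =
      do {xs \<leftarrow> replicate_pmf m p; ys \<leftarrow> map_pmf concat (replicate_pmf n (replicate_pmf m p)); return_pmf (xs @ ys)}"
    by (simp add: map_bind_pmf bind_map_pmf)
  also have "\<dots> = replicate_pmf (m + n * m) p"
    unfolding Suc.IH by (simp add: replicate_pmf_distrib)
  finally show ?case by simp
qed simp

text \<open>Markov's inequality for the number \<open>k * (k - 1) / 2\<close> of pairs of
  successes.\<close>

lemma prob_two_successes_le:
  assumes law: "map_pmf f M = replicate_pmf n (bernoulli_pmf p)" and p: "p \<in> {0..1}"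
    and A: "\<And>x. x \<in> A \<Longrightarrow> 2 \<le> count_true (f x)"
  shows "measure_pmf.prob M A \<le> (n * p)\<^sup>2 / 2"
proof -
  define Q where "Q = binomial_pmf n p"
  have fin: "finite (set_pmf Q)" unfolding Q_def using p by (rule finite_set_pmf_binomial_pmf)
  have E: "measure_pmf.expectation Q (\<lambda>k. real k * (real k - 1)) = real n * (real n - 1) * p\<^sup>2"
    unfolding Q_def using expectation_binomial_pmf'[OF p, of n "\<lambda>k. real k * (real k - 1)"]
      sum_kk_Bernstein[of n p] by (simp add: Bernstein_def mult_ac)
  have Q: "Q = map_pmf (\<lambda>x. count_true (f x)) M"
    unfolding Q_def binomial_pmf_altdef[OF p] law[symmetric] by (simp add: map_pmf_comp o_def)
  have "measure_pmf.prob M {x. 2 \<le> count_true (f x)} = measure_pmf.prob Q {k. 2 \<le> k}"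
    unfolding Q by (simp add: vimage_def)
  moreover have "measure_pmf.prob M A \<le> measure_pmf.prob M {x. 2 \<le> count_true (f x)}"
    using A by (intro measure_pmf.finite_measure_mono) auto
  moreover have "measure_pmf.prob Q {k. 2 \<le> k} = measure_pmf.expectation Q (indicator {k. 2 \<le> k})"
    by simp
  moreover have "\<dots> \<le> measure_pmf.expectation Q (\<lambda>k. real k * (real k - 1) / 2)"
  proof (intro integral_mono integrable_measure_pmf_finite fin)
    fix k :: nat
    have "2 * 1 \<le> real k * (real k - 1)" if "2 \<le> k" using that by (intro mult_mono) auto
    thus "indicator {k. 2 \<le> k} k \<le> real k * (real k - 1) / 2"
      by (cases "k = 0"; cases "k = 1") (auto simp: indicator_def)
  qed
  moreover have "\<dots> = real n * (real n - 1) * p\<^sup>2 / 2" using E by simp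
  moreover have "\<dots> \<le> (n * p)\<^sup>2 / 2"
    using p by (simp add: power2_eq_square algebra_simps)
  ultimately show ?thesis by linarith
qed

subsection \<open>Configurations without ties\<close>

text \<open>The complements of \<open>A\<close> and of its image have the same size, so any
  bijection between them completes \<open>f\<close>.\<close>

lemma finite_bij_extend:
  assumes S: "finite S" "A \<subseteq> S" and f: "inj_on f A" "f ` A \<subseteq> S"
  shows "\<exists>h. h permutes S \<and> (\<forall>x\<in>A. h x = f x)"
proof -
  have fin: "finite A" using S by (auto intro: finite_subset)
  have "card (S - A) = card (S - f ` A)"
    using S f fin by (simp add: card_Diff_subset card_image)
  then obtain k where k: "bij_betw k (S - A) (S - f ` A)"
    using finite_same_card_bij[of "S - A" "S - f ` A"] S by auto
  define h where "h x = (if x \<in> A then f x else if x \<in> S then k x else x)" for x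
  have "bij_betw h A (f ` A)"
    using f by (subst bij_betw_cong[of A h f]) (auto simp: h_def inj_on_imp_bij_betw)
  moreover have "bij_betw h (S - A) (S - f ` A)"
    using k by (subst bij_betw_cong[of _ h k]) (auto simp: h_def)
  ultimately have "bij_betw h (A \<union> (S - A)) (f ` A \<union> (S - f ` A))"
    by (rule bij_betw_combine) auto
  moreover have "A \<union> (S - A) = S" "f ` A \<union> (S - f ` A) = S" using S f by auto
  ultimately have "bij_betw h S S" by simp
  hence "h permutes S" by (rule bij_imp_permutes) (use S in \<open>auto simp: h_def\<close>)
  thus ?thesis by (intro exI[of _ h]) (auto simp: h_def)
qed

definition grid :: "nat \<Rightarrow> (nat \<times> nat) set" where
  "grid s = {..<s} \<times> {..<s}"

definition tie_free :: "(nat \<times> nat) set \<Rightarrow> bool" where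
  "tie_free Z \<longleftrightarrow> inj_on fst Z \<and> inj_on snd Z"

definition tf_configs :: "nat \<Rightarrow> nat \<Rightarrow> (nat \<times> nat) set set" where
  "tf_configs s k = {Z. Z \<subseteq> grid s \<and> tie_free Z \<and> card Z = k}"

lemma finite_grid [simp]: "finite (grid s)"
  by (simp add: grid_def)

lemma finite_tf_configs: "finite (tf_configs s k)"
  by (rule finite_subset[of _ "Pow (grid s)"]) (auto simp: tf_configs_def)

lemma tf_configs_finite_elem: "Z \<in> tf_configs s k \<Longrightarrow> finite Z"
  by (auto simp: tf_configs_def intro: finite_subset[OF _ finite_grid])

lemma tie_free_card_le: "Z \<subseteq> grid s \<Longrightarrow> tie_free Z \<Longrightarrow> card Z \<le> s"
proof -
  assume Z: "Z \<subseteq> grid s" "tie_free Z"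
  have "fst ` Z \<subseteq> {..<s}" using Z by (force simp: grid_def)
  thus ?thesis using card_inj_on_le[of fst Z "{..<s}"] Z by (simp add: tie_free_def)
qed

lemma tie_free_insert:
  "tie_free (insert (i, j) Z) \<longleftrightarrow> (i, j) \<in> Z \<and> tie_free Z \<or> i \<notin> fst ` Z \<and> j \<notin> snd ` Z \<and> tie_free Z"
proof (cases "(i, j) \<in> Z")
  case False
  hence "Z - {(i, j)} = Z" by simp
  thus ?thesis using False unfolding tie_free_def by (auto simp: inj_on_insert)
qed (auto simp: insert_absorb)

definition tf_extend :: "nat \<Rightarrow> (nat \<times> nat) set \<Rightarrow> (nat \<times> nat) set" where
  "tf_extend s Z = ({..<s} - fst ` Z) \<times> ({..<s} - snd ` Z)"

lemma card_tf_extend: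
  assumes "Z \<in> tf_configs s k"
  shows "card (tf_extend s Z) = (s - k) * (s - k)"
proof -
  have "finite Z" using assms by (rule tf_configs_finite_elem)
  moreover have "fst ` Z \<subseteq> {..<s}" "snd ` Z \<subseteq> {..<s}" using assms by (auto simp: tf_configs_def grid_def)
  moreover have "card (fst ` Z) = k" "card (snd ` Z) = k"
    using assms by (auto simp: tf_configs_def tie_free_def card_image)
  ultimately show ?thesis
    by (simp add: tf_extend_def card_cartesian_product card_Diff_subset)
qed

text \<open>
  Both parts count the pairs of a tie-free configuration and a one-point extension of it.
\<close>
lemma tf_configs_double_count:
  assumes E: "\<And>Z Z'. Z \<subseteq> Z' \<Longrightarrow> Z' \<subseteq> grid s \<Longrightarrow> Z \<in> E \<Longrightarrow> Z' \<in> E"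
  shows "card (tf_configs s k \<inter> E) * ((s - k) * (s - k)) \<le> card (tf_configs s (Suc k) \<inter> E) * Suc k"
    and "card (tf_configs s k) * ((s - k) * (s - k)) = card (tf_configs s (Suc k)) * Suc k"
proof -
  \<comment> \<open>\<open>L\<close> attaches to a configuration a point to add, \<open>R\<close>
    attaches to one a point to remove, and \<open>F\<close> matches the two.\<close>
  define L where "L X = (SIGMA Z:X. tf_extend s Z)" for X
  define R where "R X = (SIGMA Z:X. Z)" for X :: "(nat \<times> nat) set set"
  define F where "F = (\<lambda>(Z, p). (insert p Z, p :: nat \<times> nat))"
  have cL: "card (L X) = card X * ((s - k) * (s - k))" if "X \<subseteq> tf_configs s k" for X
  proof -
    have "card (L X) = (\<Sum>Z\<in>X. card (tf_extend s Z))"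
      unfolding L_def using finite_subset[OF that finite_tf_configs]
      by (intro card_SigmaI) (auto simp: tf_extend_def)
    also have "\<dots> = (\<Sum>Z\<in>X. (s - k) * (s - k))" using that by (intro sum.cong card_tf_extend) auto
    finally show ?thesis by simp
  qed
  have cR: "card (R X) = card X * Suc k" if "X \<subseteq> tf_configs s (Suc k)" for X
  proof -
    have "card (R X) = (\<Sum>Z\<in>X. card Z)"
      unfolding R_def using finite_subset[OF that finite_tf_configs] tf_configs_finite_elem that
      by (intro card_SigmaI) blast+
    also have "\<dots> = (\<Sum>Z\<in>X. Suc k)" using that by (intro sum.cong) (auto simp: tf_configs_def)
    finally show ?thesis by simp
  qed
  have notin: "p \<notin> Z" if "(Z, p) \<in> L (tf_configs s k)" for Z p
    using that by (force simp: L_def tf_extend_def)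
  have inj: "inj_on F (L (tf_configs s k))"
    by (rule inj_onI) (auto simp: F_def insert_ident dest!: notin)
  have into: "F (Z, p) \<in> R (tf_configs s (Suc k))" if "(Z, p) \<in> L (tf_configs s k)" for Z p
  proof -
    have "finite Z" using that by (auto simp: L_def intro: tf_configs_finite_elem)
    thus ?thesis using that notin[OF that]
      by (cases p) (auto simp: F_def R_def L_def tf_configs_def tf_extend_def tie_free_insert grid_def)
  qed
  have finR: "finite (R X)" if "X \<subseteq> tf_configs s (Suc k)" for X
    unfolding R_def using finite_subset[OF that finite_tf_configs] tf_configs_finite_elem that
    by (intro finite_SigmaI) blast+
  have "card (L (tf_configs s k \<inter> E)) \<le> card (R (tf_configs s (Suc k) \<inter> E))"
  proof (rule card_inj_on_le[where f = F])
    show "inj_on F (L (tf_configs s k \<inter> E))" using inj by (rule inj_on_subset) (auto simp: L_def)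
    show "F ` L (tf_configs s k \<inter> E) \<subseteq> R (tf_configs s (Suc k) \<inter> E)"
    proof
      fix y assume "y \<in> F ` L (tf_configs s k \<inter> E)"
      then obtain Z p where Zp: "y = F (Z, p)" "(Z, p) \<in> L (tf_configs s k)" "Z \<in> E"
        by (auto simp: L_def)
      have yR: "y \<in> R (tf_configs s (Suc k))" using into Zp by simp
      hence "fst y \<subseteq> grid s" by (auto simp: R_def tf_configs_def)
      moreover have "Z \<subseteq> fst y" using Zp by (auto simp: F_def)
      ultimately have "fst y \<in> E" using E Zp(3) by blast
      thus "y \<in> R (tf_configs s (Suc k) \<inter> E)" using yR by (auto simp: R_def)
    qed
  qed (auto intro: finR)
  thus "card (tf_configs s k \<inter> E) * ((s - k) * (s - k)) \<le> card (tf_configs s (Suc k) \<inter> E) * Suc k"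
    by (simp add: cL cR)
  have "bij_betw F (L (tf_configs s k)) (R (tf_configs s (Suc k)))"
  proof (rule bij_betw_imageI[OF inj])
    show "F ` L (tf_configs s k) = R (tf_configs s (Suc k))"
    proof (intro equalityI subsetI)
      fix y assume "y \<in> R (tf_configs s (Suc k))"
      then obtain Z i j where y: "y = (Z, (i, j))" "Z \<in> tf_configs s (Suc k)" "(i, j) \<in> Z"
        by (auto simp: R_def)
      define D where "D = Z - {(i, j)}"
      have Z: "Z = insert (i, j) D" "(i, j) \<notin> D" using y by (auto simp: D_def)
      have "finite D" using tf_configs_finite_elem[OF y(2)] by (simp add: D_def)
      hence "(D, (i, j)) \<in> L (tf_configs s k)"
        using y(2) Z by (auto simp: L_def tf_configs_def tf_extend_def tie_free_insert grid_def)
      moreover have "F (D, (i, j)) = y" using y Z by (simp add: F_def)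
      ultimately show "y \<in> F ` L (tf_configs s k)" by force
    qed (use into in auto)
  qed
  hence "card (L (tf_configs s k)) = card (R (tf_configs s (Suc k)))" by (rule bij_betw_same_card)
  thus "card (tf_configs s k) * ((s - k) * (s - k)) = card (tf_configs s (Suc k)) * Suc k"
    by (simp add: cL cR)
qed

definition tf_frac :: "nat \<Rightarrow> (nat \<times> nat) set set \<Rightarrow> nat \<Rightarrow> real" where
  "tf_frac s E k = card (tf_configs s k \<inter> E) / card (tf_configs s k)"

lemma tf_frac_nonneg: "0 \<le> tf_frac s E k"
  unfolding tf_frac_def by simp

lemma card_tf_configs_pos: "k \<le> s \<Longrightarrow> card (tf_configs s k) > 0"
proof -
  assume "k \<le> s"
  hence "(\<lambda>i. (i, i)) ` {..<k} \<in> tf_configs s k"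
    by (auto simp: tf_configs_def grid_def tie_free_def inj_on_def card_image)
  thus ?thesis using finite_tf_configs[of s k] by (auto simp: card_gt_0_iff)
qed

text \<open>A uniform configuration of size \<open>l\<close> plus a uniform admissible point is
  uniform of size \<open>Suc l\<close>, and \<open>E\<close> survives the addition. In terms of
  counts, the inequality of \<open>tf_configs_double_count\<close> is divided by its
  equation.\<close>

lemma tf_frac_mono:
  assumes E: "\<And>Z Z'. Z \<subseteq> Z' \<Longrightarrow> Z' \<subseteq> grid s \<Longrightarrow> Z \<in> E \<Longrightarrow> Z' \<in> E"
    and "k \<le> l" "l \<le> s"
  shows "tf_frac s E k \<le> tf_frac s E l"
  using assms(2,3)
proof (induction l rule: dec_induct)
  case (step l)
  define d where "d = (s - l) * (s - l)"
  have d: "d > 0" using step by (simp add: d_def)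
  have pos: "card (tf_configs s l) > 0" "card (tf_configs s (Suc l)) > 0"
    using step by (auto intro: card_tf_configs_pos)
  have 1: "real (card (tf_configs s l \<inter> E)) * d \<le> real (card (tf_configs s (Suc l) \<inter> E)) * Suc l"
    using tf_configs_double_count(1)[of s E l] E unfolding d_def by (metis of_nat_le_iff of_nat_mult)
  have 2: "real (card (tf_configs s l)) * d = real (card (tf_configs s (Suc l))) * Suc l"
    using tf_configs_double_count(2)[of s E l] E unfolding d_def by (metis of_nat_mult)
  have "tf_frac s E l = (real (card (tf_configs s l \<inter> E)) * d) / (real (card (tf_configs s l)) * d)"
    using d by (simp add: tf_frac_def)
  also have "\<dots> \<le> (real (card (tf_configs s (Suc l) \<inter> E)) * Suc l) / (real (card (tf_configs s l)) * d)"
    using 1 by (intro divide_right_mono) auto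
  also have "\<dots> = tf_frac s E (Suc l)" unfolding 2 tf_frac_def by simp
  finally show ?case using step by simp
qed simp

text \<open>
  The conditional probability of \<open>E\<close> given \<open>k\<close> points is \<open>tf_frac s E k\<close>, for every weight that
  depends only on the number of points.
\<close>
lemma tf_weight_class:
  fixes f :: "(nat \<times> nat) set \<Rightarrow> real"
  assumes f: "\<And>Z Z'. Z \<in> tf_configs s k \<Longrightarrow> Z' \<in> tf_configs s k \<Longrightarrow> f Z = f Z'"
  shows "(\<Sum>Z\<in>tf_configs s k \<inter> E. f Z) = tf_frac s E k * (\<Sum>Z\<in>tf_configs s k. f Z)"
proof (cases "tf_configs s k = {}")
  case False
  then obtain Z0 where Z0: "Z0 \<in> tf_configs s k" by blast
  have "(\<Sum>Z\<in>tf_configs s k \<inter> E. f Z) = (\<Sum>Z\<in>tf_configs s k \<inter> E. f Z0)"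
    by (intro sum.cong refl f) (use Z0 in auto)
  moreover have "(\<Sum>Z\<in>tf_configs s k. f Z) = (\<Sum>Z\<in>tf_configs s k. f Z0)"
    by (intro sum.cong refl f) (use Z0 in auto)
  ultimately show ?thesis using False finite_tf_configs[of s k] by (simp add: tf_frac_def)
qed simp

definition tf_all :: "nat \<Rightarrow> (nat \<times> nat) set set" where
  "tf_all s = {Z. Z \<subseteq> grid s \<and> tie_free Z}"

lemma sum_tf_all: "(\<Sum>Z\<in>{Z \<in> tf_all s. P (card Z)} \<inter> E. f Z) =
    (\<Sum>k\<in>{k. k \<le> s \<and> P k}. \<Sum>Z\<in>tf_configs s k \<inter> E. f Z)"
proof -
  have "{Z \<in> tf_all s. P (card Z)} \<inter> E = (\<Union>k\<in>{k. k \<le> s \<and> P k}. tf_configs s k \<inter> E)"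
    using tie_free_card_le by (auto simp: tf_all_def tf_configs_def)
  thus ?thesis
    by (simp only:) (rule sum.UNION_disjoint, auto simp: finite_tf_configs, auto simp: tf_configs_def)
qed

text \<open>The two laws to be compared, Bernoulli field and box, are both mixtures of uniform laws
  over the sizes. Sizes up to \<open>k0\<close> give at most \<open>tf_frac s E k0\<close>, sizes
  from \<open>k0\<close> on give at least that much; so \<open>tf_frac\<close> at \<open>k0\<close>
  is where the two meet.\<close>

lemma tf_weight_compare:
  fixes f :: "(nat \<times> nat) set \<Rightarrow> real"
  assumes f: "\<And>Z Z'. Z \<in> tf_all s \<Longrightarrow> Z' \<in> tf_all s \<Longrightarrow> card Z = card Z' \<Longrightarrow> f Z = f Z'"
    and nonneg: "\<And>Z. f Z \<ge> 0"
    and E: "\<And>Z Z'. Z \<subseteq> Z' \<Longrightarrow> Z' \<subseteq> grid s \<Longrightarrow> Z \<in> E \<Longrightarrow> Z' \<in> E"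
    and k0: "k0 \<le> s"
  shows "(\<Sum>Z\<in>{Z \<in> tf_all s. card Z \<le> k0} \<inter> E. f Z) \<le> tf_frac s E k0 * (\<Sum>Z\<in>{Z \<in> tf_all s. card Z \<le> k0}. f Z)"
    and "tf_frac s E k0 * (\<Sum>Z\<in>{Z \<in> tf_all s. k0 \<le> card Z}. f Z) \<le> (\<Sum>Z\<in>{Z \<in> tf_all s. k0 \<le> card Z} \<inter> E. f Z)"
proof -
  have cls: "(\<Sum>Z\<in>tf_configs s k \<inter> E. f Z) = tf_frac s E k * (\<Sum>Z\<in>tf_configs s k. f Z)" for k
    using f by (intro tf_weight_class) (auto simp: tf_configs_def tf_all_def)
  have all: "(\<Sum>Z\<in>{Z \<in> tf_all s. P (card Z)}. f Z) = (\<Sum>k\<in>{k. k \<le> s \<and> P k}. \<Sum>Z\<in>tf_configs s k. f Z)" for P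
    using sum_tf_all[where f = f and P = P and s = s and E = UNIV] by simp
  show "(\<Sum>Z\<in>{Z \<in> tf_all s. card Z \<le> k0} \<inter> E. f Z) \<le> tf_frac s E k0 * (\<Sum>Z\<in>{Z \<in> tf_all s. card Z \<le> k0}. f Z)"
    unfolding sum_tf_all[where f = f and P = "\<lambda>k. k \<le> k0"] all[of "\<lambda>k. k \<le> k0"] sum_distrib_left cls using E k0
    by (intro sum_mono mult_right_mono tf_frac_mono sum_nonneg nonneg) auto
  show "tf_frac s E k0 * (\<Sum>Z\<in>{Z \<in> tf_all s. k0 \<le> card Z}. f Z) \<le> (\<Sum>Z\<in>{Z \<in> tf_all s. k0 \<le> card Z} \<inter> E. f Z)"
    unfolding sum_tf_all[where f = f and P = "\<lambda>k. k0 \<le> k"] all[of "\<lambda>k. k0 \<le> k"] sum_distrib_left cls using E k0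
    by (intro sum_mono mult_right_mono tf_frac_mono sum_nonneg nonneg) auto
qed

section \<open>From the Bernoulli field to uniform tie-free configurations\<close>

lemma bernoulli_field_lengths:
  assumes "yss \<in> set_pmf (bernoulli_field s \<theta>)"
  shows "length yss = s" "\<And>j. j < s \<Longrightarrow> length (yss ! j) = s"
  using assms by (auto simp: set_replicate_pmf in_lists_conv_set)

text \<open>The point is that the probability depends on \<open>Z\<close> only through its size, as
  \<open>tf_weight_compare\<close> requires.\<close>

lemma pmf_field_set:
  assumes Z: "Z \<subseteq> grid s" and \<theta>: "\<theta> \<in> {0..1}"
  shows "pmf (map_pmf (field_set s) (bernoulli_field s \<theta>)) Z = \<theta> ^ card Z * (1 - \<theta>) ^ (s * s - card Z)"
proof -
  define M where "M = bernoulli_field s \<theta>"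
  define row where "row j = map (\<lambda>i. (i, j) \<in> Z) [0..<s]" for j
  define yss0 where "yss0 = map row [0..<s]"
  have iff: "field_set s yss = Z \<longleftrightarrow> yss = yss0" if "yss \<in> set_pmf M" for yss
  proof
    note len = bernoulli_field_lengths[OF that[unfolded M_def]]
    assume *: "field_set s yss = Z"
    show "yss = yss0"
    proof (rule nth_equalityI)
      show "length yss = length yss0" using len by (simp add: yss0_def)
      fix j assume j: "j < length yss"
      show "yss ! j = yss0 ! j"
        using len j by (intro nth_equalityI) (auto simp: yss0_def row_def *[symmetric] field_set_def)
    qed
  next
    assume "yss = yss0"
    thus "field_set s yss = Z" using Z by (auto simp: field_set_def yss0_def row_def grid_def)
  qed
  have "pmf (map_pmf (field_set s) M) Z = measure_pmf.prob M (field_set s -` {Z})" by (rule pmf_map)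
  also have "\<dots> = measure_pmf.prob M {yss0}"
    using iff by (intro measure_pmf.finite_measure_eq_AE) (auto simp: AE_measure_pmf_iff)
  also have "\<dots> = pmf M yss0" by (simp add: measure_pmf_single)
  also have "\<dots> = prod_list (map (pmf (replicate_pmf s (bernoulli_pmf \<theta>))) yss0)"
    unfolding M_def by (rule pmf_replicate_pmf) (simp add: yss0_def)
  also have "\<dots> = (\<Prod>j\<in>{..<s}. pmf (replicate_pmf s (bernoulli_pmf \<theta>)) (row j))"
    unfolding yss0_def map_map by (subst prod.distinct_set_conv_list [symmetric]) (auto simp: lessThan_atLeast0)
  also have "\<dots> = (\<Prod>j\<in>{..<s}. \<Prod>i\<in>{..<s}. if (i, j) \<in> Z then \<theta> else 1 - \<theta>)"
  proof (intro prod.cong refl)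
    fix j
    have "pmf (replicate_pmf s (bernoulli_pmf \<theta>)) (row j) = prod_list (map (pmf (bernoulli_pmf \<theta>)) (row j))"
      by (rule pmf_replicate_pmf) (simp add: row_def)
    also have "\<dots> = (\<Prod>i\<in>{..<s}. pmf (bernoulli_pmf \<theta>) ((i, j) \<in> Z))"
      unfolding row_def map_map by (subst prod.distinct_set_conv_list [symmetric]) (auto simp: lessThan_atLeast0)
    also have "\<dots> = (\<Prod>i\<in>{..<s}. if (i, j) \<in> Z then \<theta> else 1 - \<theta>)"
      using \<theta> by (intro prod.cong) auto
    finally show "pmf (replicate_pmf s (bernoulli_pmf \<theta>)) (row j) = (\<Prod>i\<in>{..<s}. if (i, j) \<in> Z then \<theta> else 1 - \<theta>)" .
  qed
  also have "\<dots> = (\<Prod>i\<in>{..<s}. \<Prod>j\<in>{..<s}. if (i, j) \<in> Z then \<theta> else 1 - \<theta>)" by (rule prod.swap)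
  also have "\<dots> = (\<Prod>p\<in>grid s. if p \<in> Z then \<theta> else 1 - \<theta>)"
    unfolding grid_def by (simp add: prod.cartesian_product case_prod_unfold)
  also have "\<dots> = (\<Prod>p\<in>Z. \<theta>) * (\<Prod>p\<in>grid s - Z. 1 - \<theta>)"
    using Z by (subst prod.If_cases) (auto simp: Int_absorb1 Diff_eq)
  also have "\<dots> = \<theta> ^ card Z * (1 - \<theta>) ^ (s * s - card Z)"
    using Z by (simp add: card_Diff_subset finite_subset[OF Z] grid_def card_cartesian_product)
  finally show ?thesis by (simp add: M_def)
qed

text \<open>Fields with a tie or with more than \<open>k0\<close> points are given up; the others
  form a mixture over sizes up to \<open>k0\<close>.\<close>

lemma prob_field_le_tf_frac:
  assumes E: "\<And>Z Z'. Z \<subseteq> Z' \<Longrightarrow> Z' \<subseteq> grid s \<Longrightarrow> Z \<in> E \<Longrightarrow> Z' \<in> E"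
    and \<theta>: "\<theta> \<in> {0..1}" and k0: "k0 \<le> s"
  shows "measure_pmf.prob (bernoulli_field s \<theta>) {yss. field_set s yss \<in> E} \<le> tf_frac s E k0
    + measure_pmf.prob (bernoulli_field s \<theta>) {yss. k0 < card (field_set s yss)}
    + measure_pmf.prob (bernoulli_field s \<theta>) {yss. \<not> tie_free (field_set s yss)}"
proof -
  define M where "M = bernoulli_field s \<theta>"
  define \<nu> where "\<nu> = map_pmf (field_set s) M"
  define X where "X = {Z \<in> tf_all s. card Z \<le> k0}"
  have fin: "finite X" unfolding X_def
    by (rule finite_subset[of _ "Pow (grid s)"]) (auto simp: tf_all_def)
  have fgrid: "field_set s yss \<subseteq> grid s" for yss by (auto simp: field_set_def grid_def)
  have "{yss. field_set s yss \<in> E} \<subseteq> {yss. field_set s yss \<in> X \<inter> E} \<union>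
      {yss. k0 < card (field_set s yss)} \<union> {yss. \<not> tie_free (field_set s yss)}"
    using fgrid by (auto simp: X_def tf_all_def)
  hence "measure_pmf.prob M {yss. field_set s yss \<in> E} \<le> measure_pmf.prob M ({yss. field_set s yss \<in> X \<inter> E} \<union>
      {yss. k0 < card (field_set s yss)} \<union> {yss. \<not> tie_free (field_set s yss)})"
    by (intro measure_pmf.finite_measure_mono) auto
  also have "\<dots> \<le> measure_pmf.prob M {yss. field_set s yss \<in> X \<inter> E}
      + measure_pmf.prob M {yss. k0 < card (field_set s yss)} + measure_pmf.prob M {yss. \<not> tie_free (field_set s yss)}"
    by (intro order_trans[OF measure_Un_le] add_mono measure_Un_le order_refl) auto
  also have "measure_pmf.prob M {yss. field_set s yss \<in> X \<inter> E} = measure_pmf.prob \<nu> (X \<inter> E)"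
    by (simp add: \<nu>_def vimage_def)
  also have "\<dots> = (\<Sum>Z\<in>X \<inter> E. pmf \<nu> Z)" using fin by (intro measure_measure_pmf_finite) auto
  also have "\<dots> \<le> tf_frac s E k0 * (\<Sum>Z\<in>X. pmf \<nu> Z)"
    unfolding X_def
  proof (rule tf_weight_compare(1)[OF _ _ E k0])
    show "pmf \<nu> Z = pmf \<nu> Z'" if "Z \<in> tf_all s" "Z' \<in> tf_all s" "card Z = card Z'" for Z Z'
      using that pmf_field_set[OF _ \<theta>, of Z s] pmf_field_set[OF _ \<theta>, of Z' s]
      by (simp add: tf_all_def \<nu>_def M_def)
  qed auto
  also have "(\<Sum>Z\<in>X. pmf \<nu> Z) = measure_pmf.prob \<nu> X" using fin by (intro measure_measure_pmf_finite[symmetric]) auto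
  also have "tf_frac s E k0 * measure_pmf.prob \<nu> X \<le> tf_frac s E k0"
    by (intro mult_left_le measure_pmf.prob_le_1 tf_frac_nonneg)
  finally show ?thesis by (simp add: M_def)
qed

lemma card_field_set:
  assumes "yss \<in> set_pmf (bernoulli_field s \<theta>)"
  shows "card (field_set s yss) = count_true (concat yss)"
proof -
  note len = bernoulli_field_lengths[OF assms]
  have "field_set s yss = prod.swap ` (SIGMA j:{..<s}. {i. i < s \<and> yss ! j ! i})"
    by (auto simp: field_set_def image_iff)
  hence "card (field_set s yss) = card (SIGMA j:{..<s}. {i. i < s \<and> yss ! j ! i})"
    by (simp add: card_image)
  also have "\<dots> = (\<Sum>j<s. card {i. i < s \<and> yss ! j ! i})" by (subst card_SigmaI) auto
  also have "\<dots> = (\<Sum>j<s. count_true (yss ! j))"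
    using len by (intro sum.cong) (auto simp: length_filter_conv_card)
  also have "\<dots> = sum_list (map count_true yss)"
    using len(1) by (simp add: sum_list_sum_nth lessThan_atLeast0)
  also have "\<dots> = count_true (concat yss)"
    by (simp add: filter_concat length_concat o_def)
  finally show ?thesis .
qed

lemma prob_card_field_gt:
  fixes s k :: nat
  assumes \<theta>: "\<theta> \<in> {0..1}" and t: "t > 0" and k: "real s * real s * \<theta> + t \<le> k"
  shows "measure_pmf.prob (bernoulli_field s \<theta>) {yss. k < card (field_set s yss)} \<le> real s * real s * \<theta> / t\<^sup>2"
proof -
  define M where "M = bernoulli_field s \<theta>"
  have "measure_pmf.prob M {yss. k < card (field_set s yss)} \<le> measure_pmf.prob M {yss. k < count_true (concat yss)}"
    using card_field_set[of _ s \<theta>] by (intro measure_pmf.finite_measure_mono_AE) (auto simp: AE_measure_pmf_iff M_def)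
  also have "\<dots> \<le> real (s * s) * \<theta> / t\<^sup>2"
    unfolding M_def
  proof (rule prob_count_true_deviation[OF concat_replicate_pmf \<theta> t])
    fix yss assume "yss \<in> {yss. k < count_true (concat yss)}"
    hence "real k < real (count_true (concat yss))" by simp
    thus "t \<le> \<bar>real (count_true (concat yss)) - real (s * s) * \<theta>\<bar>" using k by simp
  qed
  finally show ?thesis by (simp add: M_def)
qed

lemma two_le_count_true:
  assumes "i < length xs" "i' < length xs" "i \<noteq> i'" "xs ! i" "xs ! i'"
  shows "2 \<le> count_true xs"
proof -
  have "card {i, i'} \<le> card {i. i < length xs \<and> id (xs ! i)}"
    using assms by (intro card_mono) auto
  thus ?thesis using assms(3) by (simp add: length_filter_conv_card)
qed

text \<open>A tie puts two points into one of the \<open>s\<close> rows or \<open>s\<close> columns.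
  For \<open>\<theta> = (A / s) ^ 2\<close> the bound is \<open>A ^ 4 / s\<close>, so ties disappear
  as \<open>s\<close> grows with \<open>A\<close> fixed.\<close>

lemma prob_field_not_tie_free:
  assumes \<theta>: "\<theta> \<in> {0..1}"
  shows "measure_pmf.prob (bernoulli_field s \<theta>) {yss. \<not> tie_free (field_set s yss)} \<le> s * (s * \<theta>)\<^sup>2"
proof -
  define M where "M = bernoulli_field s \<theta>"
  define R where "R j = {yss. 2 \<le> count_true (yss ! j)}" for j
  define C where "C i = {yss. 2 \<le> count_true (map (\<lambda>ys. ys ! i) yss)}" for i
  have R: "measure_pmf.prob M (R j) \<le> (s * \<theta>)\<^sup>2 / 2" if "j < s" for j
    unfolding M_def using nth_replicate_pmf[OF that] \<theta> by (rule prob_two_successes_le) (simp add: R_def)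
  have C: "measure_pmf.prob M (C i) \<le> (s * \<theta>)\<^sup>2 / 2" if "i < s" for i
  proof (rule prob_two_successes_le[OF _ \<theta>])
    show "map_pmf (map (\<lambda>ys. ys ! i)) M = replicate_pmf s (bernoulli_pmf \<theta>)"
      unfolding M_def map_replicate_pmf nth_replicate_pmf[OF that] ..
  qed (simp add: C_def)
  have "yss \<in> (\<Union>j<s. R j) \<union> (\<Union>i<s. C i)" if yss: "yss \<in> set_pmf M" "\<not> tie_free (field_set s yss)" for yss
  proof -
    note len = bernoulli_field_lengths[OF yss(1)[unfolded M_def]]
    from yss(2) consider i j j' where "(i, j) \<in> field_set s yss" "(i, j') \<in> field_set s yss" "j \<noteq> j'"
      | i i' j where "(i, j) \<in> field_set s yss" "(i', j) \<in> field_set s yss" "i \<noteq> i'"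
      unfolding tie_free_def inj_on_def by fastforce
    thus ?thesis
    proof cases
      case 1
      hence "2 \<le> count_true (map (\<lambda>ys. ys ! i) yss)" using len
        by (intro two_le_count_true[of j _ j']) (auto simp: field_set_def)
      thus ?thesis using 1 by (auto simp: C_def field_set_def)
    next
      case 2
      hence "2 \<le> count_true (yss ! j)" using len
        by (intro two_le_count_true[of i _ i']) (auto simp: field_set_def)
      thus ?thesis using 2 by (auto simp: R_def field_set_def)
    qed
  qed
  hence "measure_pmf.prob M {yss. \<not> tie_free (field_set s yss)} \<le> measure_pmf.prob M ((\<Union>j<s. R j) \<union> (\<Union>i<s. C i))"
    by (intro measure_pmf.finite_measure_mono_AE) (auto simp: AE_measure_pmf_iff)
  also have "\<dots> \<le> measure_pmf.prob M (\<Union>j<s. R j) + measure_pmf.prob M (\<Union>i<s. C i)"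
    by (intro measure_Un_le) auto
  also have "\<dots> \<le> (\<Sum>j<s. measure_pmf.prob M (R j)) + (\<Sum>i<s. measure_pmf.prob M (C i))"
    by (intro add_mono measure_pmf.finite_measure_subadditive_finite) auto
  also have "\<dots> \<le> (\<Sum>j<s. (s * \<theta>)\<^sup>2 / 2) + (\<Sum>i<s. (s * \<theta>)\<^sup>2 / 2)"
    by (intro add_mono sum_mono R C) auto
  also have "\<dots> = s * (s * \<theta>)\<^sup>2" by simp
  finally show ?thesis by (simp add: M_def)
qed

text \<open>The field of density \<open>(A / s) ^ 2\<close> has \<open>A ^ 2\<close> points on
  average. The three losses of \<open>\<epsilon>\<close> are a chain that is too short, more than
  \<open>k0\<close> points (Chebyshev), and a tie.\<close>

lemma tf_frac_lis_ge:
  fixes \<epsilon> A :: real and s k0 :: nat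
  assumes e: "0 < \<epsilon>" "\<epsilon> \<le> 1" and A: "46080 / \<epsilon> ^ 5 \<le> A" and s: "100 * A / \<epsilon>\<^sup>2 \<le> s" "A ^ 4 / \<epsilon> \<le> s"
    and k0: "(1 + \<epsilon>) * A\<^sup>2 \<le> k0" "k0 \<le> s"
  shows "1 - 3 * \<epsilon> \<le> tf_frac s {Z. (2 - 5 * \<epsilon>) * A \<le> real (lis Z)} k0"
    (is "_ \<le> tf_frac s {Z. ?l \<le> _} k0")
proof -
  have e5: "\<epsilon> ^ 5 > 0" using e by simp
  have A1: "46080 \<le> A * \<epsilon> ^ 5" using A e5 by (simp add: field_simps)
  have A0: "A > 0"
  proof -
    have "0 < A * \<epsilon> ^ 5" using A1 by linarith
    thus ?thesis using e5 by (simp add: zero_less_mult_iff)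
  qed
  have s0: "real s > 0"
  proof -
    have "100 * A / \<epsilon>\<^sup>2 > 0" using A0 e by simp
    thus ?thesis using s by linarith
  qed
  define x where "x = A / s"
  have x: "0 < x" "x \<le> \<epsilon>\<^sup>2 / 100" "s * x = A"
    using A0 s0 s e by (auto simp: x_def field_simps)
  have th: "x\<^sup>2 \<in> {0..1}"
  proof -
    have "\<epsilon>\<^sup>2 \<le> 1" using e by (simp add: power_le_one)
    hence "x \<le> 1" using x by linarith
    thus ?thesis using x by (simp add: power_le_one)
  qed
  let ?P = "measure_pmf.prob (bernoulli_field s (x\<^sup>2))"
  have 1: "1 - \<epsilon> \<le> ?P {yss. ?l \<le> real (lis (field_set s yss))}"
    using prob_lis_field_near_optimal[OF e x(1,2), of s] A unfolding x(3) by simp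
  have "?P {yss. field_set s yss \<in> {Z. ?l \<le> real (lis Z)}}
      \<le> tf_frac s {Z. ?l \<le> real (lis Z)} k0
    + ?P {yss. k0 < card (field_set s yss)}
    + ?P {yss. \<not> tie_free (field_set s yss)}"
  proof (rule prob_field_le_tf_frac[OF _ th k0(2)])
    fix Z Z' assume "Z \<subseteq> Z'" "Z' \<subseteq> grid s" "Z \<in> {Z. ?l \<le> real (lis Z)}"
    thus "Z' \<in> {Z. ?l \<le> real (lis Z)}"
      using lis_mono[of Z' Z] finite_subset[OF _ finite_grid, of Z' s] by simp
  qed
  moreover have "?P {yss. k0 < card (field_set s yss)} \<le> \<epsilon>"
  proof -
    have sx: "real s * real s * x\<^sup>2 = A\<^sup>2" unfolding x(3)[symmetric] by (simp add: power2_eq_square)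
    have "?P {yss. k0 < card (field_set s yss)} \<le> real s * real s * x\<^sup>2 / (\<epsilon> * A\<^sup>2)\<^sup>2"
      using th e A0 k0 sx by (intro prob_card_field_gt) (auto simp: algebra_simps)
    also have "\<dots> = 1 / (\<epsilon> * A)\<^sup>2" unfolding sx using A0 e by (simp add: power2_eq_square field_simps)
    also have "\<dots> \<le> \<epsilon>"
    proof -
      have "1 \<le> A"
      proof -
        have "A * \<epsilon> ^ 5 \<le> A" using A0 e by (intro mult_left_le power_le_one) auto
        thus ?thesis using A1 by linarith
      qed
      hence "A \<le> A * A" by simp
      have "1 \<le> A * \<epsilon> ^ 5" using A1 by linarith
      also have "\<dots> \<le> A * \<epsilon> ^ 3" using A0 e by (intro mult_left_mono power_decreasing) auto
      also have "\<dots> \<le> (A * A) * \<epsilon> ^ 3" using \<open>A \<le> A * A\<close> e by (intro mult_right_mono) auto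
      finally have "1 \<le> \<epsilon> * (\<epsilon> * A)\<^sup>2" by (simp add: power2_eq_square power3_eq_cube mult_ac)
      thus ?thesis using e A0 by (simp add: divide_le_eq)
    qed
    finally show ?thesis .
  qed
  moreover have "?P {yss. \<not> tie_free (field_set s yss)} \<le> \<epsilon>"
  proof -
    have "?P {yss. \<not> tie_free (field_set s yss)} \<le> s * (s * x\<^sup>2)\<^sup>2"
      by (rule prob_field_not_tie_free[OF th])
    also have "\<dots> = A ^ 4 / s"
      unfolding x_def using s0 by (simp add: power2_eq_square power4_eq_xxxx field_simps)
    also have "\<dots> \<le> \<epsilon>" using s(2) s0 e by (simp add: field_simps)
    finally show ?thesis .
  qed
  ultimately show ?thesis using 1 by simp
qed

subsection \<open>Boxes of a conjugated permutation\<close>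

text \<open>Coordinates are relative to the corner \<open>(\<alpha>, \<beta>)\<close>, so that boxes
  at different places are subsets of the same grid.\<close>

definition zbox :: "(nat \<Rightarrow> nat) \<Rightarrow> nat \<Rightarrow> nat \<Rightarrow> nat \<Rightarrow> (nat \<times> nat) set" where
  "zbox \<tau> \<alpha> \<beta> s = {(x, y). x < s \<and> y < s \<and> \<tau> (\<alpha> + x) = \<beta> + y}"

lemma zbox_subset_grid: "zbox \<tau> \<alpha> \<beta> s \<subseteq> grid s"
  by (auto simp: zbox_def grid_def)

lemma finite_zbox [simp]: "finite (zbox \<tau> \<alpha> \<beta> s)"
  using finite_subset[OF zbox_subset_grid finite_grid] .

lemma zbox_tie_free: "inj \<tau> \<Longrightarrow> zbox \<tau> \<alpha> \<beta> s \<in> tf_all s"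
proof -
  assume inj: "inj \<tau>"
  have "inj_on fst (zbox \<tau> \<alpha> \<beta> s)" by (rule inj_onI) (auto simp: zbox_def)
  moreover have "inj_on snd (zbox \<tau> \<alpha> \<beta> s)"
  proof (rule inj_onI)
    fix p q assume pq: "p \<in> zbox \<tau> \<alpha> \<beta> s" "q \<in> zbox \<tau> \<alpha> \<beta> s" "snd p = snd q"
    hence "\<tau> (\<alpha> + fst p) = \<tau> (\<alpha> + fst q)" by (auto simp: zbox_def)
    hence "fst p = fst q" using inj by (simp add: inj_eq)
    thus "p = q" using pq(3) by (simp add: prod_eq_iff)
  qed
  ultimately show ?thesis using zbox_subset_grid by (auto simp: tf_all_def tie_free_def)
qed

text \<open>Conjugation by \<open>h\<close> moves the graph point \<open>(z, \<tau> z)\<close> to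
  \<open>(h z, h (\<tau> z))\<close>.\<close>

lemma zbox_conj_by:
  assumes h: "h permutes S" and \<pi>: "\<pi> permutes {..<s}" and \<rho>: "\<rho> permutes {..<s}"
    and h1: "\<And>x. x < s \<Longrightarrow> h (\<alpha> + x) = \<alpha> + \<pi> x" and h2: "\<And>y. y < s \<Longrightarrow> h (\<beta> + y) = \<beta> + \<rho> y"
  shows "zbox (conj_by h \<tau>) \<alpha> \<beta> s = map_prod \<pi> \<rho> ` zbox \<tau> \<alpha> \<beta> s"
proof (intro equalityI subsetI)
  note inv = permutes_inverses[OF h]
  have lt: "\<pi> x < s" "\<rho> x < s" if "x < s" for x
    using permutes_in_image[OF \<pi>, of x] permutes_in_image[OF \<rho>, of x] that by auto
  have eq: "conj_by h \<tau> (\<alpha> + \<pi> x) = h (\<tau> (\<alpha> + x))" if "x < s" for x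
    using h1[OF that, symmetric] inv by (simp add: conj_by_def)
  {
    fix p assume "p \<in> map_prod \<pi> \<rho> ` zbox \<tau> \<alpha> \<beta> s"
    then obtain x y where p: "p = (\<pi> x, \<rho> y)" "x < s" "y < s" "\<tau> (\<alpha> + x) = \<beta> + y"
      by (auto simp: zbox_def)
    thus "p \<in> zbox (conj_by h \<tau>) \<alpha> \<beta> s" using lt eq h2 by (auto simp: zbox_def)
  next
    fix p assume "p \<in> zbox (conj_by h \<tau>) \<alpha> \<beta> s"
    then obtain x' y' where p: "p = (x', y')" "x' < s" "y' < s" "conj_by h \<tau> (\<alpha> + x') = \<beta> + y'"
      by (auto simp: zbox_def)
    obtain x y where xy: "x' = \<pi> x" "x < s" "y' = \<rho> y" "y < s"
      using p permutes_image[OF \<pi>] permutes_image[OF \<rho>] by (metis imageE lessThan_iff)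
    have "h (\<tau> (\<alpha> + x)) = h (\<beta> + y)" using p(4) eq xy h2 by simp
    hence "\<tau> (\<alpha> + x) = \<beta> + y" using permutes_inj[OF h] by (simp add: inj_eq)
    thus "p \<in> map_prod \<pi> \<rho> ` zbox \<tau> \<alpha> \<beta> s" using p xy by (force simp: zbox_def)
  }
qed

lemma block_permutes:
  fixes \<alpha> s :: nat
  assumes "\<pi> permutes {..<s}"
  obtains h where "h permutes {\<alpha>..<\<alpha> + s}" "\<And>x. x < s \<Longrightarrow> h (\<alpha> + x) = \<alpha> + \<pi> x"
proof
  have inj: "inj_on ((+) \<alpha>) {..<s}" by simp
  have im: "(+) \<alpha> ` {..<s} = {\<alpha>..<\<alpha> + s}"
    by (simp add: lessThan_atLeast0 add.commute)
  show "map_permutation {..<s} ((+) \<alpha>) \<pi> permutes {\<alpha>..<\<alpha> + s}"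
    using inj im by (intro map_permutation_permutes[OF _ assms]) (simp add: bij_betw_def)
  show "map_permutation {..<s} ((+) \<alpha>) \<pi> (\<alpha> + x) = \<alpha> + \<pi> x" if "x < s" for x
    using map_permutation_apply[OF inj, of x \<pi>] that by simp
qed

text \<open>Left translation by \<open>h\<close> is injective on the relabellings and turns the
  conjugate by \<open>g\<close> into its own conjugate by \<open>h\<close>.\<close>

lemma card_conj_transport:
  fixes n :: nat
  assumes h: "h permutes {1..n}" and Q: "\<And>\<sigma>. \<sigma> permutes {1..n} \<Longrightarrow> Q \<sigma> \<Longrightarrow> Q' (conj_by h \<sigma>)"
    and \<tau>: "\<tau> permutes {1..n}"
  shows "card {g. g permutes {1..n} \<and> Q (conj_by g \<tau>)} \<le> card {g. g permutes {1..n} \<and> Q' (conj_by g \<tau>)}"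
proof (rule card_inj_on_le[where f = "(\<circ>) h"])
  show "inj_on ((\<circ>) h) {g. g permutes {1..n} \<and> Q (conj_by g \<tau>)}"
    using permutes_inj[OF h] by (intro inj_onI) (simp add: fun.inj_map_strong fun_eq_iff inj_eq)
  show "(\<circ>) h ` {g. g permutes {1..n} \<and> Q (conj_by g \<tau>)} \<subseteq> {g. g permutes {1..n} \<and> Q' (conj_by g \<tau>)}"
  proof
    fix k assume "k \<in> (\<circ>) h ` {g. g permutes {1..n} \<and> Q (conj_by g \<tau>)}"
    then obtain g where g: "k = h \<circ> g" "g permutes {1..n}" "Q (conj_by g \<tau>)" by blast
    have "Q' (conj_by h (conj_by g \<tau>))" using g by (intro Q conj_by_permutes \<tau>)
    moreover have "k permutes {1..n}" unfolding g(1) using g(2) h by (rule permutes_compose)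
    ultimately show "k \<in> {g. g permutes {1..n} \<and> Q' (conj_by g \<tau>)}"
      by (simp add: g(1) conj_by_comp[OF h g(2)])
  qed
  show "finite {g. g permutes {1..n} \<and> Q' (conj_by g \<tau>)}"
    by (rule finite_subset[OF _ finite_permutations[of "{1..n}"]]) auto
qed

text \<open>Exchangeability inside a box. Tie-free configurations of equal size differ by a
  permutation of the columns and one of the rows. The blocks at \<open>\<alpha>\<close> and
  \<open>\<beta>\<close> are disjoint, so a single relabelling \<open>h\<close> performs both; a box
  on the diagonal would force the two to coincide.\<close>

lemma card_zbox_config_le:
  assumes \<tau>: "\<tau> permutes {1..n}"
    and box: "1 \<le> \<alpha>" "\<alpha> + s \<le> n + 1" "1 \<le> \<beta>" "\<beta> + s \<le> n + 1" "\<alpha> + s \<le> \<beta> \<or> \<beta> + s \<le> \<alpha>"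
    and Z: "Z \<in> tf_all s" "Z' \<in> tf_all s" "card Z = card Z'"
  shows "card {g. g permutes {1..n} \<and> zbox (conj_by g \<tau>) \<alpha> \<beta> s = Z}
    \<le> card {g. g permutes {1..n} \<and> zbox (conj_by g \<tau>) \<alpha> \<beta> s = Z'}"
proof -
  have fin: "finite Z" "finite Z'" and sub: "Z \<subseteq> grid s" "Z' \<subseteq> grid s"
    using Z by (auto simp: tf_all_def intro: finite_subset[OF _ finite_grid])
  have inj: "inj_on fst Z" "inj_on snd Z" "inj_on fst Z'" "inj_on snd Z'"
    using Z by (auto simp: tf_all_def tie_free_def)
  obtain b where b: "bij_betw b Z Z'" using finite_same_card_bij[OF fin Z(3)] by blast
  have bZ: "b p \<in> Z'" if "p \<in> Z" for p using b that by (auto simp: bij_betw_def)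
  \<comment> \<open>For either coordinate \<open>c\<close>, the bijection \<open>b\<close> induces a
    map on coordinates, well defined and injective since neither configuration has ties.\<close>
  have ext: "\<exists>\<pi>. \<pi> permutes {..<s} \<and> (\<forall>p\<in>Z. \<pi> (c p) = c (b p))"
    if c: "inj_on c Z" "inj_on c Z'" "\<And>p. p \<in> grid s \<Longrightarrow> c p < s" for c :: "nat \<times> nat \<Rightarrow> nat"
  proof -
    define f where "f i = c (b (inv_into Z c i))" for i
    have f: "f (c p) = c (b p)" if "p \<in> Z" for p using that c by (simp add: f_def)
    have "inj_on f (c ` Z)"
    proof (rule inj_onI)
      fix i j assume "i \<in> c ` Z" "j \<in> c ` Z" "f i = f j"
      then obtain p q where pq: "i = c p" "j = c q" "p \<in> Z" "q \<in> Z" "c (b p) = c (b q)" using f by auto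
      hence "b p = b q" using c(2) bZ by (auto simp: inj_on_def)
      hence "p = q" using b pq by (auto simp: bij_betw_def inj_on_def)
      thus "i = j" using pq by simp
    qed
    moreover have "c p < s" "f (c p) < s" if "p \<in> Z" for p
      using c(3)[of p] c(3)[of "b p"] sub bZ[OF that] that f[OF that] by auto
    hence "c ` Z \<subseteq> {..<s}" "f ` c ` Z \<subseteq> {..<s}" by auto
    ultimately obtain \<pi> where "\<pi> permutes {..<s}" "\<forall>x\<in>c ` Z. \<pi> x = f x"
      using finite_bij_extend[of "{..<s}" "c ` Z" f] by auto
    thus ?thesis using f by auto
  qed
  obtain \<pi> where \<pi>: "\<pi> permutes {..<s}" "\<And>p. p \<in> Z \<Longrightarrow> \<pi> (fst p) = fst (b p)"
  proof -
    have "p \<in> grid s \<Longrightarrow> fst p < s" for p by (auto simp: grid_def)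
    thus ?thesis using ext[of fst] inj that by blast
  qed
  obtain \<rho> where \<rho>: "\<rho> permutes {..<s}" "\<And>p. p \<in> Z \<Longrightarrow> \<rho> (snd p) = snd (b p)"
  proof -
    have "p \<in> grid s \<Longrightarrow> snd p < s" for p by (auto simp: grid_def)
    thus ?thesis using ext[of snd] inj that by blast
  qed
  have img: "map_prod \<pi> \<rho> ` Z = Z'"
  proof -
    have "map_prod \<pi> \<rho> ` Z = b ` Z"
      using \<pi>(2) \<rho>(2) by (intro image_cong) (auto simp: map_prod_def split: prod.splits)
    thus ?thesis using b by (simp add: bij_betw_def)
  qed
  obtain h1 where h1: "h1 permutes {\<alpha>..<\<alpha> + s}" "\<And>x. x < s \<Longrightarrow> h1 (\<alpha> + x) = \<alpha> + \<pi> x"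
    using block_permutes[OF \<pi>(1)] by blast
  obtain h2 where h2: "h2 permutes {\<beta>..<\<beta> + s}" "\<And>x. x < s \<Longrightarrow> h2 (\<beta> + x) = \<beta> + \<rho> x"
    using block_permutes[OF \<rho>(1)] by blast
  define h where "h = h1 \<circ> h2"
  have "h1 permutes {1..n}" using h1(1) by (rule permutes_subset) (use box in auto)
  moreover have "h2 permutes {1..n}" using h2(1) by (rule permutes_subset) (use box in auto)
  ultimately have h: "h permutes {1..n}" unfolding h_def by (intro permutes_compose)
  have "h2 (\<alpha> + x) = \<alpha> + x" if "x < s" for x
    using h2(1) box(5) that by (intro permutes_not_in) auto
  hence ha: "h (\<alpha> + x) = \<alpha> + \<pi> x" if "x < s" for x using that h1(2) by (simp add: h_def)
  have hb: "h (\<beta> + x) = \<beta> + \<rho> x" if "x < s" for x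
  proof -
    have "\<rho> x < s" using permutes_in_image[OF \<rho>(1), of x] that by simp
    hence "h1 (\<beta> + \<rho> x) = \<beta> + \<rho> x" using h1(1) box(5) by (intro permutes_not_in) auto
    thus ?thesis using h2(2)[OF that] by (simp add: h_def)
  qed
  show ?thesis
    using zbox_conj_by[OF h \<pi>(1) \<rho>(1) ha hb] img
    by (intro card_conj_transport[OF h _ \<tau>]) simp
qed

section \<open>The number of points in a box\<close>

lemma card_conj_value:
  assumes \<tau>: "\<tau> permutes {1..n}" "\<And>x. x \<in> {1..n} \<Longrightarrow> \<tau> x \<noteq> x"
    and ab: "a \<in> {1..n}" "b \<in> {1..n}" "a \<noteq> b"
  shows "card {g. g permutes {1..n} \<and> conj_by g \<tau> a = b} * (n - 1) = fact n"
proof -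
  define P where "P = {g. g permutes {1..n}}"
  define W where "W c = {g. g permutes {1..n} \<and> conj_by g \<tau> a = c}" for c
  have fP: "finite P" "card P = fact n" unfolding P_def by (simp_all add: finite_permutations card_permutations)
  have fW: "finite (W c)" for c
    by (rule finite_subset[OF _ fP(1)]) (auto simp: W_def P_def)
  have le: "card (W c) \<le> card (W d)" if "c \<in> {1..n} - {a}" "d \<in> {1..n} - {a}" for c d
  proof -
    \<comment> \<open>Swapping the labels \<open>c\<close> and \<open>d\<close>, both different from
      \<open>a\<close>, carries \<open>W c\<close> into \<open>W d\<close>; so all values other than
      \<open>a\<close> are equally likely.\<close>
    have h: "Transposition.transpose c d permutes {1..n}" using that by (intro permutes_swap_id) auto
    have "conj_by (Transposition.transpose c d) \<sigma> a = d" if "\<sigma> a = c" for \<sigma>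
      using \<open>c \<in> {1..n} - {a}\<close> \<open>d \<in> {1..n} - {a}\<close> that by (simp add: conj_by_def)
    thus ?thesis unfolding W_def by (intro card_conj_transport[OF h _ \<tau>(1)])
  qed
  have eq: "card (W c) = card (W b)" if "c \<in> {1..n} - {a}" for c
    using le[of c b] le[of b c] that ab by auto
  have U: "P = (\<Union>c\<in>{1..n} - {a}. W c)"
  proof (intro equalityI subsetI)
    fix g assume "g \<in> P"
    hence g: "g permutes {1..n}" by (simp add: P_def)
    \<comment> \<open>The value \<open>a\<close> itself would come from a fixed point of
      \<open>\<tau>\<close>.\<close>
    have "inv g a \<in> {1..n}" using permutes_in_image[OF permutes_inv[OF g]] ab by simp
    hence "\<tau> (inv g a) \<noteq> inv g a" using \<tau>(2) by blast
    hence "conj_by g \<tau> a \<noteq> a" using permutes_inverses[OF g] by (auto simp: conj_by_def dest: arg_cong[of _ _ "inv g"])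
    moreover have "conj_by g \<tau> a \<in> {1..n}" using permutes_in_image[OF conj_by_permutes[OF g \<tau>(1)]] ab by simp
    ultimately show "g \<in> (\<Union>c\<in>{1..n} - {a}. W c)" using g by (auto simp: W_def)
  qed (auto simp: W_def P_def)
  have "fact n = (\<Sum>c\<in>{1..n} - {a}. card (W c))"
    unfolding fP(2)[symmetric] U by (subst card_UN_disjoint) (auto simp: fW, auto simp: W_def)
  also have "\<dots> = (\<Sum>c\<in>{1..n} - {a}. card (W b))" using eq by (intro sum.cong) auto
  also have "\<dots> = card (W b) * (n - 1)" using ab by simp
  finally show ?thesis by (simp add: W_def)
qed

text \<open>Relabellings that fix \<open>a\<close> and \<open>a'\<close> make all pairs of distinct
  values outside \<open>{a, a'}\<close> equally likely. Depending on the cycle type, pairs of values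
  meeting \<open>{a, a'}\<close> may occur too, hence an inequality.\<close>

lemma card_conj_two_values:
  assumes \<tau>: "\<tau> permutes {1..n}"
    and d: "{a, a', b, b'} \<subseteq> {1..n}" "distinct [a, a', b, b']"
  shows "card {g. g permutes {1..n} \<and> conj_by g \<tau> a = b \<and> conj_by g \<tau> a' = b'} * ((n - 2) * (n - 3)) \<le> fact n"
proof -
  define P where "P = {g. g permutes {1..n}}"
  define W where "W = (\<lambda>(c, c'). {g. g permutes {1..n} \<and> conj_by g \<tau> a = c \<and> conj_by g \<tau> a' = c'})"
  define S where "S = {1..n} - {a, a'}"
  define D where "D = (SIGMA c:S. S - {c})"
  have fP: "finite P" "card P = fact n" unfolding P_def by (simp_all add: finite_permutations card_permutations)
  have fW: "finite (W c)" for c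
    by (rule finite_subset[OF _ fP(1)]) (auto simp: W_def P_def split: prod.splits)
  have S: "finite S" "card S = n - 2" using d by (auto simp: S_def card_Diff_subset)
  have "card D = (\<Sum>c\<in>S. card (S - {c}))" unfolding D_def using S by (intro card_SigmaI) auto
  also have "\<dots> = (\<Sum>c\<in>S. n - 3)" using S by (intro sum.cong) auto
  finally have D: "card D = (n - 2) * (n - 3)" "finite D" using S by (auto simp: D_def)
  have le: "card (W (b, b')) \<le> card (W q)" if q: "q \<in> D" for q
  proof -
    obtain c c' where c: "q = (c, c')" by (cases q)
    define f where "f x = (if x = b then c else if x = b' then c' else x)" for x
    have "inj_on f {a, a', b, b'}" "f ` {a, a', b, b'} \<subseteq> {1..n}"
      using d q c by (auto simp: f_def D_def S_def inj_on_def)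
    then obtain h where h: "h permutes {1..n}" "\<forall>x\<in>{a, a', b, b'}. h x = f x"
      using finite_bij_extend[of "{1..n}" "{a, a', b, b'}" f] d by auto
    have fix_a: "inv h a = a" "inv h a' = a'"
      using h d by (auto simp: f_def permutes_inv_eq[OF h(1)])
    have hb: "h b = c" "h b' = c'" using h(2) d by (auto simp: f_def)
    show ?thesis unfolding W_def c prod.case
      by (intro card_conj_transport[OF h(1) _ \<tau>]) (simp add: conj_by_def fix_a hb)
  qed
  have "card (W (b, b')) * card D = (\<Sum>q\<in>D. card (W (b, b')))" by simp
  also have "\<dots> \<le> (\<Sum>q\<in>D. card (W q))" by (intro sum_mono le)
  also have "\<dots> = card (\<Union>q\<in>D. W q)"
    using D fW by (subst card_UN_disjoint) (auto simp: W_def)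
  also have "\<dots> \<le> card P" using fP by (intro card_mono) (auto simp: W_def P_def)
  finally show ?thesis unfolding D fP by (simp add: W_def)
qed

text \<open>Chebyshev's inequality: the mean \<open>\<mu>\<close> is exact by
  \<open>card_conj_value\<close>, the second moment is bounded by
  \<open>card_conj_two_values\<close>, and the bracket on the right bounds the variance.\<close>

lemma card_few_box_points_le:
  assumes \<tau>: "\<tau> permutes {1..n}" "\<And>x. x \<in> {1..n} \<Longrightarrow> \<tau> x \<noteq> x"
    and box: "1 \<le> \<alpha>" "\<alpha> + s \<le> n + 1" "1 \<le> \<beta>" "\<beta> + s \<le> n + 1" "\<alpha> + s \<le> \<beta> \<or> \<beta> + s \<le> \<alpha>"
    and n: "n \<ge> 4"
  defines "\<mu> \<equiv> real s ^ 2 / (real n - 1)"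
  assumes k0: "real k0 \<le> \<mu>"
  shows "real (card {g. g permutes {1..n} \<and> card (zbox (conj_by g \<tau>) \<alpha> \<beta> s) < k0}) * (\<mu> - k0)\<^sup>2
    \<le> fact n * (\<mu> + real s ^ 4 / ((real n - 2) * (real n - 3)) - \<mu>\<^sup>2)"
proof -
  define P where "P = {g. g permutes {1..n}}"
  have fP: "finite P" "card P = fact n" unfolding P_def by (simp_all add: finite_permutations card_permutations)
  define I where "I p g = (of_bool (conj_by g \<tau> (\<alpha> + fst p) = \<beta> + snd p) :: real)" for p g
  define K where "K g = real (card (zbox (conj_by g \<tau>) \<alpha> \<beta> s))" for g
  define a where "a = fact n / (real n - 1)"
  define b where "b = fact n / ((real n - 2) * (real n - 3))"
  have cgrid: "real (card (grid s)) = real s ^ 2" by (simp add: grid_def card_cartesian_product power2_eq_square)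
  have K: "K g = (\<Sum>p\<in>grid s. I p g)" for g
  proof -
    have "zbox (conj_by g \<tau>) \<alpha> \<beta> s = grid s \<inter> {p. conj_by g \<tau> (\<alpha> + fst p) = \<beta> + snd p}"
      by (auto simp: zbox_def grid_def)
    thus ?thesis by (simp add: K_def I_def)
  qed
  have sumI: "(\<Sum>g\<in>P. of_bool (Q g)) = real (card {g. g permutes {1..n} \<and> Q g})" for Q
  proof -
    have "{g. g permutes {1..n} \<and> Q g} = P \<inter> {g. Q g}" by (auto simp: P_def)
    thus ?thesis using fP by simp
  qed
  have in_box: "\<alpha> + fst p \<in> {1..n}" "\<beta> + snd p \<in> {1..n}" "\<alpha> + fst p \<noteq> \<beta> + snd q"
    if "p \<in> grid s" "q \<in> grid s" for p q
    using that box by (auto simp: grid_def)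
  have one: "(\<Sum>g\<in>P. I p g) = a" if p: "p \<in> grid s" for p
  proof -
    define c where "c = card {g. g permutes {1..n} \<and> conj_by g \<tau> (\<alpha> + fst p) = \<beta> + snd p}"
    have "c * (n - 1) = fact n"
      unfolding c_def using in_box[OF p p] by (intro card_conj_value \<tau>)
    hence "real (c * (n - 1)) = fact n" by (simp only: of_nat_fact)
    hence "real c * (real n - 1) = fact n" using n by (simp add: of_nat_diff)
    hence "real c = a" using n by (simp add: a_def field_simps)
    thus ?thesis unfolding I_def sumI c_def .
  qed
  have two: "(\<Sum>g\<in>P. I p g * I q g) \<le> of_bool (p = q) * a + b" if pq: "p \<in> grid s" "q \<in> grid s" for p q
  proof -
    have b0: "b \<ge> 0" using n by (simp add: b_def)
    have II: "(\<Sum>g\<in>P. I p g * I q g) = real (card {g. g permutes {1..n} \<and>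
        (conj_by g \<tau> (\<alpha> + fst p) = \<beta> + snd p \<and> conj_by g \<tau> (\<alpha> + fst q) = \<beta> + snd q)})"
      unfolding I_def of_bool_conj[symmetric] by (rule sumI)
    \<comment> \<open>Two different cells in one row or column exclude each other, so only equal
      cells and cells in general position contribute.\<close>
    consider "p = q" | "p \<noteq> q" "fst p = fst q" | "p \<noteq> q" "snd p = snd q" | "fst p \<noteq> fst q" "snd p \<noteq> snd q" by blast
    thus ?thesis
    proof cases
      case 1
      have "I p g * I p g = I p g" for g by (simp add: I_def)
      hence "(\<Sum>g\<in>P. I p g * I q g) = a" using one[OF pq(1)] unfolding 1[symmetric] by (simp only:)
      thus ?thesis using 1 b0 by simp
    next
      case 2
      hence "snd p \<noteq> snd q" by (auto simp: prod_eq_iff)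
      hence "I p g * I q g = 0" for g using 2 by (simp add: I_def)
      hence "(\<Sum>g\<in>P. I p g * I q g) = 0" by (intro sum.neutral) blast
      thus ?thesis using 2 b0 by simp
    next
      case 3
      hence "fst p \<noteq> fst q" by (auto simp: prod_eq_iff)
      hence "I p g * I q g = 0" if "g \<in> P" for g
        using 3 permutes_inj[OF conj_by_permutes[of g "{1..n}" \<tau>]] \<tau>(1) that
        by (auto simp: I_def P_def inj_eq dest!: injD[of "conj_by g \<tau>" "\<alpha> + fst p" "\<alpha> + fst q"])
      hence "(\<Sum>g\<in>P. I p g * I q g) = 0" by (intro sum.neutral) blast
      thus ?thesis using 3 b0 by simp
    next
      case 4
      have "card {g. g permutes {1..n} \<and> conj_by g \<tau> (\<alpha> + fst p) = \<beta> + snd p \<and> conj_by g \<tau> (\<alpha> + fst q) = \<beta> + snd q}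
          * ((n - 2) * (n - 3)) \<le> fact n"
        using in_box[OF pq(1) pq(1)] in_box[OF pq(2) pq(2)] in_box[OF pq(1,2)] in_box[OF pq(2,1)] 4
        by (intro card_conj_two_values \<tau>(1)) auto
      hence "real (card {g. g permutes {1..n} \<and> conj_by g \<tau> (\<alpha> + fst p) = \<beta> + snd p \<and> conj_by g \<tau> (\<alpha> + fst q) = \<beta> + snd q}
          * ((n - 2) * (n - 3))) \<le> real (fact n)" by (subst of_nat_le_iff)
      hence "(\<Sum>g\<in>P. I p g * I q g) * ((real n - 2) * (real n - 3)) \<le> fact n"
        unfolding II using n by (simp add: of_nat_diff)
      hence "(\<Sum>g\<in>P. I p g * I q g) \<le> b" using n by (simp add: b_def le_divide_eq)
      thus ?thesis using 4 by auto
    qed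
  qed
  have S1: "(\<Sum>g\<in>P. K g) = \<mu> * fact n"
  proof -
    have "(\<Sum>g\<in>P. K g) = (\<Sum>p\<in>grid s. \<Sum>g\<in>P. I p g)" unfolding K by (rule sum.swap)
    also have "\<dots> = (\<Sum>p\<in>grid s. a)" by (intro sum.cong one) auto
    also have "\<dots> = \<mu> * fact n" by (simp add: cgrid a_def \<mu>_def)
    finally show ?thesis .
  qed
  have S2: "(\<Sum>g\<in>P. (K g)\<^sup>2) \<le> \<mu> * fact n + real s ^ 4 * b"
  proof -
    have "(\<Sum>g\<in>P. (K g)\<^sup>2) = (\<Sum>g\<in>P. \<Sum>p\<in>grid s. \<Sum>q\<in>grid s. I p g * I q g)"
      unfolding K power2_eq_square sum_product ..
    also have "\<dots> = (\<Sum>p\<in>grid s. \<Sum>g\<in>P. \<Sum>q\<in>grid s. I p g * I q g)" by (rule sum.swap)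
    also have "\<dots> = (\<Sum>p\<in>grid s. \<Sum>q\<in>grid s. \<Sum>g\<in>P. I p g * I q g)" by (intro sum.cong refl sum.swap)
    also have "\<dots> \<le> (\<Sum>p\<in>grid s. \<Sum>q\<in>grid s. of_bool (p = q) * a + b)" by (intro sum_mono two)
    also have "\<dots> = (\<Sum>p\<in>grid s. a + real s ^ 2 * b)"
    proof (intro sum.cong refl)
      fix p assume "p \<in> grid s"
      hence "(\<Sum>q\<in>grid s. of_bool (p = q) * a) = a" by (simp add: of_bool_def if_distrib[of "\<lambda>x. x * a"] cong: if_cong)
      thus "(\<Sum>q\<in>grid s. of_bool (p = q) * a + b) = a + real s ^ 2 * b" by (simp add: sum.distrib cgrid)
    qed
    also have "\<dots> = \<mu> * fact n + real s ^ 4 * b"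
      by (simp add: cgrid a_def \<mu>_def algebra_simps power2_eq_square power4_eq_xxxx)
    finally show ?thesis .
  qed
  define W where "W = {g. g permutes {1..n} \<and> card (zbox (conj_by g \<tau>) \<alpha> \<beta> s) < k0}"
  have "real (card W) * (\<mu> - k0)\<^sup>2 = (\<Sum>g\<in>W. (\<mu> - k0)\<^sup>2)" by simp
  also have "\<dots> \<le> (\<Sum>g\<in>W. (\<mu> - K g)\<^sup>2)"
    using k0 by (intro sum_mono power_mono) (auto simp: W_def K_def)
  also have "\<dots> \<le> (\<Sum>g\<in>P. (\<mu> - K g)\<^sup>2)"
    using fP by (intro sum_mono2) (auto simp: W_def P_def)
  also have "\<dots> = (\<Sum>g\<in>P. \<mu>\<^sup>2 - 2 * \<mu> * K g + (K g)\<^sup>2)"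
    by (intro sum.cong refl) (simp add: power2_eq_square algebra_simps)
  also have "\<dots> = fact n * \<mu>\<^sup>2 - 2 * \<mu> * (\<Sum>g\<in>P. K g) + (\<Sum>g\<in>P. (K g)\<^sup>2)"
    by (simp add: sum.distrib sum_subtractf fP flip: sum_distrib_left)
  also have "\<dots> \<le> fact n * \<mu>\<^sup>2 - 2 * \<mu> * (\<mu> * fact n) + (\<mu> * fact n + real s ^ 4 * b)"
    using S2 unfolding S1 by simp
  also have "\<dots> = fact n * (\<mu> + real s ^ 4 / ((real n - 2) * (real n - 3)) - \<mu>\<^sup>2)"
    by (simp add: b_def algebra_simps power2_eq_square)
  finally show ?thesis by (simp add: W_def)
qed

section \<open>The longest chain in a box\<close>

lemma finite_tf_all: "finite (tf_all s)"
  by (rule finite_subset[of _ "Pow (grid s)"]) (auto simp: tf_all_def)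

text \<open>Counterpart of \<open>prob_field_le_tf_frac\<close>: relabellings with at least
  \<open>k0\<close> points in the box form a mixture over sizes from \<open>k0\<close> on.\<close>

lemma tf_frac_le_card_conj:
  assumes \<tau>: "\<tau> permutes {1..n}"
    and box: "1 \<le> \<alpha>" "\<alpha> + s \<le> n + 1" "1 \<le> \<beta>" "\<beta> + s \<le> n + 1" "\<alpha> + s \<le> \<beta> \<or> \<beta> + s \<le> \<alpha>"
    and E: "\<And>Z Z'. Z \<subseteq> Z' \<Longrightarrow> Z' \<subseteq> grid s \<Longrightarrow> Z \<in> E \<Longrightarrow> Z' \<in> E"
    and k0: "k0 \<le> s"
  shows "tf_frac s E k0 * real (card {g. g permutes {1..n} \<and> k0 \<le> card (zbox (conj_by g \<tau>) \<alpha> \<beta> s)})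
    \<le> real (card {g. g permutes {1..n} \<and> zbox (conj_by g \<tau>) \<alpha> \<beta> s \<in> E})"
proof -
  define P where "P = {g. g permutes {1..n}}"
  have fP: "finite P" unfolding P_def by (simp add: finite_permutations)
  define f where "f Z = real (card {g. g permutes {1..n} \<and> zbox (conj_by g \<tau>) \<alpha> \<beta> s = Z})" for Z
  have tf: "zbox (conj_by g \<tau>) \<alpha> \<beta> s \<in> tf_all s" if "g permutes {1..n}" for g
    by (rule zbox_tie_free[OF permutes_inj[OF conj_by_permutes[OF that \<tau>]]])
  have sumf: "(\<Sum>Z\<in>X. f Z) = real (card {g. g permutes {1..n} \<and> zbox (conj_by g \<tau>) \<alpha> \<beta> s \<in> X})"
    if "X \<subseteq> tf_all s" for X
  proof -
    have "{g. g permutes {1..n} \<and> zbox (conj_by g \<tau>) \<alpha> \<beta> s \<in> X}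
        = (\<Union>Z\<in>X. {g. g permutes {1..n} \<and> zbox (conj_by g \<tau>) \<alpha> \<beta> s = Z})" by auto
    also have "card \<dots> = (\<Sum>Z\<in>X. card {g. g permutes {1..n} \<and> zbox (conj_by g \<tau>) \<alpha> \<beta> s = Z})"
      using finite_subset[OF that finite_tf_all]
      by (intro card_UN_disjoint) (auto intro: finite_subset[OF _ fP] simp: P_def)
    finally show ?thesis by (simp add: f_def)
  qed
  have "tf_frac s E k0 * (\<Sum>Z\<in>{Z \<in> tf_all s. k0 \<le> card Z}. f Z) \<le> (\<Sum>Z\<in>{Z \<in> tf_all s. k0 \<le> card Z} \<inter> E. f Z)"
  proof (rule tf_weight_compare(2)[OF _ _ E k0])
    show "f Z = f Z'" if "Z \<in> tf_all s" "Z' \<in> tf_all s" "card Z = card Z'" for Z Z'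
      using card_zbox_config_le[OF \<tau> box that] card_zbox_config_le[OF \<tau> box that(2,1) that(3)[symmetric]]
      by (simp add: f_def)
  qed (auto simp: f_def)
  also have "(\<Sum>Z\<in>{Z \<in> tf_all s. k0 \<le> card Z}. f Z)
      = real (card {g. g permutes {1..n} \<and> k0 \<le> card (zbox (conj_by g \<tau>) \<alpha> \<beta> s)})"
    using tf by (subst sumf) (auto intro!: arg_cong[of _ _ card])
  also have "(\<Sum>Z\<in>{Z \<in> tf_all s. k0 \<le> card Z} \<inter> E. f Z)
      = real (card {g. g permutes {1..n} \<and> zbox (conj_by g \<tau>) \<alpha> \<beta> s \<in> {Z \<in> tf_all s. k0 \<le> card Z} \<inter> E})"
    by (rule sumf) auto
  also have "\<dots> \<le> real (card {g. g permutes {1..n} \<and> zbox (conj_by g \<tau>) \<alpha> \<beta> s \<in> E})"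
    unfolding of_nat_le_iff by (rule card_mono[OF finite_subset[OF _ fP]]) (auto simp: P_def)
  finally show ?thesis .
qed

text \<open>The side \<open>(1 + \<epsilon>) * A * sqrt n\<close> gives the box a mean of at least
  \<open>(1 + \<epsilon>) ^ 2 * A ^ 2\<close> points, against \<open>A ^ 2\<close> in the Bernoulli
  field. So \<open>k0\<close>, about \<open>(1 + \<epsilon>) * A ^ 2\<close>, is at distance of
  order \<open>\<epsilon> * A ^ 2\<close> from both means, while both counts fluctuate by order
  \<open>A\<close>. The loss \<open>4 * \<epsilon>\<close> is \<open>3 * \<epsilon>\<close> from
  \<open>tf_frac_lis_ge\<close> and \<open>\<epsilon>\<close> for boxes with too few points.\<close>

lemma card_lis_box_ge:
  fixes \<epsilon> :: real
  assumes e: "0 < \<epsilon>" "\<epsilon> \<le> 1 / 12"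
  shows "\<exists>A>0. \<exists>N. \<forall>n\<ge>N. \<forall>\<tau> \<alpha> \<beta> s. s = nat \<lceil>(1 + \<epsilon>) * A * sqrt n\<rceil> \<longrightarrow>
    \<tau> permutes {1..n} \<longrightarrow> (\<forall>x\<in>{1..n}. \<tau> x \<noteq> x) \<longrightarrow>
    1 \<le> \<alpha> \<longrightarrow> \<alpha> + s \<le> n + 1 \<longrightarrow> 1 \<le> \<beta> \<longrightarrow> \<beta> + s \<le> n + 1 \<longrightarrow> \<alpha> + s \<le> \<beta> \<or> \<beta> + s \<le> \<alpha> \<longrightarrow>
    (1 - 4 * \<epsilon>) * fact n \<le>
      real (card {g. g permutes {1..n} \<and> (2 - 5 * \<epsilon>) * A \<le> real (lis (zbox (conj_by g \<tau>) \<alpha> \<beta> s))})"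
proof -
  define A where "A = 46080 / \<epsilon> ^ 5"
  have e5: "0 < \<epsilon> ^ 5" "\<epsilon> ^ 5 \<le> 1" using e by (auto intro: power_le_one)
  have A1: "A \<ge> 46080" using e5 by (simp add: A_def le_divide_eq)
  have Ae: "A * \<epsilon> ^ 5 = 46080" using e5 by (simp add: A_def)
  have Ae2: "A * \<epsilon>\<^sup>2 \<ge> 46080"
  proof -
    have "\<epsilon> ^ 5 \<le> \<epsilon>\<^sup>2" using e by (intro power_decreasing) auto
    hence "A * \<epsilon> ^ 5 \<le> A * \<epsilon>\<^sup>2" using A1 by (intro mult_left_mono) auto
    thus ?thesis using Ae by simp
  qed
  have Ae3: "A * \<epsilon> ^ 3 \<ge> 46080"
  proof -
    have "\<epsilon> ^ 5 \<le> \<epsilon> ^ 3" using e by (intro power_decreasing) auto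
    hence "A * \<epsilon> ^ 5 \<le> A * \<epsilon> ^ 3" using A1 by (intro mult_left_mono) auto
    thus ?thesis using Ae by simp
  qed
  \<comment> \<open>The first two terms, multiplied by \<open>A\<close>, are the lower bounds on
    \<open>s\<close> in \<open>tf_frac_lis_ge\<close>. The third gives
    \<open>k0 \<le> 63 * A ^ 2 \<le> s\<close> and \<open>A ^ 2 / n \<le> 1 / 3969\<close>, used for
    the variance below.\<close>
  define R where "R = 100 / \<epsilon>\<^sup>2 + A ^ 3 / \<epsilon> + 63 * A + 3"
  have R0: "100 / \<epsilon>\<^sup>2 \<ge> 0" "A ^ 3 / \<epsilon> \<ge> 0" using e A1 by auto
  define N where "N = nat \<lceil>R\<^sup>2\<rceil>"
  show ?thesis
  proof (rule exI[of _ A], intro conjI exI[of _ N] allI impI)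
    show "A > 0" using A1 by simp
    fix n \<tau> \<alpha> \<beta> s
    assume n: "N \<le> n" and s: "s = nat \<lceil>(1 + \<epsilon>) * A * sqrt n\<rceil>"
      and \<tau>: "\<tau> permutes {1..n}" "\<forall>x\<in>{1..n}. \<tau> x \<noteq> x"
      and box: "1 \<le> \<alpha>" "\<alpha> + s \<le> n + 1" "1 \<le> \<beta>" "\<beta> + s \<le> n + 1" "\<alpha> + s \<le> \<beta> \<or> \<beta> + s \<le> \<alpha>"
    have "real n \<ge> R\<^sup>2" using n unfolding N_def by linarith
    hence sn: "R \<le> sqrt n" by (rule real_le_rsqrt)
    have sn1: "100 / \<epsilon>\<^sup>2 \<le> sqrt n" "A ^ 3 / \<epsilon> \<le> sqrt n" "63 * A \<le> sqrt n"
      using sn R0 A1 unfolding R_def by linarith+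
    have sq: "sqrt n * sqrt n = n" by simp
    have n0: "real n \<ge> 3969 * A\<^sup>2"
    proof -
      have "(63 * A) * (63 * A) \<le> sqrt n * sqrt n" using sn1(3) A1 by (intro mult_mono) auto
      thus ?thesis unfolding sq by (simp add: power2_eq_square)
    qed
    have AA: "A \<le> A\<^sup>2" using A1 by (simp add: power2_eq_square)
    have n6: "real n \<ge> 6" using n0 AA A1 by linarith
    have s_ge: "(1 + \<epsilon>) * A * sqrt n \<le> s" unfolding s by linarith
    have sA: "A * sqrt n \<le> s"
    proof -
      have "1 * (A * sqrt n) \<le> (1 + \<epsilon>) * (A * sqrt n)" using e A1 by (intro mult_right_mono) auto
      thus ?thesis using s_ge by (simp add: mult_ac)
    qed
    have s_le: "s \<le> 3 * A * sqrt n"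
    proof -
      have "(1 + \<epsilon>) * (A * sqrt n) \<le> 2 * (A * sqrt n)" using e A1 by (intro mult_right_mono) auto
      moreover have "1 * 1 \<le> A * sqrt n" using A1 n6 by (intro mult_mono) auto
      moreover have "s \<le> (1 + \<epsilon>) * A * sqrt n + 1" unfolding s using e A1 by simp
      ultimately show ?thesis by (simp add: mult_ac)
    qed
    define k0 where "k0 = nat \<lceil>(1 + \<epsilon>) * A\<^sup>2\<rceil>"
    have k0: "(1 + \<epsilon>) * A\<^sup>2 \<le> k0" "k0 \<le> (1 + \<epsilon>) * A\<^sup>2 + 1"
      using e by (auto simp: k0_def)
    have k0s: "k0 \<le> s"
    proof -
      have "(1 + \<epsilon>) * A\<^sup>2 \<le> 2 * A\<^sup>2" using e by (intro mult_right_mono) auto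
      hence "k0 \<le> 63 * A\<^sup>2" using k0(2) AA A1 by linarith
      also have "\<dots> \<le> A * sqrt n"
        using mult_left_mono[OF sn1(3), of A] A1 by (simp add: power2_eq_square)
      also have "\<dots> \<le> s" by (rule sA)
      finally show ?thesis by simp
    qed
    have frac: "1 - 3 * \<epsilon> \<le> tf_frac s {Z. (2 - 5 * \<epsilon>) * A \<le> real (lis Z)} k0"
    proof (rule tf_frac_lis_ge[OF e(1) _ _ _ _ k0(1) k0s])
      show "46080 / \<epsilon> ^ 5 \<le> A" by (simp add: A_def)
      have "A * (100 / \<epsilon>\<^sup>2) \<le> A * sqrt n" using sn1(1) A1 by (intro mult_left_mono) auto
      thus "100 * A / \<epsilon>\<^sup>2 \<le> s" using sA by (simp add: mult.commute)
      have "A * (A ^ 3 / \<epsilon>) \<le> A * sqrt n" using sn1(2) A1 by (intro mult_left_mono) auto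
      thus "A ^ 4 / \<epsilon> \<le> s" using sA by (simp add: power4_eq_xxxx power3_eq_cube)
    qed (use e in simp)
    define P where "P = {g. g permutes {1..n}}"
    have fP: "finite P" "card P = fact n" unfolding P_def by (simp_all add: finite_permutations card_permutations)
    define few where "few = {g. g permutes {1..n} \<and> card (zbox (conj_by g \<tau>) \<alpha> \<beta> s) < k0}"
    define many where "many = {g. g permutes {1..n} \<and> k0 \<le> card (zbox (conj_by g \<tau>) \<alpha> \<beta> s)}"
    define \<mu> where "\<mu> = real s ^ 2 / (real n - 1)"
    have mu_ge: "(1 + \<epsilon>)\<^sup>2 * A\<^sup>2 \<le> \<mu>"
    proof -
      have "((1 + \<epsilon>) * A * sqrt n)\<^sup>2 \<le> real s ^ 2" using s_ge e A1 by (intro power_mono) auto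
      hence "(1 + \<epsilon>)\<^sup>2 * A\<^sup>2 * n \<le> real s ^ 2" by (simp add: power_mult_distrib)
      moreover have "(1 + \<epsilon>)\<^sup>2 * A\<^sup>2 * (real n - 1) \<le> (1 + \<epsilon>)\<^sup>2 * A\<^sup>2 * n" by (intro mult_left_mono) auto
      ultimately have "(1 + \<epsilon>)\<^sup>2 * A\<^sup>2 * (real n - 1) \<le> real s ^ 2" by linarith
      thus ?thesis using n6 by (simp add: \<mu>_def le_divide_eq)
    qed
    have s2: "real s ^ 2 \<le> 9 * A\<^sup>2 * n"
      using power_mono[OF s_le, of 2] by (simp add: power_mult_distrib)
    have mu_le: "\<mu> \<le> 18 * A\<^sup>2"
    proof -
      have "9 * A\<^sup>2 * n \<le> 18 * A\<^sup>2 * (real n - 1)"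
        using mult_left_mono[of "real n" "2 * (real n - 1)" "9 * A\<^sup>2"] n6 by (simp add: algebra_simps)
      hence "real s ^ 2 \<le> 18 * A\<^sup>2 * (real n - 1)" using s2 by linarith
      thus ?thesis using n6 by (simp add: \<mu>_def divide_le_eq)
    qed
    \<comment> \<open>Half of the distance \<open>\<epsilon> * A ^ 2\<close> is spent on rounding
      \<open>k0\<close> up.\<close>
    have gap: "\<epsilon> * A\<^sup>2 / 2 \<le> \<mu> - k0"
    proof -
      have "46080 \<le> \<epsilon> * A\<^sup>2"
      proof -
        have "A * \<epsilon>\<^sup>2 \<le> A\<^sup>2 * \<epsilon>" using e A1 AA by (intro mult_mono) (auto simp: power2_eq_square)
        thus ?thesis using Ae2 by (simp add: mult_ac)
      qed
      moreover have "(1 + \<epsilon>)\<^sup>2 * A\<^sup>2 \<ge> (1 + \<epsilon>) * A\<^sup>2 + \<epsilon> * A\<^sup>2"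
      proof -
        have "\<epsilon>\<^sup>2 * A\<^sup>2 \<ge> 0" by simp
        thus ?thesis by (simp add: power2_eq_square algebra_simps)
      qed
      ultimately show ?thesis using mu_ge k0(2) by linarith
    qed
    have gap_pos: "\<epsilon> * A\<^sup>2 / 2 > 0" using e A1 by simp
    have V: "\<mu> + real s ^ 4 / ((real n - 2) * (real n - 3)) - \<mu>\<^sup>2 \<le> 19 * A\<^sup>2"
    proof -
      \<comment> \<open>The two denominators differ only by a linear term, so the part of the
        variance beyond \<open>\<mu>\<close> is of order \<open>A ^ 4 / n\<close>; the constants
        give \<open>81 * 48 = 3888 < 3969\<close>.\<close>
      have den: "1 / ((real n - 2) * (real n - 3)) - 1 / (real n - 1)\<^sup>2 \<le> 48 / real n ^ 3"
      proof -
        define d where "d = (real n - 2) * (real n - 3)"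
        define q where "q = (real n - 1)\<^sup>2"
        have half: "real n / 2 \<le> real n - 3" using n6 by simp
        have d: "(real n / 2) * (real n / 2) \<le> d" unfolding d_def using half n6 by (intro mult_mono) auto
        have q: "(real n / 2) * (real n / 2) \<le> q" unfolding q_def power2_eq_square using half n6 by (intro mult_mono) auto
        have nn: "(real n / 2) * (real n / 2) > 0" using n6 by simp
        have dq: "real n ^ 4 / 16 \<le> d * q"
        proof -
          have "((real n / 2) * (real n / 2)) * ((real n / 2) * (real n / 2)) \<le> d * q"
            using d q nn by (intro mult_mono) auto
          thus ?thesis by (simp add: power4_eq_xxxx)
        qed
        have "1 / d - 1 / q = (q - d) / (d * q)" using d q nn by (simp add: field_simps)
        also have "q - d = 3 * real n - 5" by (simp add: q_def d_def power2_eq_square algebra_simps)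
        also have "(3 * real n - 5) / (d * q) \<le> (3 * real n) / (real n ^ 4 / 16)"
          using dq n6 by (intro frac_le) auto
        also have "\<dots> = 48 / real n ^ 3" using n6 by (simp add: power4_eq_xxxx power3_eq_cube)
        finally show ?thesis by (simp add: d_def q_def)
      qed
      have s4: "real s ^ 4 \<le> 81 * A ^ 4 * real n ^ 2"
        using power_mono[OF s2, of 2] by (simp add: power_mult_distrib flip: power_mult)
      have "real s ^ 4 / ((real n - 2) * (real n - 3)) - \<mu>\<^sup>2
          = real s ^ 4 * (1 / ((real n - 2) * (real n - 3)) - 1 / (real n - 1)\<^sup>2)"
        by (simp add: \<mu>_def power_divide right_diff_distrib flip: power_mult)
      also have "\<dots> \<le> real s ^ 4 * (48 / real n ^ 3)" using den by (intro mult_left_mono) auto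
      also have "\<dots> \<le> (81 * A ^ 4 * real n ^ 2) * (48 / real n ^ 3)" using s4 by (intro mult_right_mono) auto
      also have "\<dots> = 3888 * A\<^sup>2 * (A\<^sup>2 / n)"
        using n6 by (simp add: power2_eq_square power3_eq_cube power4_eq_xxxx)
      also have "\<dots> \<le> 3888 * A\<^sup>2 * (1 / 3969)"
        using n0 n6 by (intro mult_left_mono) (auto simp: divide_le_eq)
      also have "\<dots> \<le> A\<^sup>2" by simp
      finally show ?thesis using mu_le by linarith
    qed
    have few: "real (card few) \<le> \<epsilon> * fact n"
    proof -
      have k0mu: "real k0 \<le> real s ^ 2 / (real n - 1)" using gap gap_pos unfolding \<mu>_def by linarith
      have n4: "4 \<le> n" using n6 by linarith
      have "real (card few) * (\<mu> - k0)\<^sup>2 \<le> fact n * (\<mu> + real s ^ 4 / ((real n - 2) * (real n - 3)) - \<mu>\<^sup>2)"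
        unfolding few_def \<mu>_def by (rule card_few_box_points_le[OF \<tau>(1) _ box n4 k0mu]) (use \<tau>(2) in blast)
      also have "\<dots> \<le> fact n * (19 * A\<^sup>2)" using V by (intro mult_left_mono) auto
      finally have 1: "real (card few) * (\<mu> - k0)\<^sup>2 \<le> fact n * (19 * A\<^sup>2)" .
      have "real (card few) * (\<epsilon> * A\<^sup>2 / 2)\<^sup>2 \<le> real (card few) * (\<mu> - k0)\<^sup>2"
        using gap gap_pos by (intro mult_left_mono power_mono) auto
      hence 2: "real (card few) * (\<epsilon> * A\<^sup>2 / 2)\<^sup>2 \<le> fact n * (19 * A\<^sup>2)" using 1 by linarith
      have "19 * A\<^sup>2 \<le> \<epsilon> * (\<epsilon> * A\<^sup>2 / 2)\<^sup>2"
      proof -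
        have "46080 * A\<^sup>2 \<le> (A * \<epsilon> ^ 3) * A\<^sup>2" using Ae3 by (intro mult_right_mono) auto
        also have "\<dots> \<le> (A\<^sup>2 * \<epsilon> ^ 3) * A\<^sup>2" using AA e by (intro mult_right_mono) auto
        finally have "46080 * A\<^sup>2 \<le> 4 * (\<epsilon> * (\<epsilon> * A\<^sup>2 / 2)\<^sup>2)"
          by (simp add: power2_eq_square power3_eq_cube mult_ac)
        moreover have "A\<^sup>2 \<ge> 0" by simp
        ultimately show ?thesis by linarith
      qed
      hence "fact n * (19 * A\<^sup>2) \<le> (\<epsilon> * fact n) * (\<epsilon> * A\<^sup>2 / 2)\<^sup>2"
        using mult_left_mono[of "19 * A\<^sup>2" "\<epsilon> * (\<epsilon> * A\<^sup>2 / 2)\<^sup>2" "fact n"] by (simp add: mult_ac)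
      hence "real (card few) * (\<epsilon> * A\<^sup>2 / 2)\<^sup>2 \<le> (\<epsilon> * fact n) * (\<epsilon> * A\<^sup>2 / 2)\<^sup>2" using 2 by linarith
      moreover have "0 < (\<epsilon> * A\<^sup>2 / 2)\<^sup>2" using gap_pos by (rule zero_less_power)
      ultimately show ?thesis by (rule mult_right_le_imp_le)
    qed
    have "P = few \<union> many" "few \<inter> many = {}" by (auto simp: P_def few_def many_def)
    hence "real (card P) = real (card few) + real (card many)"
      using fP(1) by (simp add: card_Un_disjoint)
    hence many: "real (card many) \<ge> (1 - \<epsilon>) * fact n" using few fP by (simp add: algebra_simps)
    have "(1 - 4 * \<epsilon>) * fact n \<le> (1 - 3 * \<epsilon>) * ((1 - \<epsilon>) * fact n)"
    proof -
      have "1 - 4 * \<epsilon> \<le> (1 - 3 * \<epsilon>) * (1 - \<epsilon>)" by (simp add: algebra_simps)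
      hence "(1 - 4 * \<epsilon>) * fact n \<le> ((1 - 3 * \<epsilon>) * (1 - \<epsilon>)) * fact n" by (rule mult_right_mono) simp
      thus ?thesis by (simp only: mult.assoc)
    qed
    also have "\<dots> \<le> tf_frac s {Z. (2 - 5 * \<epsilon>) * A \<le> real (lis Z)} k0 * real (card many)"
      using frac many e by (intro mult_mono tf_frac_nonneg) auto
    also have "\<dots> \<le> real (card {g. g permutes {1..n} \<and>
        zbox (conj_by g \<tau>) \<alpha> \<beta> s \<in> {Z. (2 - 5 * \<epsilon>) * A \<le> real (lis Z)}})"
      unfolding many_def
    proof (rule tf_frac_le_card_conj[OF \<tau>(1) box _ k0s])
      fix Z Z' assume *: "Z \<subseteq> Z'" "Z' \<subseteq> grid s" "Z \<in> {Z. (2 - 5 * \<epsilon>) * A \<le> real (lis Z)}"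
      have "lis Z \<le> lis Z'" using * finite_subset[OF *(2) finite_grid] by (intro lis_mono)
      thus "Z' \<in> {Z. (2 - 5 * \<epsilon>) * A \<le> real (lis Z)}" using *(3) by simp
    qed
    finally show "(1 - 4 * \<epsilon>) * fact n \<le> real (card {g. g permutes {1..n} \<and>
        (2 - 5 * \<epsilon>) * A \<le> real (lis (zbox (conj_by g \<tau>) \<alpha> \<beta> s))})" by simp
  qed
qed

subsection \<open>Strips parallel to the diagonal\<close>

text \<open>Along a strip the column block \<open>i\<close> and the value block \<open>i + j\<close>
  increase together, so chains of successive boxes concatenate.\<close>

lemma strip_lis_le_LIS:
  assumes s: "s > 0" and fit: "\<And>i. i < q \<Longrightarrow> (i + 1) * s \<le> n"
  shows "(\<Sum>i<q. lis (zbox \<tau> (i * s + 1) ((i + j) * s + 1) s)) \<le> LIS n \<tau>"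
proof -
  define Zi where "Zi i = zbox \<tau> (i * s + 1) ((i + j) * s + 1) s" for i
  have "\<exists>C. C \<subseteq> Zi i \<and> grid_chain C \<and> card C = lis (Zi i)" for i
    by (rule lis_attained) (simp add: Zi_def)
  then obtain C where C: "\<And>i. C i \<subseteq> Zi i" "\<And>i. grid_chain (C i)" "\<And>i. card (C i) = lis (Zi i)"
    by metis
  define F where "F i = (\<lambda>p. i * s + 1 + fst p) ` C i" for i
  define I where "I = (\<Union>i<q. F i)"
  have mem: "\<exists>x y. (x, y) \<in> C i \<and> z = i * s + 1 + x \<and> x < s \<and> y < s \<and> \<tau> z = (i + j) * s + 1 + y"
    if "z \<in> F i" for i z
    using that C(1)[of i] by (fastforce simp: F_def Zi_def zbox_def)
  have order: "i < i'" if zz: "z \<in> F i" "z' \<in> F i'" "i \<noteq> i'" "z \<le> z'" for i i' z z'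
  proof (rule ccontr)
    assume "\<not> i < i'"
    hence "(i' + 1) * s \<le> i * s" using zz(3) by (intro mult_right_mono) auto
    moreover obtain x where "z = i * s + 1 + x" using mem[OF zz(1)] by blast
    moreover obtain x' where "z' = i' * s + 1 + x'" "x' < s" using mem[OF zz(2)] by blast
    ultimately show False using zz(4) by simp
  qed
  have disj: "F i \<inter> F i' = {}" if "i \<noteq> i'" for i i'
    using order[of _ i _ i'] order[of _ i' _ i] that by fastforce
  have finC: "finite (C i)" for i using C(1)[of i] finite_subset by (fastforce simp: Zi_def)
  have cF: "card (F i) = lis (Zi i)" for i
  proof -
    have "inj_on (\<lambda>p. i * s + 1 + fst p) (C i)"
      using C(2)[of i] unfolding grid_chain_def by (intro inj_onI) (metis add_left_cancel less_irrefl)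
    thus ?thesis using C(3) by (simp add: F_def card_image)
  qed
  have "I \<subseteq> {1..n}"
  proof
    fix z assume "z \<in> I"
    then obtain i where i: "i < q" "z \<in> F i" by (auto simp: I_def)
    obtain x where "z = i * s + 1 + x" "x < s" using mem[OF i(2)] by blast
    thus "z \<in> {1..n}" using fit[OF i(1)] by simp
  qed
  moreover have "strict_mono_on I \<tau>"
  proof (rule strict_mono_onI)
    fix z z' assume "z \<in> I" "z' \<in> I" and lt: "z < z'"
    then obtain i i' where i: "z \<in> F i" "z' \<in> F i'" by (auto simp: I_def)
    obtain x y where z: "(x, y) \<in> C i" "z = i * s + 1 + x" "y < s" "\<tau> z = (i + j) * s + 1 + y"
      using mem[OF i(1)] by blast
    obtain x' y' where z': "(x', y') \<in> C i'" "z' = i' * s + 1 + x'" "\<tau> z' = (i' + j) * s + 1 + y'"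
      using mem[OF i(2)] by blast
    show "\<tau> z < \<tau> z'"
    proof (cases "i = i'")
      case True
      hence "x < x'" using lt z z' by simp
      hence "y < y'" using C(2)[of i] z(1) z'(1) True unfolding grid_chain_def by fastforce
      thus ?thesis using z z' True by simp
    next
      case False
      hence "i < i'" using order[OF i] lt by simp
      hence "(i + j + 1) * s \<le> (i' + j) * s" by (intro mult_right_mono) auto
      thus ?thesis using z z' by simp
    qed
  qed
  ultimately have "card I \<le> LIS n \<tau>" by (rule LIS_ge)
  moreover have "card I = (\<Sum>i<q. card (F i))"
    unfolding I_def using disj finC by (intro card_UN_disjoint) (auto simp: F_def)
  ultimately show ?thesis by (simp add: cF Zi_def)
qed

text \<open>\<open>j\<close> starts at 1: the boxes with \<open>j = 0\<close> lie on the diagonal,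
  where \<open>card_lis_box_ge\<close> does not apply.\<close>

definition strips_lis :: "nat \<Rightarrow> nat \<Rightarrow> nat \<Rightarrow> (nat \<Rightarrow> nat) \<Rightarrow> nat" where
  "strips_lis s q w \<tau> = (\<Sum>j\<in>{1..w}. \<Sum>i<q. lis (zbox \<tau> (i * s + 1) ((i + j) * s + 1) s))"

lemma strips_lis_le_LIS:
  assumes "s > 0" "\<And>i. i < q \<Longrightarrow> (i + 1) * s \<le> n"
  shows "strips_lis s q w \<tau> \<le> w * LIS n \<tau>"
proof -
  have "strips_lis s q w \<tau> \<le> (\<Sum>j\<in>{1..w}. LIS n \<tau>)"
    unfolding strips_lis_def by (intro sum_mono strip_lis_le_LIS assms)
  thus ?thesis by simp
qed

text \<open>From an optimal chain of the first box, drop the points missing in the second.\<close>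

lemma lis_zbox_le_add_diff:
  "lis (zbox \<tau> \<alpha> \<beta> s) \<le> lis (zbox \<tau>' \<alpha> \<beta> s) + card (zbox \<tau> \<alpha> \<beta> s - zbox \<tau>' \<alpha> \<beta> s)"
proof -
  let ?Z = "zbox \<tau> \<alpha> \<beta> s" and ?Z' = "zbox \<tau>' \<alpha> \<beta> s"
  obtain C where C: "C \<subseteq> ?Z" "grid_chain C" "card C = lis ?Z"
    using lis_attained[of ?Z] by auto
  have fin: "finite C" using C(1) by (rule finite_subset) simp
  have "card C \<le> card (C \<inter> ?Z') + card (C - ?Z')"
    using fin by (metis Int_Diff_Un card_Un_le)
  moreover have "card (C \<inter> ?Z') \<le> lis ?Z'"
    using C(2) by (intro lis_ge) (auto intro: grid_chain_subset)
  moreover have "card (C - ?Z') \<le> card (?Z - ?Z')" using C(1) by (intro card_mono) auto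
  ultimately show ?thesis using C(3) by linarith
qed

text \<open>The boxes are disjoint, so a point of the graph that moves costs at most one in total.\<close>
lemma strips_lis_diff:
  assumes D: "finite {z. \<tau> z \<noteq> \<tau>' z}"
  shows "strips_lis s q w \<tau> \<le> strips_lis s q w \<tau>' + card {z. \<tau> z \<noteq> \<tau>' z}"
proof -
  define Q where "Q = {1..w} \<times> {..<q}"
  define X where "X = (\<lambda>(j, i). zbox \<tau> (i * s + 1) ((i + j) * s + 1) s - zbox \<tau>' (i * s + 1) ((i + j) * s + 1) s)"
  \<comment> \<open>Sends a lost point to its column. This is injective: by division with remainder
    the column gives \<open>i\<close> and \<open>fst p\<close>, and its value under
    \<open>\<tau>\<close> gives \<open>i + j\<close> and \<open>snd p\<close>.\<close>
  define h where "h = (\<lambda>((j :: nat, i), p :: nat \<times> nat). i * s + 1 + fst p)"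
  have mem: "fst p < s \<and> snd p < s \<and> \<tau> (h ((j, i), p)) = (i + j) * s + 1 + snd p \<and> \<tau> (h ((j, i), p)) \<noteq> \<tau>' (h ((j, i), p))"
    if "((j, i), p) \<in> Sigma Q X" for j i p
    using that by (cases p) (auto simp: X_def zbox_def h_def)
  have uniq: "a = b \<and> x = y" if "a * s + x = b * s + y" "x < s" "y < s" for a b x y :: nat
  proof -
    have "a = (a * s + x) div s" using that(2) by simp
    also have "\<dots> = b" unfolding that(1) using that(3) by simp
    finally show ?thesis using that by simp
  qed
  have inj: "inj_on h (Sigma Q X)"
  proof (rule inj_onI)
    fix a b assume ab: "a \<in> Sigma Q X" "b \<in> Sigma Q X" "h a = h b"
    obtain j i p where a: "a = ((j, i), p)" by (cases a) auto
    obtain j' i' p' where b: "b = ((j', i'), p')" by (cases b) auto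
    note m = mem[OF ab(1)[unfolded a]] mem[OF ab(2)[unfolded b]]
    have "i * s + fst p = i' * s + fst p'" using ab(3) by (simp add: a b h_def)
    hence 1: "i = i'" "fst p = fst p'" using uniq[of i "fst p" i' "fst p'"] m by auto
    have "(i + j) * s + snd p = (i' + j') * s + snd p'" using m ab(3) by (simp add: a b)
    hence "i + j = i' + j'" "snd p = snd p'" using uniq[of "i + j" "snd p" "i' + j'" "snd p'"] m by auto
    thus "a = b" using 1 a b by (simp add: prod_eq_iff)
  qed
  have "(\<Sum>p\<in>Q. card (X p)) = card (Sigma Q X)"
    by (subst card_SigmaI) (auto simp: Q_def X_def)
  also have "\<dots> \<le> card {z. \<tau> z \<noteq> \<tau>' z}"
    using inj mem by (intro card_inj_on_le[OF _ _ D]) auto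
  finally have "(\<Sum>p\<in>Q. card (X p)) \<le> card {z. \<tau> z \<noteq> \<tau>' z}" .
  moreover have "strips_lis s q w \<tau> \<le> strips_lis s q w \<tau>' + (\<Sum>p\<in>Q. card (X p))"
  proof -
    have "strips_lis s q w \<tau> \<le> (\<Sum>j\<in>{1..w}. \<Sum>i<q. lis (zbox \<tau>' (i * s + 1) ((i + j) * s + 1) s) + card (X (j, i)))"
      unfolding strips_lis_def X_def prod.case by (intro sum_mono lis_zbox_le_add_diff)
    also have "\<dots> = strips_lis s q w \<tau>' + (\<Sum>p\<in>Q. card (X p))"
      unfolding strips_lis_def Q_def by (simp add: sum.distrib sum.cartesian_product)
    finally show ?thesis .
  qed
  ultimately show ?thesis by linarith
qed

lemma strips_lis_lipschitz:
  assumes "g permutes S" "\<tau> permutes S"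
  shows "\<bar>real (strips_lis s q w (conj_by (g \<circ> Transposition.transpose x y) \<tau>)) - real (strips_lis s q w (conj_by g \<tau>))\<bar> \<le> 4"
proof -
  let ?g = "conj_by g \<tau>" and ?h = "conj_by (g \<circ> Transposition.transpose x y) \<tau>"
  note d = conj_by_transpose_diff[OF assms, of x y]
  have sym: "{z. ?g z \<noteq> ?h z} = {z. ?h z \<noteq> ?g z}" by auto
  have "strips_lis s q w ?h \<le> strips_lis s q w ?g + 4"
    using strips_lis_diff[OF d(1), of s q w] d(2) by linarith
  moreover have "strips_lis s q w ?g \<le> strips_lis s q w ?h + 4"
    using strips_lis_diff[of ?g ?h s q w] d unfolding sym by linarith
  ultimately show ?thesis by linarith
qed

text \<open>With \<open>X = sqrt n / A\<close> there are \<open>w\<close> strips of at least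
  \<open>(1 - 5 * \<epsilon>) * X\<close> boxes, each with mean at least
  \<open>(2 - 5 * \<epsilon>) * (1 - 4 * \<epsilon>) * A\<close>. Reserving
  \<open>\<epsilon> * A\<close> per box for the deviation leaves at least
  \<open>(2 - 24 * \<epsilon>) * sqrt n\<close> per strip, which is why
  \<open>\<epsilon> = \<delta> / 12\<close>.\<close>

lemma card_conj_LIS_lower_tail:
  fixes \<delta> :: real
  assumes delta: "0 < \<delta>" "\<delta> \<le> 1"
  shows "\<exists>c>0. \<exists>N. \<forall>n\<ge>N. \<forall>\<tau>. \<tau> permutes {1..n} \<longrightarrow> (\<forall>x\<in>{1..n}. \<tau> x \<noteq> x) \<longrightarrow>
    real (card {g. g permutes {1..n} \<and> real (LIS n (conj_by g \<tau>)) < 2 * (1 - \<delta>) * sqrt n})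
      \<le> exp (- c * n) * fact n"
proof -
  define \<epsilon> where "\<epsilon> = \<delta> / 12"
  have e: "0 < \<epsilon>" "\<epsilon> \<le> 1 / 12" using delta by (auto simp: \<epsilon>_def)
  from card_lis_box_ge[OF e] obtain A N0 where A: "A > 0"
    and box: "\<forall>n\<ge>N0. \<forall>\<tau> \<alpha> \<beta> s. s = nat \<lceil>(1 + \<epsilon>) * A * sqrt n\<rceil> \<longrightarrow>
    \<tau> permutes {1..n} \<longrightarrow> (\<forall>x\<in>{1..n}. \<tau> x \<noteq> x) \<longrightarrow>
    1 \<le> \<alpha> \<longrightarrow> \<alpha> + s \<le> n + 1 \<longrightarrow> 1 \<le> \<beta> \<longrightarrow> \<beta> + s \<le> n + 1 \<longrightarrow> \<alpha> + s \<le> \<beta> \<or> \<beta> + s \<le> \<alpha> \<longrightarrow>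
    (1 - 4 * \<epsilon>) * fact n \<le>
      real (card {g. g permutes {1..n} \<and> (2 - 5 * \<epsilon>) * A \<le> real (lis (zbox (conj_by g \<tau>) \<alpha> \<beta> s))})"
    by (elim exE conjE)
  \<comment> \<open>The exponent of \<open>perm_lower_tail\<close> with Lipschitz constant 4 is
    \<open>y ^ 2 / (256 * n)\<close>, and \<open>y\<close> will be at least
    \<open>\<epsilon> ^ 2 * n / (2 * A)\<close>.\<close>
  define c where "c = \<epsilon> ^ 4 / (1024 * A\<^sup>2)"
  define R where "R = A / \<epsilon> + 1 / (\<epsilon> * A) + 1"
  define N where "N = N0 + nat \<lceil>R\<^sup>2\<rceil> + 1"
  have Rpos: "A / \<epsilon> > 0" "1 / (\<epsilon> * A) > 0" using e A by auto
  show ?thesis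
  proof (intro exI[of _ c] conjI exI[of _ N] allI impI)
    show "c > 0" using e A by (simp add: c_def)
    fix n \<tau>
    assume n: "N \<le> n" and \<tau>: "\<tau> permutes {1..n}" "\<forall>x\<in>{1..n}. \<tau> x \<noteq> x"
    have "real n \<ge> R\<^sup>2" using n unfolding N_def by linarith
    hence R: "R \<le> sqrt n" by (rule real_le_rsqrt)
    define X where "X = sqrt n / A"
    have X: "X \<ge> 1 / \<epsilon>" "\<epsilon> * A * sqrt n \<ge> 1" "X > 0"
    proof -
      have "A / \<epsilon> \<le> sqrt n" using R Rpos unfolding R_def by linarith
      thus "X \<ge> 1 / \<epsilon>" using A e by (simp add: X_def field_simps)
      moreover have "1 / \<epsilon> > 0" using e by simp
      ultimately show "X > 0" by linarith
      have "1 / (\<epsilon> * A) \<le> sqrt n" using R Rpos unfolding R_def by linarith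
      thus "\<epsilon> * A * sqrt n \<ge> 1" using A e by (simp add: field_simps)
    qed
    have eX: "\<epsilon> * X \<ge> 1" using X(1) e by (simp add: field_simps)
    have XA: "X * A = sqrt n" using A by (simp add: X_def)
    have n1: "n \<ge> 1" using n by (simp add: N_def)
    define s where "s = nat \<lceil>(1 + \<epsilon>) * A * sqrt n\<rceil>"
    define m where "m = n div s"
    \<comment> \<open>The number of strips is of order \<open>sqrt n\<close>, which brings the speed
      \<open>n\<close>, yet a small fraction of \<open>m\<close>, so that little of each strip is
      lost.\<close>
    define w where "w = nat \<lceil>\<epsilon> * X\<rceil>"
    \<comment> \<open>Strip \<open>j \<le> w\<close> is shifted by \<open>j\<close> blocks, so its
      first \<open>m - w\<close> boxes fit into the square.\<close>
    define q where "q = m - w"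
    have s: "0 < s" "s \<le> (1 + 2 * \<epsilon>) * A * sqrt n"
    proof -
      have pos: "(1 + \<epsilon>) * A * sqrt n > 0" using e A n1 by simp
      thus "0 < s" by (simp add: s_def)
      have "s \<le> (1 + \<epsilon>) * A * sqrt n + 1" using pos unfolding s_def by linarith
      thus "s \<le> (1 + 2 * \<epsilon>) * A * sqrt n" using X(2) by (simp add: algebra_simps)
    qed
    have m: "real m \<ge> (1 - 3 * \<epsilon>) * X"
    proof -
      have "n < (m + 1) * s" using s(1) unfolding m_def by (metis Suc_eq_plus1 dividend_less_div_times mult.commute mult_Suc add.commute)
      hence "real n \<le> (real m + 1) * s" by (metis less_imp_le of_nat_1 of_nat_add of_nat_le_iff of_nat_mult)
      also have "\<dots> \<le> (real m + 1) * ((1 + 2 * \<epsilon>) * A * sqrt n)" using s(2) by (intro mult_left_mono) auto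
      finally have "sqrt n * sqrt n \<le> ((real m + 1) * ((1 + 2 * \<epsilon>) * A)) * sqrt n" by (simp add: mult_ac)
      hence "sqrt n \<le> (real m + 1) * ((1 + 2 * \<epsilon>) * A)"
        by (rule mult_right_le_imp_le) (use n1 in simp)
      hence "X * A \<le> ((real m + 1) * (1 + 2 * \<epsilon>)) * A" unfolding XA by (simp add: mult_ac)
      hence X_le: "X \<le> (real m + 1) * (1 + 2 * \<epsilon>)" using A by (rule mult_right_le_imp_le)
      \<comment> \<open>Multiplying by \<open>1 - 2 * \<epsilon>\<close> replaces a division by
        \<open>1 + 2 * \<epsilon>\<close>; the rounding in \<open>m\<close> is absorbed by
        \<open>\<epsilon> * X \<ge> 1\<close>.\<close>
      have "(1 - 2 * \<epsilon>) * X \<le> (1 - 2 * \<epsilon>) * ((real m + 1) * (1 + 2 * \<epsilon>))"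
        using X_le e by (intro mult_left_mono) auto
      also have "\<dots> = (real m + 1) * (1 - 4 * \<epsilon>\<^sup>2)" by (simp add: power2_eq_square algebra_simps)
      also have "\<dots> \<le> (real m + 1) * 1" by (intro mult_left_mono) auto
      finally show ?thesis using eX by (simp add: algebra_simps)
    qed
    have w: "\<epsilon> * X \<le> w" "w \<le> 2 * \<epsilon> * X" "0 < w"
    proof -
      show "\<epsilon> * X \<le> w" unfolding w_def by linarith
      have "w \<le> \<epsilon> * X + 1" using eX unfolding w_def by linarith
      thus "w \<le> 2 * \<epsilon> * X" using eX by simp
      show "0 < w" using eX by (simp add: w_def)
    qed
    have q: "real q \<ge> (1 - 5 * \<epsilon>) * X"
    proof -
      have "real q \<ge> real m - real w" unfolding q_def by linarith
      thus ?thesis using m w(2) by (simp add: algebra_simps)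
    qed
    have mw: "w \<le> m" 
    proof -
      have "2 * \<epsilon> * X \<le> (1 - 3 * \<epsilon>) * X" using e X(3) by (intro mult_right_mono) auto
      hence "real w \<le> real m" using m w(2) by linarith
      thus ?thesis by simp
    qed
    have ms: "m * s \<le> n" unfolding m_def by (rule div_times_less_eq_dividend)
    have fit: "(i + 1) * s \<le> n" if "i < m" for i
    proof -
      have "(i + 1) * s \<le> m * s" using that by (intro mult_right_mono) auto
      thus ?thesis using ms by linarith
    qed
    define P where "P = {g. g permutes {1..n}}"
    have fP: "finite P" "card P = fact n" unfolding P_def by (simp_all add: finite_permutations card_permutations)
    define f where "f g = real (strips_lis s q w (conj_by g \<tau>))" for g
    define l where "l = (2 - 5 * \<epsilon>) * A"
    have l0: "l \<ge> 0" using e A by (simp add: l_def)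
    have boxsum: "(\<Sum>g\<in>P. real (lis (zbox (conj_by g \<tau>) (i * s + 1) ((i + j) * s + 1) s))) \<ge> l * ((1 - 4 * \<epsilon>) * fact n)"
      if ij: "i < q" "j \<in> {1..w}" for i j
    proof -
      define G where "G = {g. g permutes {1..n} \<and> l \<le> real (lis (zbox (conj_by g \<tau>) (i * s + 1) ((i + j) * s + 1) s))}"
      have im: "i < m" "i + j < m" using ij by (auto simp: q_def)
      have sep: "(i + 1) * s \<le> (i + j) * s" using ij by (intro mult_right_mono) auto
      have "N0 \<le> n" using n by (simp add: N_def)
      hence "(1 - 4 * \<epsilon>) * fact n \<le> real (card G)"
        unfolding G_def l_def
        by (rule box[rule_format]) (use fit[OF im(1)] fit[OF im(2)] sep \<tau> in \<open>auto simp: s_def[symmetric]\<close>)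
      \<comment> \<open>The box counts at least \<open>l\<close> on \<open>G\<close> and at least 0
        elsewhere.\<close>
      hence "l * ((1 - 4 * \<epsilon>) * fact n) \<le> l * real (card G)" using l0 by (rule mult_left_mono)
      also have "\<dots> = (\<Sum>g\<in>G. l)" by simp
      also have "\<dots> \<le> (\<Sum>g\<in>G. real (lis (zbox (conj_by g \<tau>) (i * s + 1) ((i + j) * s + 1) s)))"
        by (intro sum_mono) (auto simp: G_def)
      also have "\<dots> \<le> (\<Sum>g\<in>P. real (lis (zbox (conj_by g \<tau>) (i * s + 1) ((i + j) * s + 1) s)))"
        using fP(1) by (intro sum_mono2) (auto simp: G_def P_def)
      finally show ?thesis .
    qed
    define \<mu> where "\<mu> = (\<Sum>g\<in>P. f g) / fact n"
    have mu: "real w * real q * (l * (1 - 4 * \<epsilon>)) \<le> \<mu>"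
    proof -
      have "real w * real q * (l * ((1 - 4 * \<epsilon>) * fact n)) = (\<Sum>j\<in>{1..w}. \<Sum>i<q. l * ((1 - 4 * \<epsilon>) * fact n))"
        by simp
      also have "\<dots> \<le> (\<Sum>j\<in>{1..w}. \<Sum>i<q. \<Sum>g\<in>P. real (lis (zbox (conj_by g \<tau>) (i * s + 1) ((i + j) * s + 1) s)))"
        by (intro sum_mono boxsum) auto
      also have "\<dots> = (\<Sum>j\<in>{1..w}. \<Sum>g\<in>P. \<Sum>i<q. real (lis (zbox (conj_by g \<tau>) (i * s + 1) ((i + j) * s + 1) s)))"
        by (intro sum.cong refl sum.swap)
      also have "\<dots> = (\<Sum>g\<in>P. \<Sum>j\<in>{1..w}. \<Sum>i<q. real (lis (zbox (conj_by g \<tau>) (i * s + 1) ((i + j) * s + 1) s)))"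
        by (rule sum.swap)
      also have "\<dots> = (\<Sum>g\<in>P. f g)" unfolding f_def strips_lis_def by simp
      finally have "(real w * real q * (l * (1 - 4 * \<epsilon>))) * fact n \<le> (\<Sum>g\<in>P. f g)" by (simp add: mult_ac)
      thus ?thesis unfolding \<mu>_def by (simp add: le_divide_eq)
    qed
    define y where "y = real w * real q * (\<epsilon> * A)"
    have y0: "y \<ge> 0" using e A by (simp add: y_def)
    have low: "real w * (2 * (1 - \<delta>) * sqrt n) \<le> \<mu> - y"
    proof -
      have e2: "\<epsilon>\<^sup>2 \<ge> 0" by simp
      have "2 * (1 - \<delta>) = 2 - 24 * \<epsilon>" by (simp add: \<epsilon>_def)
      \<comment> \<open>\<open>1 - 5 * \<epsilon>\<close> is the loss in boxes;
        \<open>2 - 14 * \<epsilon>\<close> bounds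
        \<open>(2 - 5 * \<epsilon>) * (1 - 4 * \<epsilon>) - \<epsilon>\<close> from below.\<close>
      also have "\<dots> \<le> (1 - 5 * \<epsilon>) * (2 - 14 * \<epsilon>)" using e2 by (simp add: power2_eq_square algebra_simps)
      finally have "2 * (1 - \<delta>) * sqrt n \<le> ((1 - 5 * \<epsilon>) * (2 - 14 * \<epsilon>)) * sqrt n"
        by (rule mult_right_mono) simp
      also have "\<dots> = ((1 - 5 * \<epsilon>) * X) * ((2 - 14 * \<epsilon>) * A)" unfolding XA[symmetric] by (simp add: mult_ac)
      also have "\<dots> \<le> real q * ((2 - 14 * \<epsilon>) * A)" using q e A by (intro mult_right_mono) auto
      also have "\<dots> \<le> real q * (l * (1 - 4 * \<epsilon>) - \<epsilon> * A)"
      proof (rule mult_left_mono)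
        have "l * (1 - 4 * \<epsilon>) - \<epsilon> * A - (2 - 14 * \<epsilon>) * A = 20 * \<epsilon>\<^sup>2 * A"
          by (simp add: l_def power2_eq_square algebra_simps)
        moreover have "20 * \<epsilon>\<^sup>2 * A \<ge> 0" using A by simp
        ultimately show "(2 - 14 * \<epsilon>) * A \<le> l * (1 - 4 * \<epsilon>) - \<epsilon> * A" by linarith
      qed simp
      finally have "real w * (2 * (1 - \<delta>) * sqrt n) \<le> real w * (real q * (l * (1 - 4 * \<epsilon>) - \<epsilon> * A))"
        by (rule mult_left_mono) simp
      also have "\<dots> = real w * real q * (l * (1 - 4 * \<epsilon>)) - y" by (simp add: y_def algebra_simps)
      finally show ?thesis using mu by linarith
    qed
    have sub: "{g. g permutes {1..n} \<and> real (LIS n (conj_by g \<tau>)) < 2 * (1 - \<delta>) * sqrt n}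
        \<subseteq> {g. g permutes {1..n} \<and> f g \<le> (\<Sum>g | g permutes {1..n}. f g) / fact (card {1..n}) - y}"
    proof
      fix g assume g: "g \<in> {g. g permutes {1..n} \<and> real (LIS n (conj_by g \<tau>)) < 2 * (1 - \<delta>) * sqrt n}"
      have "strips_lis s q w (conj_by g \<tau>) \<le> w * LIS n (conj_by g \<tau>)"
        using s(1) fit by (intro strips_lis_le_LIS) (auto simp: q_def)
      hence "f g \<le> real w * real (LIS n (conj_by g \<tau>))" unfolding f_def by (metis of_nat_le_iff of_nat_mult)
      also have "\<dots> \<le> real w * (2 * (1 - \<delta>) * sqrt n)" using g by (intro mult_left_mono) auto
      also have "\<dots> \<le> \<mu> - y" by (rule low)
      finally show "g \<in> {g. g permutes {1..n} \<and> f g \<le> (\<Sum>g | g permutes {1..n}. f g) / fact (card {1..n}) - y}"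
        using g by (simp add: \<mu>_def P_def)
    qed
    have "real (card {g. g permutes {1..n} \<and> real (LIS n (conj_by g \<tau>)) < 2 * (1 - \<delta>) * sqrt n})
        \<le> real (card {g. g permutes {1..n} \<and> f g \<le> (\<Sum>g | g permutes {1..n}. f g) / fact (card {1..n}) - y})"
      unfolding of_nat_le_iff by (rule card_mono[OF finite_subset[OF _ fP(1)] sub]) (auto simp: P_def)
    also have "\<dots> \<le> fact (card {1..n}) * exp (- y\<^sup>2 / (16 * 4\<^sup>2 * real (card {1..n})))"
      using n1 y0 \<tau>(1) by (intro perm_lower_tail) (auto simp: f_def intro!: strips_lis_lipschitz)
    also have "\<dots> = exp (- (y\<^sup>2 / (256 * n))) * fact n" by simp
    also have "\<dots> \<le> exp (- c * n) * fact n"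
    proof -
      have "(\<epsilon> * X) * (X / 2) \<le> real w * real q"
      proof (intro mult_mono)
        have "X / 2 \<le> (1 - 5 * \<epsilon>) * X" using e X(3) by simp
        thus "X / 2 \<le> real q" using q by linarith
      qed (use w X e in auto)
      hence "(\<epsilon> * X) * (X / 2) * (\<epsilon> * A) \<le> y" unfolding y_def using e A by (intro mult_right_mono) auto
      also have "(\<epsilon> * X) * (X / 2) * (\<epsilon> * A) = \<epsilon>\<^sup>2 * (X * A) * (X * A) / (2 * A)"
        using A by (simp add: power2_eq_square)
      also have "\<dots> = \<epsilon>\<^sup>2 * n / (2 * A)" unfolding XA by (simp add: mult.assoc)
      finally have "(\<epsilon>\<^sup>2 * n / (2 * A))\<^sup>2 \<le> y\<^sup>2" using A by (intro power_mono) auto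
      hence "(\<epsilon>\<^sup>2 * n / (2 * A))\<^sup>2 / (256 * n) \<le> y\<^sup>2 / (256 * n)" by (rule divide_right_mono) simp
      moreover have "(\<epsilon>\<^sup>2 * n / (2 * A))\<^sup>2 / (256 * n) = c * n"
        using n1 A by (simp add: c_def power2_eq_square power4_eq_xxxx)
      ultimately show ?thesis by simp
    qed
    finally show "real (card {g. g permutes {1..n} \<and> real (LIS n (conj_by g \<tau>)) < 2 * (1 - \<delta>) * sqrt n})
      \<le> exp (- c * n) * fact n" .
  qed
qed

theorem proposition2p3:
  shows "\<forall>\<delta>::real. \<delta> > 0 \<longrightarrow>
    (\<exists>c::real. c > 0 \<and>
      (\<exists>N::nat. \<forall>t :: nat \<Rightarrow> nat \<Rightarrow> nat. \<forall>n\<ge>N.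
        is_cycle_type n (t n) \<and> t n 1 = 0 \<longrightarrow>
          measure_pmf.prob (random_cyclic_perm n (t n))
              {\<tau>. 1 / sqrt (real n) * real (LIS n \<tau>) < 2 * (1 - \<delta>)}
            \<le> exp (- c * real n) \<and>
          measure_pmf.prob (random_cyclic_perm n (t n))
              {\<tau>. 1 / sqrt (real n) * real (LIS n \<tau>) > 2 * (1 + \<delta>) * sqrt 3}
            \<le> exp (- c * sqrt (real n))))"
proof (intro allI impI)
  fix \<delta> :: real assume d: "\<delta> > 0"
  \<comment> \<open>For \<open>\<delta> > 1\<close> the lower threshold is negative;
    \<open>min \<delta> 1\<close> only enlarges the event and meets the assumption of
    \<open>card_conj_LIS_lower_tail\<close>.\<close>
  have "0 < min \<delta> 1" "min \<delta> 1 \<le> 1" using d by auto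
  from card_conj_LIS_lower_tail[OF this] obtain c1 N1 where c1: "c1 > 0"
    and low: "\<forall>n\<ge>N1. \<forall>\<tau>. \<tau> permutes {1..n} \<longrightarrow> (\<forall>x\<in>{1..n}. \<tau> x \<noteq> x) \<longrightarrow>
      real (card {g. g permutes {1..n} \<and> real (LIS n (conj_by g \<tau>)) < 2 * (1 - min \<delta> 1) * sqrt n})
        \<le> exp (- c1 * n) * fact n"
    by (elim exE conjE)
  from card_conj_LIS_upper_tail obtain c2 N2 where c2: "c2 > 0"
    and up: "\<forall>n\<ge>N2. \<forall>\<tau>. \<tau> permutes {1..n} \<longrightarrow> (\<forall>x\<in>{1..n}. \<tau> x \<noteq> x) \<longrightarrow>
      real (card {g. g permutes {1..n} \<and> real (LIS n (conj_by g \<tau>)) \<ge> 3 * sqrt n})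
        \<le> exp (- c2 * sqrt n) * fact n"
    by (elim exE conjE)
  have sqrt3: "3 \<le> 2 * (1 + \<delta>) * sqrt 3"
  proof -
    have "3 / 2 \<le> sqrt (3 :: real)" by (rule real_le_rsqrt) (simp add: power2_eq_square)
    hence "3 \<le> 2 * sqrt (3 :: real)" by simp
    also have "\<dots> \<le> 2 * (1 + \<delta>) * sqrt 3" using d by (intro mult_right_mono) auto
    finally show ?thesis .
  qed
  show "\<exists>c>0. \<exists>N. \<forall>t :: nat \<Rightarrow> nat \<Rightarrow> nat. \<forall>n\<ge>N.
        is_cycle_type n (t n) \<and> t n 1 = 0 \<longrightarrow>
          measure_pmf.prob (random_cyclic_perm n (t n))
              {\<tau>. 1 / sqrt (real n) * real (LIS n \<tau>) < 2 * (1 - \<delta>)}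
            \<le> exp (- c * real n) \<and>
          measure_pmf.prob (random_cyclic_perm n (t n))
              {\<tau>. 1 / sqrt (real n) * real (LIS n \<tau>) > 2 * (1 + \<delta>) * sqrt 3}
            \<le> exp (- c * sqrt (real n))"
  \<comment> \<open>The threshold depends on \<open>\<delta>\<close> alone, since both tail bounds
    are uniform in the permutation. Some threshold is unavoidable: for \<open>n = 2\<close> only the
    transposition qualifies, and for small \<open>\<delta>\<close> the first event has probability
    1.\<close>
  proof (rule exI[of _ "min c1 c2"], intro conjI exI[of _ "max 1 (max N1 N2)"] allI impI)
    show "min c1 c2 > 0" using c1 c2 by simp
    fix t :: "nat \<Rightarrow> nat \<Rightarrow> nat" and n
    assume n: "max 1 (max N1 N2) \<le> n" and ct: "is_cycle_type n (t n) \<and> t n 1 = 0"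
    have sn: "sqrt n > 0" using n by simp
    have prob_le: "measure_pmf.prob (random_cyclic_perm n (t n)) {\<tau>. P \<tau>} \<le> exp (- min c1 c2 * y)"
      if PQ: "\<And>\<tau>. P \<tau> \<Longrightarrow> Q \<tau>" and y: "y \<ge> 0" and c: "c = c1 \<or> c = c2"
        and bound: "\<And>\<tau>. \<tau> permutes {1..n} \<Longrightarrow> \<forall>x\<in>{1..n}. \<tau> x \<noteq> x \<Longrightarrow>
          real (card {g. g permutes {1..n} \<and> Q (conj_by g \<tau>)}) \<le> exp (- c * y) * fact n" for P Q c y
    proof (rule prob_random_cyclic_perm_le)
      show "is_cycle_type n (t n)" using ct by simp
      fix \<tau> assume \<tau>: "\<tau> \<in> cyclic_perms n (t n)"
      have "finite {g. g permutes {1..n} \<and> Q (conj_by g \<tau>)}"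
        by (rule finite_subset[OF _ finite_permutations[of "{1..n}"]]) auto
      hence "real (card {g. g permutes {1..n} \<and> conj_by g \<tau> \<in> {\<tau>. P \<tau>}})
          \<le> real (card {g. g permutes {1..n} \<and> Q (conj_by g \<tau>)})"
        unfolding of_nat_le_iff by (rule card_mono) (use PQ in auto)
      also have "\<dots> \<le> exp (- c * y) * fact n"
        using \<tau> ct cyclic_perms_no_fixpoint[OF \<tau>] by (intro bound) (auto simp: cyclic_perms_def)
      also have "\<dots> \<le> exp (- min c1 c2 * y) * fact n"
        using y c by (intro mult_right_mono) (auto intro: mult_right_mono)
      finally show "real (card {g. g permutes {1..n} \<and> conj_by g \<tau> \<in> {\<tau>. P \<tau>}}) \<le> exp (- min c1 c2 * y) * fact n" .
    qed
    show "measure_pmf.prob (random_cyclic_perm n (t n))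
        {\<tau>. 1 / sqrt (real n) * real (LIS n \<tau>) < 2 * (1 - \<delta>)} \<le> exp (- min c1 c2 * real n)"
    proof (rule prob_le[where Q = "\<lambda>\<tau>. real (LIS n \<tau>) < 2 * (1 - min \<delta> 1) * sqrt n" and c = c1])
      fix \<tau> assume "1 / sqrt (real n) * real (LIS n \<tau>) < 2 * (1 - \<delta>)"
      hence "real (LIS n \<tau>) < 2 * (1 - \<delta>) * sqrt n" using sn by (simp add: divide_less_eq)
      also have "\<dots> \<le> 2 * (1 - min \<delta> 1) * sqrt n" using sn by (intro mult_right_mono) auto
      finally show "real (LIS n \<tau>) < 2 * (1 - min \<delta> 1) * sqrt n" .
    qed (use low n in auto)
    show "measure_pmf.prob (random_cyclic_perm n (t n))
        {\<tau>. 1 / sqrt (real n) * real (LIS n \<tau>) > 2 * (1 + \<delta>) * sqrt 3} \<le> exp (- min c1 c2 * sqrt (real n))"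
    proof (rule prob_le[where Q = "\<lambda>\<tau>. 3 * sqrt n \<le> real (LIS n \<tau>)" and c = c2])
      fix \<tau> assume "1 / sqrt (real n) * real (LIS n \<tau>) > 2 * (1 + \<delta>) * sqrt 3"
      hence "2 * (1 + \<delta>) * sqrt 3 * sqrt n \<le> real (LIS n \<tau>)" using sn by (simp add: less_divide_eq)
      moreover have "3 * sqrt n \<le> 2 * (1 + \<delta>) * sqrt 3 * sqrt n" using sqrt3 by (rule mult_right_mono) simp
      ultimately show "3 * sqrt n \<le> real (LIS n \<tau>)" by linarith
    qed (use up n in auto)
  qed
qed

end
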